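(* Let $\mathcal S=(\mathcal M,X)$ be an irreducible concurrent system equipped with a Markov measure $\nu=(\nu_\alpha)_{\alpha\in X}$. Let $J$ be a final component of $\mathsf{DSC}^+$. Let $Q$ be the transition matrix of the Markov chain of state-and-cliques, restricted to $J$, and let $\pi_J$ be the unique invariant probability distribution of $Q$. Then the speedup $s$ of $\mathcal S$ is $$s=\sum_{(\alpha,d)\in J}|d|\,\pi_J\bigl((\alpha,d)\bigr),$$ and this quantity is independent of $J$.
   Context: Trace monoids. Let $\Sigma$ be a finite set and $I\subseteq\Sigma\times\Sigma$ irreflexive and symmetric. The trace monoid $\mathcal M=\mathcal M(\Sigma,I)$ is presented by $\langle\Sigma\mid ab=ba\text{ for }(a,b)\in I\rangle$. Its elements are traces, $\varepsilon$ is the unit, $|x|$ is the length of $x$, and $x\leqslant y$ means $y=xz$ for some $z\in\mathcal M$. $\mathcal M$ is irreducible if the graph $(\Sigma,(\Sigma\times\Sigma)\setminus I)$ is connected. A clique is a trace $a_1\cdots a_k$ of letters with $(a_i,a_j)\in I$ for $i\neq j$ (empty trace included); $\mathcal C$ is the set of cliques, identified with subsets of $\Sigma$. For cliques write $c\to d$ if for every letter $b\in d$ there is a letter $a\in c$ with $(a,b)\notin I$. Every trace $x$ has a unique normal form $x=c_1\cdots c_n$ with non-empty cliques $c_i\to c_{i+1}$; $\tau(x)=n$ is the height of $x$; put $C_i(x)=c_i$ for $i\leqslant n$ and $C_i(x)=\varepsilon$ for $i>n$. Infinite traces. An infinite trace is a sequence $\omega=(c_i)_{i\geqslant1}$ of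 non-empty cliques with $c_i\to c_{i+1}$ for all $i$; $C_i(\omega)=c_i$. The set $\partial\mathcal M$ of infinite traces carries its Borel $\sigma$-algebra. For $x\in\mathcal M$, $x\leqslant\omega$ means $x\leqslant C_1(\omega)\cdots C_n(\omega)$ for some $n$, and ${\uparrow}x=\{\omega\in\partial\mathcal M:x\leqslant\omega\}$. Concurrent systems. A concurrent system is a pair $(\mathcal M,X)$, $X$ a finite set of states, with a right monoid action of $\mathcal M$ on $X\sqcup\{\bot\}$, where $\bot\cdot x=\bot$ for all $x$. Put $\mathcal M_\alpha=\{x:\alpha\cdot x\neq\bot\}$, $\mathcal M_{\alpha,\beta}=\{x:\alpha\cdot x=\beta\}$, $\mathcal C_\alpha=\mathcal C\cap\mathcal M_\alpha$, and $\partial\mathcal M_\alpha=\{\omega\in\partial\mathcal M: x\in\mathcal M_\alpha\text{ for all }x\in\mathcal M\text{ with }x\leqslant\omega\}$. Non-trivial: $\alpha\cdot a\neq\bot$ for some $\alpha\in X$, $a\in\Sigma$. Transitive: $\mathcal M_{\alpha,\beta}\neq\emptyset$ for all $\alpha,\beta\in X$. Irreducible: (1) transitive and non-trivial; (2) $\mathcal M$ is irreducible; (3) for all $\alpha\in X$, $a\in\Sigma$ there is $u\in\mathcal M$ with $\alpha\cdot(ua)\neq\bot$. Markov measures. A Markov measure is a family $\nu=(\nu_\alpha)_{\alpha\in X}$ of probability measures on $\partial\mathcal M$ with $\nu_\alpha(\partial\mathcal M_\alpha)=1$, $x\in\mathcal M_\alpha\iff\nu_\alpha({\uparrow}x)>0$,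 and $\nu_\alpha({\uparrow}(xy))=\nu_\alpha({\uparrow}x)\,\nu_{\alpha\cdot x}({\uparrow}y)$ for all $\alpha,x,y$ (right-hand side $0$ if $\alpha\cdot x=\bot$). Speedup. The speedup is the limit $s=\lim|x|/\tau(x)$ as the finite trace $x\to\omega$, a constant independent of $\alpha\in X$ and, $\nu_\alpha$-almost surely, of $\omega\in\partial\mathcal M_\alpha$. The limit means: for every $\epsilon>0$ there is $x\in\mathcal M_\alpha$ with $x\leqslant\omega$ such that every non-empty $y\in\mathcal M_\alpha$ with $x\leqslant y\leqslant\omega$ satisfies $\bigl||y|/\tau(y)-s\bigr|<\epsilon$. State-and-cliques. A state-and-clique is a pair $(\alpha,c)$ with $\alpha\in X$, $c$ a non-empty clique, $\alpha\cdot c\neq\bot$. Write $(\alpha,c)\to(\beta,d)$ if $\beta=\alpha\cdot c$ and $c\to d$; this defines the digraph $\mathsf{DSC}$. $(\alpha,c)$ is stable if there is $x\in\mathcal M_\alpha$ such that every $z\in\mathcal M_\alpha$ with $x\leqslant z$ satisfies $C_1(z)=c$. $\mathsf{DSC}^+$ is the sub-digraph of $\mathsf{DSC}$ induced on stable state-and-cliques. A final component is a strongly connected component with no edge to another component. Transition matrix. Let $f_\alpha(x)=\nu_\alpha({\uparrow}x)$, $h_\alpha(c)=\sum_{c'\in\mathcal C,\,c\leqslant c'}(-1)^{|c'|-|c|}f_\alpha(c')$ and $g_\beta(c)=\sum_{d\in\mathcal C_\beta,\,c\to d}h_\beta(d)$. Under $\nu_\alpha$ the process $(\alpha_i,C_{i+1})_{i\geqslant0}$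 with $\alpha_0=\alpha$, $\alpha_{i+1}=\alpha_i\cdot C_{i+1}$ is a Markov chain (the Markov chain of state-and-cliques) with transition matrix $P_{(\alpha,c),(\beta,d)}=\mathbf 1_{\{(\alpha,c)\to(\beta,d)\}}\,h_\beta(d)/g_{\alpha\cdot c}(c)$, defined when $g_{\alpha\cdot c}(c)>0$ (which is the case for stable $(\alpha,c)$). *)

theory Defs
  imports
    "HOL-Algebra.Divisibility"
    "HOL-Probability.Probability"
    "Graph_Theory.Digraph_Component"
begin

section \<open>Trace monoids\<close>

text \<open>
  The alphabet is the whole finite type \<open>'a\<close>; \<open>I\<close> is the independence relation.  The presented
  monoid is the quotient of the free monoid \<open>'a list\<close> by the congruence generated by \<open>ab = ba\<close>,
  so a trace is an equivalence class of words.
\<close>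

locale independence =
  fixes I :: "('a::finite \<times> 'a) set"
  assumes irrefl_I: "irrefl I" and sym_I: "sym I"

definition trace_step :: "('a \<times> 'a) set \<Rightarrow> ('a list \<times> 'a list) set" where
  "trace_step I = {(u @ [a, b] @ v, u @ [b, a] @ v) | u v a b. (a, b) \<in> I}"

definition trace_equiv :: "('a \<times> 'a) set \<Rightarrow> ('a list \<times> 'a list) set" where
  "trace_equiv I = (trace_step I \<union> (trace_step I)\<inverse>)\<^sup>*"

definition trace_of :: "('a \<times> 'a) set \<Rightarrow> 'a list \<Rightarrow> 'a list set" where
  "trace_of I w = trace_equiv I `` {w}"

definition trace_monoid :: "('a \<times> 'a) set \<Rightarrow> 'a list set monoid" where
  "trace_monoid I =
     \<lparr> carrier = UNIV // trace_equiv I,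
       mult = (\<lambda>x y. \<Union>u\<in>x. \<Union>v\<in>y. trace_of I (u @ v)),
       one = trace_of I [] \<rparr>"

lemma equiv_trace_equiv: "equiv UNIV (trace_equiv I)"
  unfolding trace_equiv_def
  by (intro equivI refl_rtrancl trans_rtrancl sym_rtrancl sym_Un_converse) simp

lemma trace_equiv_append:
  assumes "(u, u') \<in> trace_equiv I" "(v, v') \<in> trace_equiv I"
  shows "(u @ v, u' @ v') \<in> trace_equiv I"
proof -
  let ?R = "trace_step I \<union> (trace_step I)\<inverse>"
  have l: "(p @ x, p @ y) \<in> ?R" and r: "(x @ p, y @ p) \<in> ?R" if "(x, y) \<in> ?R" for p x y
  proof -
    from that obtain s t a b where st:
      "x = s @ [a, b] @ t \<and> y = s @ [b, a] @ t \<or> y = s @ [a, b] @ t \<and> x = s @ [b, a] @ t"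
      and ab: "(a, b) \<in> I" unfolding trace_step_def by fast
    have A: "((p @ s) @ [a, b] @ t, (p @ s) @ [b, a] @ t) \<in> trace_step I"
      and B: "(s @ [a, b] @ (t @ p), s @ [b, a] @ (t @ p)) \<in> trace_step I"
      unfolding trace_step_def using ab by blast+
    show "(p @ x, p @ y) \<in> ?R" using st A by (elim disjE) simp_all
    show "(x @ p, y @ p) \<in> ?R" using st B by (elim disjE) simp_all
  qed
  have "(u @ v, u' @ v) \<in> ?R\<^sup>*"
    using assms(1)[unfolded trace_equiv_def]
  proof (induction rule: rtrancl_induct)
    case base show ?case by (rule rtrancl.rtrancl_refl)
  next
    case (step y z) show ?case by (rule rtrancl_into_rtrancl[OF step.IH r[OF step.hyps(2)]])
  qed
  moreover have "(u' @ v, u' @ v') \<in> ?R\<^sup>*"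
    using assms(2)[unfolded trace_equiv_def]
  proof (induction rule: rtrancl_induct)
    case base show ?case by (rule rtrancl.rtrancl_refl)
  next
    case (step y z) show ?case by (rule rtrancl_into_rtrancl[OF step.IH l[OF step.hyps(2)]])
  qed
  ultimately show ?thesis unfolding trace_equiv_def by (rule rtrancl_trans)
qed

lemma trace_of_eq_iff: "trace_of I u = trace_of I v \<longleftrightarrow> (u, v) \<in> trace_equiv I"
  unfolding trace_of_def using eq_equiv_class_iff[OF equiv_trace_equiv] by auto

lemma trace_mult: "trace_of I u \<otimes>\<^bsub>trace_monoid I\<^esub> trace_of I v = trace_of I (u @ v)"
proof -
  have "trace_of I (u' @ v') = trace_of I (u @ v)" if "u' \<in> trace_of I u" "v' \<in> trace_of I v" for u' v'
  proof -
    have "(u, u') \<in> trace_equiv I" "(v, v') \<in> trace_equiv I"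
      using that unfolding trace_of_def by blast+
    then show ?thesis using trace_equiv_append trace_of_eq_iff by metis
  qed
  moreover have "u \<in> trace_of I u" "v \<in> trace_of I v"
    by (auto simp: trace_of_def trace_equiv_def)
  ultimately show ?thesis unfolding trace_monoid_def monoid.simps by blast
qed

lemma carrier_trace_monoid: "carrier (trace_monoid I) = range (trace_of I)"
  unfolding trace_monoid_def quotient_def trace_of_def by auto

lemma monoid_trace_monoid: "Group.monoid (trace_monoid I)"
proof -
  have one: "\<one>\<^bsub>trace_monoid I\<^esub> = trace_of I []" by (simp add: trace_monoid_def)
  show ?thesis
    by (rule monoidI) (unfold carrier_trace_monoid one, auto simp: trace_mult)
qed

abbreviation trace_le :: "('a \<times> 'a) set \<Rightarrow> 'a list set \<Rightarrow> 'a list set \<Rightarrow> bool" where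
  "trace_le I x y \<equiv> x divides\<^bsub>trace_monoid I\<^esub> y"

text \<open>All words of a trace have the same length.\<close>

definition trace_length :: "'a list set \<Rightarrow> nat" where
  "trace_length x = length (SOME w. w \<in> x)"

lemma trace_length_trace_of: "trace_length (trace_of I w) = length w"
proof -
  have "length v = length w" if "(w, v) \<in> trace_equiv I" for v
    using that unfolding trace_equiv_def
    by (induction rule: rtrancl_induct) (auto simp: trace_step_def)
  moreover have "w \<in> trace_of I w" by (auto simp: trace_of_def trace_equiv_def)
  ultimately show ?thesis
    unfolding trace_length_def by (metis (mono_tags) Image_singleton_iff someI trace_of_def)
qed

definition irreducible_trace_monoid :: "('a \<times> 'a) set \<Rightarrow> bool" where
  "irreducible_trace_monoid I \<longleftrightarrow>
     Digraph_Component.connected (with_proj \<lparr> pverts = UNIV, parcs = UNIV \<times> UNIV - I \<rparr>)"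

text \<open>A clique is represented by its set of letters; the order in which the letters are
  multiplied in \<open>clique_trace\<close> is irrelevant.\<close>

definition clique :: "('a \<times> 'a) set \<Rightarrow> 'a set \<Rightarrow> bool" where
  "clique I c \<longleftrightarrow> (\<forall>a\<in>c. \<forall>b\<in>c. a \<noteq> b \<longrightarrow> (a, b) \<in> I)"

definition clique_trace :: "('a \<times> 'a) set \<Rightarrow> 'a set \<Rightarrow> 'a list set" where
  "clique_trace I c = trace_of I (SOME w. distinct w \<and> set w = c)"

lemma clique_trace_eq:
  assumes "clique I c" "distinct w" "set w = c"
  shows "clique_trace I c = trace_of I w"
proof -
  have move: "trace_of I (p @ a # q) = trace_of I (a # p @ q)" if "\<forall>b\<in>set p. (b, a) \<in> I" for p q a
    using that
  proof (induction p arbitrary: q rule: rev_induct)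
    case (snoc b p)
    have "(p @ [b, a] @ q, p @ [a, b] @ q) \<in> trace_step I"
      unfolding trace_step_def using snoc.prems by auto
    then have "trace_of I (p @ [b, a] @ q) = trace_of I (p @ [a, b] @ q)"
      unfolding trace_of_eq_iff trace_equiv_def by blast
    with snoc show ?case by simp
  qed simp
  have "trace_of I v = trace_of I w"
    if "clique I (set w)" "distinct v" "distinct w" "set v = set w" for v w
    using that
  proof (induction v arbitrary: w)
    case (Cons a v)
    then obtain p q where w: "w = p @ a # q" by (metis list.set_intros(1) split_list)
    have "\<forall>b\<in>set p. (b, a) \<in> I" using Cons.prems by (auto simp: w clique_def)
    then have "trace_of I w = trace_of I (a # p @ q)" unfolding w by (rule move)
    moreover have "trace_of I v = trace_of I (p @ q)"
      using Cons.prems by (intro Cons.IH) (auto simp: w clique_def)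
    then have "trace_of I ([a] @ v) = trace_of I ([a] @ p @ q)" by (metis trace_mult)
    ultimately show ?case by simp
  qed simp
  moreover have "distinct (SOME v. distinct v \<and> set v = c) \<and> set (SOME v. distinct v \<and> set v = c) = c"
    by (rule someI[where x = w]) (use assms in simp)
  ultimately show ?thesis using assms unfolding clique_trace_def by metis
qed

definition clique_arrow :: "('a \<times> 'a) set \<Rightarrow> 'a set \<Rightarrow> 'a set \<Rightarrow> bool" where
  "clique_arrow I c d \<longleftrightarrow> (\<forall>b\<in>d. \<exists>a\<in>c. (a, b) \<notin> I)"

definition clique_product :: "('a \<times> 'a) set \<Rightarrow> 'a set list \<Rightarrow> 'a list set" where
  "clique_product I cs =
     foldr (\<lambda>c x. clique_trace I c \<otimes>\<^bsub>trace_monoid I\<^esub> x) cs \<one>\<^bsub>trace_monoid I\<^esub>"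

definition is_normal_form :: "('a \<times> 'a) set \<Rightarrow> 'a list set \<Rightarrow> 'a set list \<Rightarrow> bool" where
  "is_normal_form I x cs \<longleftrightarrow>
     (\<forall>c\<in>set cs. clique I c \<and> c \<noteq> {}) \<and> successively (clique_arrow I) cs
     \<and> clique_product I cs = x"

definition normal_form :: "('a \<times> 'a) set \<Rightarrow> 'a list set \<Rightarrow> 'a set list" where
  "normal_form I x = (THE cs. is_normal_form I x cs)"

definition height :: "('a \<times> 'a) set \<Rightarrow> 'a list set \<Rightarrow> nat" where
  "height I x = length (normal_form I x)"

text \<open>Positions are counted from 0 here: \<open>nf_clique I x i\<close> is $C_{i+1}(x)$.\<close>

definition nf_clique :: "('a \<times> 'a) set \<Rightarrow> 'a list set \<Rightarrow> nat \<Rightarrow> 'a set" where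
  "nf_clique I x i = (if i < height I x then normal_form I x ! i else {})"


section \<open>Infinite traces\<close>

text \<open>Again \<open>\<omega> i\<close> is $C_{i+1}(\omega)$.\<close>

definition boundary :: "('a \<times> 'a) set \<Rightarrow> (nat \<Rightarrow> 'a set) set" where
  "boundary I = {\<omega>. \<forall>i. clique I (\<omega> i) \<and> \<omega> i \<noteq> {} \<and> clique_arrow I (\<omega> i) (\<omega> (Suc i))}"

text \<open>The boundary carries the topology induced by the product of the discrete topologies.\<close>

definition boundary_topology :: "('a \<times> 'a) set \<Rightarrow> (nat \<Rightarrow> 'a set) topology" where
  "boundary_topology I =
     subtopology (product_topology (\<lambda>_. discrete_topology UNIV) UNIV) (boundary I)"

definition boundary_borel :: "('a \<times> 'a) set \<Rightarrow> (nat \<Rightarrow> 'a set) measure" where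
  "boundary_borel I = sigma (boundary I) {U. openin (boundary_topology I) U}"

definition prefix_of :: "('a \<times> 'a) set \<Rightarrow> 'a list set \<Rightarrow> (nat \<Rightarrow> 'a set) \<Rightarrow> bool" where
  "prefix_of I x \<omega> \<longleftrightarrow> (\<exists>n. trace_le I x (clique_product I (map \<omega> [0..<n])))"

definition cylinder :: "('a \<times> 'a) set \<Rightarrow> 'a list set \<Rightarrow> (nat \<Rightarrow> 'a set) set" where
  "cylinder I x = {\<omega> \<in> boundary I. prefix_of I x \<omega>}"


section \<open>Concurrent systems\<close>

text \<open>The set of states is the whole finite type \<open>'s\<close>, and \<open>None\<close> plays the role of the sink
  \<open>\<bottom>\<close>.  The values of \<open>act\<close> outside the carrier of the trace monoid are irrelevant.\<close>

locale concurrent_system = independence I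
  for I :: "('a::finite \<times> 'a) set" +
  fixes act :: "'s::finite option \<Rightarrow> 'a list set \<Rightarrow> 's option"
  assumes act_one: "act p \<one>\<^bsub>trace_monoid I\<^esub> = p"
    and act_mult: "\<lbrakk> x \<in> carrier (trace_monoid I); y \<in> carrier (trace_monoid I) \<rbrakk>
      \<Longrightarrow> act p (x \<otimes>\<^bsub>trace_monoid I\<^esub> y) = act (act p x) y"
    and act_bot: "x \<in> carrier (trace_monoid I) \<Longrightarrow> act None x = None"

context
  fixes I :: "('a::finite \<times> 'a) set" and act :: "'s::finite option \<Rightarrow> 'a list set \<Rightarrow> 's option"
begin

definition traces_from :: "'s \<Rightarrow> 'a list set set" where
  "traces_from \<alpha> = {x \<in> carrier (trace_monoid I). act (Some \<alpha>) x \<noteq> None}"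

definition traces_between :: "'s \<Rightarrow> 's \<Rightarrow> 'a list set set" where
  "traces_between \<alpha> \<beta> = {x \<in> carrier (trace_monoid I). act (Some \<alpha>) x = Some \<beta>}"

definition cliques_from :: "'s \<Rightarrow> 'a set set" where
  "cliques_from \<alpha> = {c. clique I c \<and> clique_trace I c \<in> traces_from \<alpha>}"

definition boundary_from :: "'s \<Rightarrow> (nat \<Rightarrow> 'a set) set" where
  "boundary_from \<alpha> =
     {\<omega> \<in> boundary I. \<forall>x\<in>carrier (trace_monoid I). prefix_of I x \<omega> \<longrightarrow> x \<in> traces_from \<alpha>}"

definition nontrivial_system :: bool where
  "nontrivial_system \<longleftrightarrow> (\<exists>\<alpha> a. act (Some \<alpha>) (trace_of I [a]) \<noteq> None)"

definition transitive_system :: bool where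
  "transitive_system \<longleftrightarrow> (\<forall>\<alpha> \<beta>. traces_between \<alpha> \<beta> \<noteq> {})"

definition irreducible_system :: bool where
  "irreducible_system \<longleftrightarrow>
     transitive_system \<and> nontrivial_system \<and> irreducible_trace_monoid I \<and>
     (\<forall>\<alpha> a. \<exists>u\<in>carrier (trace_monoid I).
        act (Some \<alpha>) (u \<otimes>\<^bsub>trace_monoid I\<^esub> trace_of I [a]) \<noteq> None)"


section \<open>Markov measures and the speedup\<close>

definition markov_measure :: "('s \<Rightarrow> (nat \<Rightarrow> 'a set) measure) \<Rightarrow> bool" where
  "markov_measure \<nu> \<longleftrightarrow>
     (\<forall>\<alpha>. prob_space (\<nu> \<alpha>) \<and> space (\<nu> \<alpha>) = boundary I \<and> sets (\<nu> \<alpha>) = sets (boundary_borel I)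
        \<and> measure (\<nu> \<alpha>) (boundary_from \<alpha>) = 1) \<and>
     (\<forall>\<alpha>. \<forall>x\<in>carrier (trace_monoid I).
        x \<in> traces_from \<alpha> \<longleftrightarrow> measure (\<nu> \<alpha>) (cylinder I x) > 0) \<and>
     (\<forall>\<alpha>. \<forall>x\<in>carrier (trace_monoid I). \<forall>y\<in>carrier (trace_monoid I).
        measure (\<nu> \<alpha>) (cylinder I (x \<otimes>\<^bsub>trace_monoid I\<^esub> y)) =
          (case act (Some \<alpha>) x of
             None \<Rightarrow> 0
           | Some \<beta> \<Rightarrow> measure (\<nu> \<alpha>) (cylinder I x) * measure (\<nu> \<beta>) (cylinder I y)))"

definition speed_limit :: "'s \<Rightarrow> (nat \<Rightarrow> 'a set) \<Rightarrow> real \<Rightarrow> bool" where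
  "speed_limit \<alpha> \<omega> s \<longleftrightarrow>
     (\<forall>\<epsilon>>0. \<exists>x\<in>traces_from \<alpha>. prefix_of I x \<omega> \<and>
        (\<forall>y\<in>traces_from \<alpha>. y \<noteq> \<one>\<^bsub>trace_monoid I\<^esub> \<and> trace_le I x y \<and> prefix_of I y \<omega> \<longrightarrow>
           \<bar>real (trace_length y) / real (height I y) - s\<bar> < \<epsilon>))"

definition is_speedup :: "('s \<Rightarrow> (nat \<Rightarrow> 'a set) measure) \<Rightarrow> real \<Rightarrow> bool" where
  "is_speedup \<nu> s \<longleftrightarrow> (\<forall>\<alpha>. AE \<omega> in \<nu> \<alpha>. \<omega> \<in> boundary_from \<alpha> \<and> speed_limit \<alpha> \<omega> s)"

definition speedup :: "('s \<Rightarrow> (nat \<Rightarrow> 'a set) measure) \<Rightarrow> real" where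
  "speedup \<nu> = (THE s. is_speedup \<nu> s)"


section \<open>States-and-cliques\<close>

definition state_clique :: "'s \<times> 'a set \<Rightarrow> bool" where
  "state_clique = (\<lambda>(\<alpha>, c). clique I c \<and> c \<noteq> {} \<and> act (Some \<alpha>) (clique_trace I c) \<noteq> None)"

definition sc_arrow :: "'s \<times> 'a set \<Rightarrow> 's \<times> 'a set \<Rightarrow> bool" where
  "sc_arrow = (\<lambda>(\<alpha>, c) (\<beta>, d). act (Some \<alpha>) (clique_trace I c) = Some \<beta> \<and> clique_arrow I c d)"

definition stable :: "'s \<times> 'a set \<Rightarrow> bool" where
  "stable = (\<lambda>(\<alpha>, c). state_clique (\<alpha>, c) \<and>
     (\<exists>x\<in>traces_from \<alpha>. \<forall>z\<in>traces_from \<alpha>. trace_le I x z \<longrightarrow> nf_clique I z 0 = c))"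

definition DSC :: "('s \<times> 'a set, ('s \<times> 'a set) \<times> 's \<times> 'a set) pre_digraph" where
  "DSC = with_proj
     \<lparr> pverts = {p. state_clique p},
       parcs = {(p, q). state_clique p \<and> state_clique q \<and> sc_arrow p q} \<rparr>"

definition DSC_plus :: "('s \<times> 'a set, ('s \<times> 'a set) \<times> 's \<times> 'a set) pre_digraph" where
  "DSC_plus = DSC \<restriction> {p. stable p}"

end

definition final_component :: "('v, 'e) pre_digraph \<Rightarrow> 'v set \<Rightarrow> bool" where
  "final_component G J \<longleftrightarrow>
     J \<in> verts ` pre_digraph.sccs G \<and> (\<forall>e\<in>arcs G. tail G e \<in> J \<longrightarrow> head G e \<in> J)"


section \<open>The Markov chain of states-and-cliques\<close>

context
  fixes I :: "('a::finite \<times> 'a) set" and act :: "'s::finite option \<Rightarrow> 'a list set \<Rightarrow> 's option"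
    and \<nu> :: "'s \<Rightarrow> (nat \<Rightarrow> 'a set) measure"
begin

definition f_val :: "'s \<Rightarrow> 'a list set \<Rightarrow> real" where
  "f_val \<alpha> x = measure (\<nu> \<alpha>) (cylinder I x)"

definition h_val :: "'s \<Rightarrow> 'a set \<Rightarrow> real" where
  "h_val \<alpha> c =
     (\<Sum>c' | clique I c' \<and> trace_le I (clique_trace I c) (clique_trace I c').
        (-1) ^ (card c' - card c) * f_val \<alpha> (clique_trace I c'))"

definition g_val :: "'s \<Rightarrow> 'a set \<Rightarrow> real" where
  "g_val \<beta> c = (\<Sum>d | d \<in> cliques_from I act \<beta> \<and> clique_arrow I c d. h_val \<beta> d)"

text \<open>Along an arrow $(\alpha,c) \to (\beta,d)$ one has $\beta = \alpha\cdot c$, so the denominator is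
  $g_{\alpha\cdot c}(c)$.\<close>

definition transition :: "'s \<times> 'a set \<Rightarrow> 's \<times> 'a set \<Rightarrow> real" where
  "transition = (\<lambda>(\<alpha>, c) (\<beta>, d).
     if sc_arrow I act (\<alpha>, c) (\<beta>, d) then h_val \<beta> d / g_val \<beta> c else 0)"

end

definition invariant_distribution :: "('v \<Rightarrow> 'v \<Rightarrow> real) \<Rightarrow> 'v set \<Rightarrow> 'v pmf \<Rightarrow> bool" where
  "invariant_distribution Q J \<pi> \<longleftrightarrow>
     set_pmf \<pi> \<subseteq> J \<and> (\<forall>q\<in>J. (\<Sum>p\<in>J. pmf \<pi> p * Q p q) = pmf \<pi> q)"

end

theory Submission
  imports Defs "HOL-Library.Sublist"
begin

text \<open>The speedup is found by comparing two descriptions of a random infinite trace: the Markov chain of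
  states-and-cliques, which governs the levels of its normal form, and concatenation on the left, under which
  a Markov measure is multiplicative.

  Fix a final component \<open>J\<close> with invariant distribution \<open>\<pi>\<close>. For a trace whose
  first clique puts the chain into \<open>J\<close>, the frequency of a letter \<open>a\<close> among the
  first \<open>n\<close> cliques converges almost surely to \<open>\<theta> a\<close>, the
  \<open>\<pi>\<close>-mass of the nodes whose clique contains \<open>a\<close>
  (\<open>AE_letter_frequency_start\<close>). This is an ergodic theorem for finite irreducible chains: a
  solution of the Poisson equation reduces it to a law of large numbers for bounded martingale differences.

  The nodes of \<open>J\<close> are stable, so there is a finite trace \<open>x\<close> that forces such a
  first clique. Left concatenation with \<open>x\<close> shifts each letter by a bounded number of levels and
  hence preserves frequencies, and it maps \<open>\<nu> (\<alpha>\<cdot>x)\<close> to a multiple of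
  \<open>\<nu> \<alpha>\<close> restricted to the cylinder of \<open>x\<close>. So the frequencies are
  \<open>\<theta>\<close> almost surely from the state \<open>\<alpha>\<cdot>x\<close> as well, and by
  transitivity from every state (\<open>AE_letter_frequency\<close>). As the limit is taken under measures
  that do not depend on \<open>J\<close>, it is the same for all final components; its sum over the letters is
  the mean clique size under \<open>\<pi>\<close>.

  Two facts use the irreducibility of the trace monoid. First, every letter almost surely occurs
  (\<open>measure_avoids\<close>). The proof inserts a trace in which all letters lie above one occurrence of
  the letter \<open>a\<close> into traces that avoid \<open>a\<close>; the place of insertion can be
  recognised afterwards up to finitely many possibilities, so a positive mass would be reproduced infinitely
  often with bounded overlap. Consequently a node is stable exactly if it has positive probability
  (\<open>stable_iff\<close>), the chain stays inside \<open>J\<close>, and all \<open>\<theta> a\<close> are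
  positive. Second, the speedup is a limit over all finite prefixes \<open>y\<close>, which may have ragged
  ends. Positive frequencies provide, in each proportional stretch of levels, enough consecutive blocks
  containing all letters; a prefix that reaches beyond such a stretch contains everything before it
  (\<open>prefix_beyond_blocks\<close>). So a prefix of large height \<open>m\<close> lies between the first
  \<open>r m\<close> and the first \<open>m\<close> cliques, with \<open>r\<close> arbitrarily close to 1.\<close>

section \<open>Traces through their projections\<close>

definition proj :: "'a \<Rightarrow> 'a \<Rightarrow> 'a list \<Rightarrow> 'a list" where
  "proj a b w = filter (\<lambda>c. c = a \<or> c = b) w"

text \<open>Equality and prefix order of traces, tested on pairs of dependent letters. Commuting letters are
  never compared; a letter depends on itself, and the pair \<open>(a, a)\<close> records how often
  \<open>a\<close> occurs. The lemmas \<open>trace_of_eq_iff_teq\<close> and \<open>trace_le_iff_tle\<close>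
  identify these relations with those of the presented monoid, which reduces cancellation and comparison of
  traces to facts about words.\<close>

definition teq :: "('a \<times> 'a) set \<Rightarrow> 'a list \<Rightarrow> 'a list \<Rightarrow> bool" where
  "teq I u v \<longleftrightarrow> (\<forall>a b. (a, b) \<notin> I \<longrightarrow> proj a b u = proj a b v)"

definition tle :: "('a \<times> 'a) set \<Rightarrow> 'a list \<Rightarrow> 'a list \<Rightarrow> bool" where
  "tle I u v \<longleftrightarrow> (\<forall>a b. (a, b) \<notin> I \<longrightarrow> prefix (proj a b u) (proj a b v))"

lemma proj_append [simp]: "proj a b (u @ v) = proj a b u @ proj a b v"
  by (simp add: proj_def)

lemma proj_Nil [simp]: "proj a b [] = []"
  by (simp add: proj_def)

lemma proj_Cons: "proj a b (c # w) = (if c = a \<or> c = b then c # proj a b w else proj a b w)"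
  by (simp add: proj_def)

lemma length_proj:
  "length (proj a b w) = (if a = b then count_list w a else count_list w a + count_list w b)"
  by (induction w) (auto simp: proj_def)

lemma trace_of_move:
  "\<forall>b\<in>set p. (b, a) \<in> I \<Longrightarrow> trace_of I (p @ a # q) = trace_of I (a # p @ q)"
proof (induction p arbitrary: q rule: rev_induct)
  case (snoc b p)
  have "(p @ [b, a] @ q, p @ [a, b] @ q) \<in> trace_step I"
    unfolding trace_step_def using snoc.prems by auto
  then have "trace_of I (p @ [b, a] @ q) = trace_of I (p @ [a, b] @ q)"
    unfolding trace_of_eq_iff trace_equiv_def by blast
  with snoc show ?case by simp
qed simp

lemma tle_refl [simp]: "tle I u u"
  by (simp add: tle_def)

lemma tle_trans: "tle I u v \<Longrightarrow> tle I v w \<Longrightarrow> tle I u w"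
  unfolding tle_def using prefix_order.trans by blast

lemma tle_append [simp]: "tle I u (u @ v)"
  by (simp add: tle_def)

lemma tle_Nil [simp]: "tle I [] v"
  by (simp add: tle_def)

lemma tle_append_same [simp]: "tle I (p @ u) (p @ v) \<longleftrightarrow> tle I u v"
  by (simp add: tle_def)

lemma teq_imp_tle: "teq I u v \<Longrightarrow> tle I u v"
  by (simp add: tle_def teq_def)

lemma teq_refl [simp]: "teq I u u"
  by (simp add: teq_def)

lemma teq_sym: "teq I u v \<Longrightarrow> teq I v u"
  by (simp add: teq_def)

lemma teq_trans: "teq I u v \<Longrightarrow> teq I v w \<Longrightarrow> teq I u w"
  by (simp add: teq_def)

lemma teq_append: "teq I u u' \<Longrightarrow> teq I v v' \<Longrightarrow> teq I (u @ v) (u' @ v')"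
  by (simp add: teq_def)

lemma teq_append_left_cancel [simp]: "teq I (p @ u) (p @ v) \<longleftrightarrow> teq I u v"
  by (simp add: teq_def)

lemma teq_append_right_cancel [simp]: "teq I (u @ p) (v @ p) \<longleftrightarrow> teq I u v"
  by (simp add: teq_def)

context independence
begin

lemma not_I_refl [simp]: "(a, a) \<notin> I"
  using irrefl_I by (simp add: irrefl_def)

lemma I_sym: "(a, b) \<in> I \<Longrightarrow> (b, a) \<in> I"
  using sym_I by (auto dest: symD)

lemma I_commute: "(a, b) \<in> I \<longleftrightarrow> (b, a) \<in> I"
  using I_sym by blast

lemma teq_if_trace_equiv: "(u, v) \<in> trace_equiv I \<Longrightarrow> teq I u v"
  unfolding trace_equiv_def
proof (induction rule: rtrancl_induct)
  case (step v w)
  then obtain p q c d where cd: "(c, d) \<in> I"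
    and vw: "v = p @ [c, d] @ q \<and> w = p @ [d, c] @ q \<or> w = p @ [c, d] @ q \<and> v = p @ [d, c] @ q"
    unfolding trace_step_def by blast
  have "proj a b [c, d] = proj a b [d, c]" if "(a, b) \<notin> I" for a b
    using that cd I_sym by (auto simp: proj_def)
  then have "teq I [c, d] [d, c]" by (simp add: teq_def)
  then have "teq I ([c, d] @ q) ([d, c] @ q)" by (intro teq_append teq_refl)
  then have "teq I v w" using vw teq_sym by (metis teq_append_left_cancel)
  with step.IH show ?case by (rule teq_trans)
qed simp

lemma trace_of_eq_imp_teq: "trace_of I u = trace_of I v \<Longrightarrow> teq I u v"
  by (simp add: teq_if_trace_equiv trace_of_eq_iff)

text \<open>The first letter of \<open>u\<close> occurs in \<open>v\<close>, and no letter that depends on it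
  can precede its first occurrence there, for otherwise the projection of \<open>v\<close> to these two
  letters would start with the wrong one. So this occurrence can be moved to the front and cancelled.\<close>

lemma tle_imp_factor: "tle I u v \<Longrightarrow> \<exists>z. trace_of I (u @ z) = trace_of I v"
proof (induction u arbitrary: v)
  case (Cons a u)
  have "prefix (proj a a (a # u)) (proj a a v)"
    using Cons.prems unfolding tle_def by simp
  then have "a \<in> set v" by (auto simp: proj_Cons proj_def dest: set_mono_prefix)
  then obtain p q where v: "v = p @ a # q" and ap: "a \<notin> set p"
    by (meson split_list_first)
  have p: "\<forall>b\<in>set p. (b, a) \<in> I"
  proof (rule ccontr)
    assume "\<not> ?thesis"
    then obtain b where b: "b \<in> set p" "(b, a) \<notin> I" by blast
    have pr: "prefix (proj b a (a # u)) (proj b a v)"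
      using Cons.prems b unfolding tle_def by simp
    have "proj b a p \<noteq> []" using b by (auto simp: proj_def filter_empty_conv)
    moreover have "set (proj b a p) \<subseteq> {b}" using ap by (auto simp: proj_def)
    ultimately obtain r where "proj b a p = b # r" by (cases "proj b a p") auto
    with pr have "b = a" by (auto simp: v proj_Cons)
    with b ap show False by auto
  qed
  have eq: "trace_of I v = trace_of I (a # p @ q)"
    unfolding v by (rule trace_of_move[OF p])
  have "tle I ([a] @ u) ([a] @ (p @ q))"
    using tle_trans[OF Cons.prems teq_imp_tle[OF trace_of_eq_imp_teq[OF eq]]] by simp
  then have "tle I u (p @ q)" by (simp only: tle_append_same)
  from Cons.IH[OF this] obtain z where "trace_of I (u @ z) = trace_of I (p @ q)" ..
  then have "trace_of I ([a] @ u @ z) = trace_of I ([a] @ p @ q)" by (metis trace_mult)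
  with eq show ?case by auto
qed auto

text \<open>A factorisation \<open>u z = v\<close> with equal projections leaves nothing for \<open>z\<close>,
  because the pairs \<open>(c, c)\<close> count letters.\<close>

lemma trace_of_eq_iff_teq: "trace_of I u = trace_of I v \<longleftrightarrow> teq I u v"
proof
  assume uv: "teq I u v"
  from tle_imp_factor[OF teq_imp_tle[OF uv]] obtain z where z: "trace_of I (u @ z) = trace_of I v" ..
  have "proj c c (u @ z) = proj c c u" for c
    using trace_of_eq_imp_teq[OF z] uv by (simp add: teq_def)
  then have "proj c c z = []" for c by simp
  then have "z = []" by (metis list.exhaust list.simps(3) proj_Cons)
  with z show "trace_of I u = trace_of I v" by simp
qed (rule trace_of_eq_imp_teq)

lemma trace_le_iff_tle: "trace_le I (trace_of I u) (trace_of I v) \<longleftrightarrow> tle I u v"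
proof
  assume "trace_le I (trace_of I u) (trace_of I v)"
  then obtain z where "trace_of I v = trace_of I (u @ z)"
    unfolding factor_def carrier_trace_monoid by (auto simp: trace_mult)
  then have "teq I (u @ z) v" by (simp add: trace_of_eq_iff_teq teq_sym)
  then show "tle I u v" using teq_imp_tle tle_trans tle_append by blast
next
  assume "tle I u v"
  from tle_imp_factor[OF this] show "trace_le I (trace_of I u) (trace_of I v)"
    unfolding factor_def carrier_trace_monoid by (force simp: trace_mult)
qed

lemma tle_factor: "tle I u v \<Longrightarrow> \<exists>z. teq I (u @ z) v"
  using tle_imp_factor trace_of_eq_iff_teq by blast

lemma teq_count: "teq I u v \<Longrightarrow> count_list u a = count_list v a"
  unfolding teq_def using length_proj[of a a] not_I_refl by metis

lemma tle_count: "tle I u v \<Longrightarrow> count_list u a \<le> count_list v a"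
  unfolding tle_def using length_proj[of a a] not_I_refl prefix_length_le by metis

text \<open>Prefixes of one and the same word are comparable, and their lengths tell which one is shorter;
  this applies to each projection.\<close>

lemma tle_if_count_le:
  assumes "tle I x z" "tle I y z" "\<And>a. count_list x a \<le> count_list y a"
  shows "tle I x y"
  unfolding tle_def
proof (intro allI impI)
  fix a b assume ab: "(a, b) \<notin> I"
  have "length (proj a b x) \<le> length (proj a b y)"
    using assms(3)[of a] assms(3)[of b] by (simp add: length_proj)
  then show "prefix (proj a b x) (proj a b y)"
    using ab assms(1,2) prefix_length_prefix unfolding tle_def by blast
qed

lemma tle_antisym: "tle I u v \<Longrightarrow> tle I v u \<Longrightarrow> teq I u v"
  unfolding tle_def teq_def by (intro allI impI prefix_order.antisym) auto

lemma teq_move: "\<forall>b\<in>set p. (b, a) \<in> I \<Longrightarrow> teq I (p @ a # q) (a # p @ q)"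
  by (simp only: trace_of_eq_iff_teq[symmetric] trace_of_move)

lemma one_trace: "\<one>\<^bsub>trace_monoid I\<^esub> = trace_of I []"
  by (simp add: trace_monoid_def)

end

section \<open>Normal sequences of cliques\<close>

definition clique_word :: "'a set \<Rightarrow> 'a list" where
  "clique_word c = (SOME w. distinct w \<and> set w = c)"

definition word_upto :: "(nat \<Rightarrow> 'a set) \<Rightarrow> nat \<Rightarrow> 'a list" where
  "word_upto \<omega> n = concat (map (\<lambda>i. clique_word (\<omega> i)) [0..<n])"

text \<open>Finite and infinite traces are treated alike: the normal form of a finite trace is continued by
  empty cliques, and the arrow condition permits empty cliques only at the end.\<close>

definition normal_seq :: "('a \<times> 'a) set \<Rightarrow> (nat \<Rightarrow> 'a set) \<Rightarrow> bool" where
  "normal_seq I \<omega> \<longleftrightarrow> (\<forall>i. clique I (\<omega> i) \<and> clique_arrow I (\<omega> i) (\<omega> (Suc i)))"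

definition empty_from :: "(nat \<Rightarrow> 'a set) \<Rightarrow> nat \<Rightarrow> bool" where
  "empty_from \<omega> n \<longleftrightarrow> (\<forall>i\<ge>n. \<omega> i = {})"

text \<open>The normal form of \<open>x a\<close>: the letter \<open>a\<close> joins the clique right above
  the last one that contains a letter depending on \<open>a\<close>.\<close>

definition right_insert :: "('a \<times> 'a) set \<Rightarrow> 'a \<Rightarrow> (nat \<Rightarrow> 'a set) \<Rightarrow> nat \<Rightarrow> 'a set" where
  "right_insert I a \<omega> =
     (let j = LEAST j. \<forall>i\<ge>j. \<forall>b\<in>\<omega> i. (b, a) \<in> I in fun_upd \<omega> j (insert a (\<omega> j)))"

lemma distinct_clique_word [simp]: "distinct (clique_word (c :: 'a::finite set))"
  and set_clique_word [simp]: "set (clique_word (c :: 'a::finite set)) = c"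
proof -
  obtain w where "distinct w \<and> set w = c" using finite_distinct_list[of c] by auto
  then have "distinct (clique_word c) \<and> set (clique_word c) = c"
    unfolding clique_word_def by (rule someI)
  then show "distinct (clique_word c)" "set (clique_word c) = c" by auto
qed

lemma clique_word_empty [simp]: "clique_word ({} :: 'a::finite set) = []"
  using set_clique_word[of "{}"] by (simp del: set_clique_word)

lemma clique_word_singleton [simp]: "clique_word {a :: 'a::finite} = [a]"
  using distinct_clique_word[of "{a}"] set_clique_word[of "{a}"]
  by (cases "clique_word {a}") (auto simp: distinct_length_2_or_more subset_singleton_iff neq_Nil_conv
     simp del: distinct_clique_word set_clique_word dest: equalityD1)

lemma clique_trace_word: "clique_trace I c = trace_of I (clique_word c)"
  by (simp add: clique_trace_def clique_word_def)

lemma clique_product_word: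
  "clique_product I cs = trace_of I (concat (map clique_word cs))"
  by (induction cs)
    (simp_all add: clique_product_def clique_trace_word trace_mult, simp add: trace_monoid_def)

lemma word_upto_0 [simp]: "word_upto \<omega> 0 = []"
  by (simp add: word_upto_def)

lemma word_upto_Suc [simp]: "word_upto \<omega> (Suc n) = word_upto \<omega> n @ clique_word (\<omega> n)"
  by (simp add: word_upto_def)

lemma word_upto_Suc_shift: "word_upto \<omega> (Suc n) = clique_word (\<omega> 0) @ word_upto (\<lambda>i. \<omega> (Suc i)) n"
  by (induction n) auto

lemma word_upto_cong: "(\<And>i. i < n \<Longrightarrow> \<omega> i = \<eta> i) \<Longrightarrow> word_upto \<omega> n = word_upto \<eta> n"
  by (induction n) auto

lemma word_upto_split: "m \<le> n \<Longrightarrow> \<exists>r. word_upto \<omega> n = word_upto \<omega> m @ r"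
  by (induction n) (auto simp: le_Suc_eq)

lemma word_upto_mono: "m \<le> n \<Longrightarrow> tle I (word_upto \<omega> m) (word_upto \<omega> n)"
  using word_upto_split[of m n \<omega>] by auto

lemma clique_product_upto: "clique_product I (map \<omega> [0..<n]) = trace_of I (word_upto \<omega> n)"
  by (simp add: clique_product_word word_upto_def comp_def)

lemma count_clique_word: "count_list (clique_word c) a = of_bool (a \<in> (c :: 'a::finite set))"
proof -
  have "distinct w \<Longrightarrow> count_list w a = of_bool (a \<in> set w)" for w :: "'a list"
    by (induction w) auto
  from this[of "clique_word c"] show ?thesis by simp
qed

lemma count_word_upto:
  "count_list (word_upto \<omega> n) (a :: 'a::finite) = card {i. i < n \<and> a \<in> \<omega> i}"
proof (induction n)
  case (Suc n)
  have "{i. i < Suc n \<and> a \<in> \<omega> i} = {i. i < n \<and> a \<in> \<omega> i} \<union> (if a \<in> \<omega> n then {n} else {})"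
    by (auto simp: less_Suc_eq)
  then show ?case using Suc by (simp add: count_clique_word card_insert_if)
qed simp

abbreviation frequency :: "(nat \<Rightarrow> 'a set) \<Rightarrow> 'a \<Rightarrow> nat \<Rightarrow> real" where
  "frequency \<omega> a \<equiv> (\<lambda>n. real (count_list (word_upto \<omega> n) a) / real n)"

lemma word_upto_empty_from:
  "empty_from \<omega> n \<Longrightarrow> n \<le> k \<Longrightarrow> word_upto \<omega> k = word_upto \<omega> (n :: nat)"
  for \<omega> :: "nat \<Rightarrow> 'a::finite set"
  by (induction k) (auto simp: le_Suc_eq empty_from_def)

lemma boundary_iff: "\<omega> \<in> boundary I \<longleftrightarrow> normal_seq I \<omega> \<and> (\<forall>i. \<omega> i \<noteq> {})"
  by (auto simp: boundary_def normal_seq_def)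

lemma normal_seq_empty: "normal_seq I \<omega> \<Longrightarrow> \<omega> n = {} \<Longrightarrow> empty_from \<omega> n"
  unfolding empty_from_def
proof (intro allI impI)
  fix i assume w: "normal_seq I \<omega>" "\<omega> n = {}" and "n \<le> i"
  from this(3) show "\<omega> i = {}"
    by (induction i rule: dec_induct) (use w in \<open>fastforce simp: normal_seq_def clique_arrow_def\<close>)+
qed

lemma normal_seq_shift: "normal_seq I \<omega> \<Longrightarrow> normal_seq I (\<lambda>i. \<omega> (Suc i))"
  by (simp add: normal_seq_def)

lemma normal_seq_truncate: "normal_seq I \<omega> \<Longrightarrow> normal_seq I (\<lambda>i. if i < n then \<omega> i else {})"
  by (simp add: normal_seq_def clique_def clique_arrow_def)

lemma clique_subset: "clique I d \<Longrightarrow> c \<subseteq> d \<Longrightarrow> clique I c"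
  unfolding clique_def by blast

lemma clique_empty [simp]: "clique I {}" and clique_singleton [simp]: "clique I {a}"
  by (simp_all add: clique_def)

context independence
begin

lemma proj_clique_word:
  assumes "clique I c" "(a, b) \<notin> I"
  shows "proj a b (clique_word c) = (if a \<in> c then [a] else if b \<in> c then [b] else [])"
proof -
  let ?p = "proj a b (clique_word c)"
  have d: "distinct ?p" and s: "set ?p = c \<inter> {a, b}" by (auto simp: proj_def)
  have single: "?p = [x]" if "set ?p = {x}" for x
  proof (cases ?p)
    case (Cons y q)
    with that d have "y = x" "q = []" by (auto simp: subset_singleton_iff)
    with Cons show ?thesis by simp
  qed (use that in simp)
  show ?thesis
  proof (cases "a \<in> c")
    case True
    then have "c \<inter> {a, b} = {a}" using assms unfolding clique_def by auto
    with s single[of a] True show ?thesis by simp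
  next
    case False
    show ?thesis
    proof (cases "b \<in> c")
      case True
      then have "c \<inter> {a, b} = {b}" using False by auto
      with s single[of b] False True show ?thesis by simp
    next
      case b: False
      then have "set ?p = {}" using s False by auto
      with b False show ?thesis by simp
    qed
  qed
qed

lemma tle_clique_word:
  assumes "clique I d" "c \<subseteq> d" shows "tle I (clique_word c) (clique_word d)"
proof -
  have "clique I c" using assms by (rule clique_subset)
  then show ?thesis unfolding tle_def
    using assms proj_clique_word unfolding clique_def by (auto 4 3)
qed

lemma tle_letter_clique_word: "clique I d \<Longrightarrow> a \<in> d \<Longrightarrow> tle I [a] (clique_word d)"
  using tle_clique_word[of d "{a}"] by simp

lemma teq_clique_word_if_word:
  assumes "clique I c" "distinct w" "set w = c" shows "teq I (clique_word c) w"
  using clique_trace_eq[OF assms] by (simp add: clique_trace_word trace_of_eq_iff_teq)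

lemma prefix_of_iff: "prefix_of I (trace_of I u) \<omega> \<longleftrightarrow> (\<exists>n. tle I u (word_upto \<omega> n))"
  by (simp add: prefix_of_def clique_product_upto trace_le_iff_tle)

text \<open>If the first occurrence of \<open>a\<close> is not in the first clique, then the clique before it
  contains some \<open>b\<close> that depends on \<open>a\<close>, and the projection to \<open>a\<close> and
  \<open>b\<close> starts with \<open>b\<close>.\<close>

lemma letter_below_normal_seq:
  assumes \<omega>: "normal_seq I \<omega>" and le: "tle I [a] (word_upto \<omega> n)"
  shows "a \<in> \<omega> 0"
proof -
  have "1 \<le> card {i. i < n \<and> a \<in> \<omega> i}"
    using tle_count[OF le, of a] by (simp add: count_word_upto)
  then obtain i where i: "i < n" "a \<in> \<omega> i" by (metis (mono_tags, lifting) Collect_empty_eq card.empty not_one_le_zero)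
  define j where "j = (LEAST i. a \<in> \<omega> i)"
  have j: "a \<in> \<omega> j" "j < n" and least: "\<And>k. k < j \<Longrightarrow> a \<notin> \<omega> k"
    unfolding j_def using i LeastI[of "\<lambda>i. a \<in> \<omega> i" i] Least_le[of "\<lambda>i. a \<in> \<omega> i" i]
    by (auto dest: not_less_Least)
  show ?thesis
  proof (cases j)
    case (Suc k)
    obtain b where b: "b \<in> \<omega> k" "(b, a) \<notin> I"
      using \<omega> j Suc unfolding normal_seq_def clique_arrow_def by blast
    have "b \<noteq> a" using b least[of k] Suc by auto
    obtain r where r: "word_upto \<omega> n = word_upto \<omega> (Suc k) @ r"
      using word_upto_split[of "Suc k" n \<omega>] j Suc by auto
    let ?p = "proj b a (word_upto \<omega> (Suc k))"
    have "a \<notin> set ?p" using least Suc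
      by (auto simp: word_upto_def proj_def)
    moreover have "?p \<noteq> []" using b by (auto simp: proj_def filter_empty_conv)
    moreover have "set ?p \<subseteq> {a, b}" by (auto simp: proj_def)
    ultimately obtain q where "?p = b # q" by (cases ?p) (auto simp del: word_upto_Suc proj_append)
    moreover have "prefix (proj b a [a]) (proj b a (word_upto \<omega> n))"
      using le b unfolding tle_def by blast
    ultimately show ?thesis using \<open>b \<noteq> a\<close> unfolding r proj_append[of b a _ r]
      by (simp add: proj_Cons del: word_upto_Suc proj_append)
  qed (use j in simp)
qed

lemma letter_below_normal_seq_iff:
  assumes "normal_seq I \<omega>" "0 < n"
  shows "tle I [a] (word_upto \<omega> n) \<longleftrightarrow> a \<in> \<omega> 0"
proof
  assume "a \<in> \<omega> 0"
  then have "tle I [a] (word_upto \<omega> (Suc 0))"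
    using assms tle_letter_clique_word unfolding normal_seq_def by simp
  moreover have "tle I (word_upto \<omega> (Suc 0)) (word_upto \<omega> n)"
    by (rule word_upto_mono) (use assms in simp)
  ultimately show "tle I [a] (word_upto \<omega> n)" by (rule tle_trans)
qed (use assms letter_below_normal_seq in blast)

lemma first_clique_unique:
  assumes "normal_seq I \<omega>" "normal_seq I \<eta>"
    and e: "teq I (word_upto \<omega> (Suc n)) (word_upto \<eta> (Suc m))"
  shows "\<omega> 0 = \<eta> 0"
proof -
  have "a \<in> \<omega> 0 \<longleftrightarrow> tle I [a] (word_upto \<omega> (Suc n))" for a
    by (rule letter_below_normal_seq_iff[symmetric]) (use assms in auto)
  moreover have "a \<in> \<eta> 0 \<longleftrightarrow> tle I [a] (word_upto \<eta> (Suc m))" for a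
    by (rule letter_below_normal_seq_iff[symmetric]) (use assms in auto)
  moreover have "tle I [a] (word_upto \<omega> (Suc n)) \<longleftrightarrow> tle I [a] (word_upto \<eta> (Suc m))" for a
    using teq_imp_tle[OF e] teq_imp_tle[OF teq_sym[OF e]] tle_trans by blast
  ultimately show ?thesis by blast
qed

text \<open>The letters below a trace make up its first clique, which can then be cancelled.\<close>

lemma normal_seq_unique:
  assumes "normal_seq I \<omega>" "normal_seq I \<eta>" "empty_from \<omega> n" "empty_from \<eta> m"
    "teq I (word_upto \<omega> n) (word_upto \<eta> m)"
  shows "\<omega> = \<eta>"
proof
  fix i show "\<omega> i = \<eta> i" using assms
  proof (induction i arbitrary: \<omega> \<eta> n m)
    case (0 \<omega> \<eta> n m)
    then show ?case using first_clique_unique[of \<omega> \<eta> n m]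
      word_upto_empty_from[of \<omega> n "Suc n"] word_upto_empty_from[of \<eta> m "Suc m"]
      by (simp del: word_upto_Suc)
  next
    case (Suc i \<omega> \<eta> n m)
    then have e: "teq I (word_upto \<omega> (Suc n)) (word_upto \<eta> (Suc m))"
      using word_upto_empty_from[of \<omega> n "Suc n"] word_upto_empty_from[of \<eta> m "Suc m"]
      by (simp del: word_upto_Suc)
    have "\<omega> 0 = \<eta> 0" using first_clique_unique[OF _ _ e] Suc.prems by blast
    with e have "teq I (word_upto (\<lambda>i. \<omega> (Suc i)) n) (word_upto (\<lambda>i. \<eta> (Suc i)) m)"
      unfolding word_upto_Suc_shift by simp
    with Suc.IH[of "\<lambda>i. \<omega> (Suc i)" "\<lambda>i. \<eta> (Suc i)" n m] Suc.prems show ?case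
      by (simp add: normal_seq_shift empty_from_def)
  qed
qed

lemma right_insert:
  assumes \<omega>: "normal_seq I \<omega>" and n: "empty_from \<omega> n"
  shows "normal_seq I (right_insert I a \<omega>)" (is ?normal)
    and "empty_from (right_insert I a \<omega>) (Suc n)" (is ?empty)
    and "teq I (word_upto (right_insert I a \<omega>) (Suc n)) (word_upto \<omega> n @ [a])" (is ?teq)
    and "\<omega> i \<subseteq> right_insert I a \<omega> i" (is ?sub)
proof -
  define free where "free j \<longleftrightarrow> (\<forall>i\<ge>j. \<forall>b\<in>\<omega> i. (b, a) \<in> I)" for j
  define j where "j = (LEAST j. free j)"
  have fn: "free n" using n by (simp add: free_def empty_from_def)
  then have fj: "free j" and jn: "j \<le> n" unfolding j_def by (rule LeastI, rule Least_le)
  define \<rho> where "\<rho> = right_insert I a \<omega>"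
  have "\<rho> = fun_upd \<omega> j (insert a (\<omega> j))"
    unfolding \<rho>_def right_insert_def j_def free_def Let_def ..
  then have \<rho>j: "\<rho> j = insert a (\<omega> j)" and \<rho>i: "\<And>i. i \<noteq> j \<Longrightarrow> \<rho> i = \<omega> i" by simp_all
  have indep: "(b, a) \<in> I" if "b \<in> \<omega> i" "j \<le> i" for b i using fj that unfolding free_def by blast
  have cl: "clique I (insert a (\<omega> j))"
    using \<omega> indep[of _ j] I_sym unfolding normal_seq_def clique_def by blast
  have prev: "\<exists>b\<in>\<omega> k. (b, a) \<notin> I" if "j = Suc k" for k
  proof -
    have "\<not> free k" using that not_less_Least[of k free] by (simp add: j_def)
    then show ?thesis unfolding free_def using fj that
      unfolding free_def by (metis Suc_leI le_neq_implies_less)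
  qed
  show ?normal unfolding \<rho>_def[symmetric] normal_seq_def
  proof (intro allI conjI)
    fix i
    show "clique I (\<rho> i)" using \<omega> cl \<rho>j \<rho>i by (cases "i = j") (simp_all add: normal_seq_def)
    have ar: "clique_arrow I (\<omega> i) (\<omega> (Suc i))" using \<omega> by (simp add: normal_seq_def)
    show "clique_arrow I (\<rho> i) (\<rho> (Suc i))"
    proof (cases "Suc i = j")
      case True
      then show ?thesis using ar prev[of i] \<rho>j \<rho>i[of i] by (auto simp: clique_arrow_def)
    next
      case False
      then show ?thesis using ar \<rho>j \<rho>i[of "Suc i"] \<rho>i[of i]
        by (cases "i = j") (auto simp: clique_arrow_def)
    qed
  qed
  show ?empty unfolding \<rho>_def[symmetric] using n jn \<rho>i by (simp add: empty_from_def)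
  show ?sub unfolding \<rho>_def[symmetric] using \<rho>j \<rho>i[of i] by (cases "i = j") auto
  have low: "word_upto \<rho> j = word_upto \<omega> j" by (rule word_upto_cong) (simp add: \<rho>i)
  have "teq I (word_upto \<rho> k) (word_upto \<omega> k @ [a])" if "Suc j \<le> k" for k
    using that
  proof (induction k rule: dec_induct)
    case base
    have "a \<notin> \<omega> j" using indep[of a j] by auto
    then have "teq I (clique_word (insert a (\<omega> j))) (clique_word (\<omega> j) @ [a])"
      by (intro teq_clique_word_if_word cl) auto
    then have "teq I (word_upto \<rho> j @ clique_word (insert a (\<omega> j))) (word_upto \<omega> j @ clique_word (\<omega> j) @ [a])"
      unfolding low by (simp only: teq_append_left_cancel)
    then show ?case by (simp add: \<rho>j)
  next
    case (step k)
    have "teq I (word_upto \<rho> (Suc k)) ((word_upto \<omega> k @ [a]) @ clique_word (\<omega> k))"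
      using step \<rho>i[of k] by (simp del: append_assoc)
    then have 1: "teq I (word_upto \<rho> (Suc k)) (word_upto \<omega> k @ [a] @ clique_word (\<omega> k))"
      by (simp only: append_assoc)
    have "teq I (clique_word (\<omega> k) @ a # []) (a # clique_word (\<omega> k) @ [])"
      by (rule teq_move) (use indep step in auto)
    then have 2: "teq I (word_upto \<omega> k @ [a] @ clique_word (\<omega> k)) (word_upto \<omega> k @ clique_word (\<omega> k) @ [a])"
      using teq_sym by simp
    from teq_trans[OF 1 2] show ?case by simp
  qed
  from this[of "Suc n"] jn have "teq I (word_upto \<rho> (Suc n)) (word_upto \<omega> (Suc n) @ [a])" by simp
  moreover have "word_upto \<omega> (Suc n) = word_upto \<omega> n"
    using word_upto_empty_from[OF n, of "Suc n"] by simp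
  ultimately show ?teq unfolding \<rho>_def[symmetric] by simp
qed

definition nf_seq :: "'a list \<Rightarrow> nat \<Rightarrow> 'a set" where
  "nf_seq w = (SOME \<omega>. normal_seq I \<omega> \<and> (\<exists>n. empty_from \<omega> n \<and> teq I (word_upto \<omega> n) w))"

lemma nf_seq_exists: "\<exists>\<omega>. normal_seq I \<omega> \<and> (\<exists>n. empty_from \<omega> n \<and> teq I (word_upto \<omega> n) w)"
proof (induction w rule: rev_induct)
  case Nil
  have "normal_seq I (\<lambda>_. {})" "empty_from (\<lambda>_. {}) 0"
    by (auto simp: normal_seq_def clique_arrow_def empty_from_def)
  then show ?case by (metis teq_refl word_upto_0)
next
  case (snoc a w)
  then obtain \<omega> n where "normal_seq I \<omega>" "empty_from \<omega> n" and t: "teq I (word_upto \<omega> n) w" by blast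
  note r = right_insert[OF this(1,2), where a = a]
  have "teq I (word_upto (right_insert I a \<omega>) (Suc n)) (w @ [a])"
    using r(3) teq_append[OF t teq_refl] by (rule teq_trans)
  with r(1,2) show ?case by blast
qed

lemma nf_seq:
  shows normal_nf_seq: "normal_seq I (nf_seq w)"
    and nf_seq_word: "\<exists>n. empty_from (nf_seq w) n \<and> teq I (word_upto (nf_seq w) n) w"
  using someI_ex[OF nf_seq_exists[of w]] unfolding nf_seq_def[symmetric] by blast+

lemma nf_seq_eqI:
  assumes "normal_seq I \<omega>" "empty_from \<omega> n" "teq I (word_upto \<omega> n) w"
  shows "nf_seq w = \<omega>"
proof -
  obtain m where "empty_from (nf_seq w) m" "teq I (word_upto (nf_seq w) m) w"
    using nf_seq_word by blast
  then show ?thesis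
    using normal_seq_unique[OF normal_nf_seq assms(1) _ assms(2)] assms(3) teq_sym teq_trans by blast
qed

lemma nf_seq_cong: "teq I u v \<Longrightarrow> nf_seq u = nf_seq v"
  using nf_seq_eqI[OF normal_nf_seq] nf_seq_word teq_trans teq_sym by metis

lemma nf_seq_word_upto:
  assumes "normal_seq I \<omega>"
  shows "nf_seq (word_upto \<omega> n) = (\<lambda>i. if i < n then \<omega> i else {})"
proof (rule nf_seq_eqI)
  show "empty_from (\<lambda>i. if i < n then \<omega> i else {}) n" by (simp add: empty_from_def)
  show "teq I (word_upto (\<lambda>i. if i < n then \<omega> i else {}) n) (word_upto \<omega> n)"
    using word_upto_cong[of n "\<lambda>i. if i < n then \<omega> i else {}" \<omega>] by simp
qed (rule normal_seq_truncate[OF assms])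

lemma nf_seq_append_mono: "nf_seq u i \<subseteq> nf_seq (u @ v) i"
proof (induction v rule: rev_induct)
  case (snoc a v)
  let ?\<omega> = "nf_seq (u @ v)"
  obtain n where n: "empty_from ?\<omega> n" and t: "teq I (word_upto ?\<omega> n) (u @ v)"
    using nf_seq_word by blast
  note r = right_insert[OF normal_nf_seq n, where a = a]
  have "nf_seq ((u @ v) @ [a]) = right_insert I a ?\<omega>"
    by (rule nf_seq_eqI[OF r(1,2)]) (use teq_trans[OF r(3) teq_append[OF t teq_refl]] in simp)
  with r(4)[of i] snoc show ?case by simp
qed simp

text \<open>Appending a letter on the right enlarges one clique of the normal form and leaves the others
  alone, so the normal form of a prefix lies inside the normal form level by level.\<close>

lemma nf_seq_mono: "tle I u v \<Longrightarrow> nf_seq u i \<subseteq> nf_seq v i"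
  using tle_factor[of u v] nf_seq_append_mono nf_seq_cong by metis

lemma nf_seq_below:
  assumes "normal_seq I \<omega>" "tle I u (word_upto \<omega> n)" shows "nf_seq u i \<subseteq> \<omega> i"
  using nf_seq_mono[OF assms(2), of i] nf_seq_word_upto[OF assms(1), of n] by (auto split: if_splits)

lemma normal_form_props:
  shows nf_clique_eq: "nf_clique I (trace_of I w) = nf_seq w"
    and height_nonempty: "i < height I (trace_of I w) \<Longrightarrow> nf_seq w i \<noteq> {}"
    and height_empty: "empty_from (nf_seq w) (height I (trace_of I w))"
    and normal_form_eqI: "is_normal_form I (trace_of I w) cs \<Longrightarrow> cs = normal_form I (trace_of I w)"
proof -
  define seq :: "'a set list \<Rightarrow> nat \<Rightarrow> 'a set" where
    "seq cs = (\<lambda>i. if i < length cs then cs ! i else {})" for cs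
  have map_seq: "map (seq cs) [0..<length cs] = cs" for cs
    by (rule nth_equalityI) (auto simp: seq_def)
  have seqD: "seq cs = nf_seq w" if nf: "is_normal_form I (trace_of I w) cs" for cs
  proof (rule nf_seq_eqI[symmetric])
    show "normal_seq I (seq cs)" unfolding normal_seq_def
    proof
      fix i
      have "clique I (seq cs i)" using nf by (auto simp: is_normal_form_def seq_def)
      moreover have "clique_arrow I (seq cs i) (seq cs (Suc i))"
        using nf by (auto simp: is_normal_form_def seq_def successively_conv_nth)
          (auto simp: clique_arrow_def)
      ultimately show "clique I (seq cs i) \<and> clique_arrow I (seq cs i) (seq cs (Suc i))" ..
    qed
    show "empty_from (seq cs) (length cs)" by (simp add: empty_from_def seq_def)
    have "trace_of I (word_upto (seq cs) (length cs)) = trace_of I w"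
      using nf unfolding clique_product_upto[symmetric] map_seq by (simp add: is_normal_form_def)
    then show "teq I (word_upto (seq cs) (length cs)) w" by (simp add: trace_of_eq_iff_teq)
  qed
  obtain n where n: "empty_from (nf_seq w) n" "teq I (word_upto (nf_seq w) n) w"
    using nf_seq_word by blast
  define k where "k = (LEAST k. nf_seq w k = {})"
  have k: "nf_seq w k = {}" and k_less: "\<And>i. i < k \<Longrightarrow> nf_seq w i \<noteq> {}"
    unfolding k_def using LeastI[of "\<lambda>k. nf_seq w k = {}" n] n
    by (auto simp: empty_from_def dest: not_less_Least)
  have ek: "empty_from (nf_seq w) k" using normal_nf_seq k by (rule normal_seq_empty)
  have "word_upto (nf_seq w) k = word_upto (nf_seq w) n"
    using word_upto_empty_from[OF ek, of "max n k"] word_upto_empty_from[OF n(1), of "max n k"] by simp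
  then have tk: "teq I (word_upto (nf_seq w) k) w" using n by simp
  have nf: "is_normal_form I (trace_of I w) (map (nf_seq w) [0..<k])"
    unfolding is_normal_form_def clique_product_upto trace_of_eq_iff_teq
    using tk k_less normal_nf_seq[of w] by (auto simp: successively_conv_nth normal_seq_def)
  have len: "length cs = k" if cs: "is_normal_form I (trace_of I w) cs" for cs
  proof -
    have "nf_seq w (length cs) = {}" using seqD[OF cs, symmetric] by (simp add: seq_def)
    moreover have "nf_seq w i \<noteq> {}" if "i < length cs" for i
    proof -
      have "cs ! i \<noteq> {}" using cs that nth_mem[of i cs] unfolding is_normal_form_def by blast
      then show ?thesis using that seqD[OF cs, symmetric] by (simp add: seq_def)
    qed
    ultimately show ?thesis using k k_less by (meson linorder_neqE_nat)
  qed
  have uniq: "cs = map (nf_seq w) [0..<k]" if cs: "is_normal_form I (trace_of I w) cs" for cs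
    using map_seq[of cs] seqD[OF cs] len[OF cs] by simp
  have e: "normal_form I (trace_of I w) = map (nf_seq w) [0..<k]"
    unfolding normal_form_def
  proof (rule the_equality)
    show "is_normal_form I (trace_of I w) (map (nf_seq w) [0..<k])" by (rule nf)
  qed (rule uniq)
  then show "is_normal_form I (trace_of I w) cs \<Longrightarrow> cs = normal_form I (trace_of I w)"
    using uniq by simp
  from e have h: "height I (trace_of I w) = k" and "normal_form I (trace_of I w) = map (nf_seq w) [0..<k]"
    by (simp_all add: height_def)
  then show "nf_clique I (trace_of I w) = nf_seq w"
    using ek by (auto simp: nf_clique_def fun_eq_iff empty_from_def)
  show "i < height I (trace_of I w) \<Longrightarrow> nf_seq w i \<noteq> {}" using h k_less by simp
  show "empty_from (nf_seq w) (height I (trace_of I w))" using h ek by simp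
qed

abbreviation ht :: "'a list \<Rightarrow> nat" where
  "ht w \<equiv> height I (trace_of I w)"

lemma teq_word_upto_height: "teq I (word_upto (nf_seq w) (ht w)) w"
proof -
  obtain n where n: "empty_from (nf_seq w) n" "teq I (word_upto (nf_seq w) n) w"
    using nf_seq_word by blast
  have "word_upto (nf_seq w) (ht w) = word_upto (nf_seq w) n"
    using word_upto_empty_from[OF n(1), of "max n (ht w)"]
      word_upto_empty_from[OF height_empty[of w], of "max n (ht w)"] by simp
  with n show ?thesis by simp
qed

lemma height_mono: "tle I u v \<Longrightarrow> ht u \<le> ht v"
  using nf_seq_mono[of u v "ht v"] height_empty[of v] height_nonempty[of "ht v" u]
  by (force simp: empty_from_def not_le[symmetric])

lemma height_word_upto:
  assumes "\<omega> \<in> boundary I" shows "ht (word_upto \<omega> n) = n"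
proof -
  have e: "nf_seq (word_upto \<omega> n) = (\<lambda>i. if i < n then \<omega> i else {})"
    using assms by (intro nf_seq_word_upto) (simp add: boundary_iff)
  have "\<not> n < ht (word_upto \<omega> n)" using height_nonempty[of n "word_upto \<omega> n"] e by auto
  moreover have "\<not> ht (word_upto \<omega> n) < n"
    using height_empty[of "word_upto \<omega> n"] e assms by (auto simp: empty_from_def boundary_iff)
  ultimately show ?thesis by simp
qed

text \<open>Each level of the normal form of \<open>u\<close> is contained in the same level of
  \<open>\<omega>\<close>. So the first \<open>ht u\<close> cliques of \<open>\<omega>\<close> contain every
  letter at least as often as \<open>u\<close>.\<close>

lemma tle_word_upto_height:
  assumes \<omega>: "normal_seq I \<omega>" and le: "tle I u (word_upto \<omega> n)"
  shows "tle I u (word_upto \<omega> (ht u))"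
proof (rule tle_if_count_le)
  let ?N = "max n (ht u)"
  show "tle I u (word_upto \<omega> ?N)" using le word_upto_mono[of n ?N] tle_trans by fastforce
  show "tle I (word_upto \<omega> (ht u)) (word_upto \<omega> ?N)" by (rule word_upto_mono) simp
  fix a
  have "count_list u a = count_list (word_upto (nf_seq u) (ht u)) a"
    by (rule teq_count[symmetric, OF teq_word_upto_height])
  also have "\<dots> \<le> count_list (word_upto \<omega> (ht u)) a"
    unfolding count_word_upto using nf_seq_below[OF \<omega> le] by (intro card_mono) auto
  finally show "count_list u a \<le> count_list (word_upto \<omega> (ht u)) a" .
qed

lemma normal_seq_below:
  assumes "normal_seq I \<omega>" "normal_seq I \<eta>" "tle I (word_upto \<omega> n) (word_upto \<eta> m)" "i < n"
  shows "\<omega> i \<subseteq> \<eta> i"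
  using nf_seq_below[OF assms(2,3), of i] nf_seq_word_upto[OF assms(1), of n] assms(4) by simp

text \<open>A comparison of prefixes gives inclusion level by level, so mutually cofinal prefixes belong to
  the same sequence.\<close>

lemma normal_seq_eqI:
  assumes "normal_seq I \<omega>" "normal_seq I \<eta>"
    and "\<And>n. \<exists>m. tle I (word_upto \<omega> n) (word_upto \<eta> m)"
    and "\<And>n. \<exists>m. tle I (word_upto \<eta> n) (word_upto \<omega> m)"
  shows "\<omega> = \<eta>"
proof
  fix i
  from assms(3)[of "Suc i"] assms(4)[of "Suc i"] show "\<omega> i = \<eta> i"
    using normal_seq_below[OF assms(1,2)] normal_seq_below[OF assms(2,1)] by blast
qed

end

section \<open>Concatenating a finite trace and an infinite trace\<close>

text \<open>Multiplication by a clique \<open>R\<close> on the left pushes letters to higher levels. The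
  clique that arrives at level \<open>i\<close> displaces the letters of \<open>\<omega> i\<close> that depend
  on it; these are carried to level \<open>i + 1\<close>, the others stay. Conversely, in a product a letter
  of level \<open>i + 1\<close> has been carried there exactly if it is independent of everything that stayed
  at level \<open>i\<close>; \<open>uncarry\<close> recovers the carried letters in this way.\<close>

fun carry :: "('a \<times> 'a) set \<Rightarrow> 'a set \<Rightarrow> (nat \<Rightarrow> 'a set) \<Rightarrow> nat \<Rightarrow> 'a set" where
  "carry I R \<omega> 0 = R"
| "carry I R \<omega> (Suc i) = {b \<in> \<omega> i. \<exists>a\<in>carry I R \<omega> i. (a, b) \<notin> I}"

definition lcat :: "('a \<times> 'a) set \<Rightarrow> 'a set \<Rightarrow> (nat \<Rightarrow> 'a set) \<Rightarrow> nat \<Rightarrow> 'a set" where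
  "lcat I R \<omega> i = carry I R \<omega> i \<union> (\<omega> i - carry I R \<omega> (Suc i))"

fun uncarry :: "('a \<times> 'a) set \<Rightarrow> 'a set \<Rightarrow> (nat \<Rightarrow> 'a set) \<Rightarrow> nat \<Rightarrow> 'a set" where
  "uncarry I R \<omega> 0 = R"
| "uncarry I R \<omega> (Suc i) = {b \<in> \<omega> (Suc i). \<forall>c\<in>\<omega> i - uncarry I R \<omega> i. (c, b) \<in> I}"

definition lcats :: "('a \<times> 'a) set \<Rightarrow> 'a set list \<Rightarrow> (nat \<Rightarrow> 'a set) \<Rightarrow> nat \<Rightarrow> 'a set" where
  "lcats I p \<omega> = foldr (lcat I) p \<omega>"

definition cliques_word :: "'a set list \<Rightarrow> 'a list" where
  "cliques_word p = concat (map clique_word p)"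

definition letters :: "'a list \<Rightarrow> 'a set list" where
  "letters w = map (\<lambda>a. {a}) w"

text \<open>These sets prescribe the first cliques. In contrast to cylinders they form a tree under inclusion,
  hence an intersection-stable generator of the Borel sets.\<close>

definition elementary :: "('a \<times> 'a) set \<Rightarrow> 'a set list \<Rightarrow> (nat \<Rightarrow> 'a set) set" where
  "elementary I w = {\<omega> \<in> boundary I. map \<omega> [0..<length w] = w}"

definition normal_list :: "('a \<times> 'a) set \<Rightarrow> 'a set list \<Rightarrow> bool" where
  "normal_list I w \<longleftrightarrow> (\<forall>c\<in>set w. clique I c \<and> c \<noteq> {}) \<and> successively (clique_arrow I) w"

lemma lcats_Nil [simp]: "lcats I [] \<omega> = \<omega>"
  and lcats_Cons [simp]: "lcats I (c # p) \<omega> = lcat I c (lcats I p \<omega>)"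
  and lcats_append: "lcats I (p @ q) \<omega> = lcats I p (lcats I q \<omega>)"
  by (simp_all add: lcats_def)

lemma cliques_word_simps [simp]:
  "cliques_word [] = []" "cliques_word (c # p) = clique_word c @ cliques_word p"
  "cliques_word (p @ q) = cliques_word p @ cliques_word q"
  by (simp_all add: cliques_word_def)

lemma letters_simps [simp]:
  "letters [] = []" "letters (a # w) = {a} # letters w" "letters (v @ w) = letters v @ letters w"
  by (simp_all add: letters_def)

lemma cliques_word_letters [simp]: "cliques_word (letters (w :: 'a::finite list)) = w"
  by (induction w) auto

lemma clique_letters: "c \<in> set (letters w) \<Longrightarrow> clique I c"
  by (auto simp: letters_def)

lemma lcat_0: "lcat I R \<omega> 0 = R \<union> {b \<in> \<omega> 0. \<forall>a\<in>R. (a, b) \<in> I}"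
  by (auto simp: lcat_def)

lemma clique_product_cliques_word: "clique_product I p = trace_of I (cliques_word p)"
  by (simp add: clique_product_word cliques_word_def)

lemma cliques_word_map: "cliques_word (map \<omega> [0..<n]) = word_upto \<omega> n"
  by (simp add: cliques_word_def word_upto_def comp_def)

lemma elementary_Nil [simp]: "elementary I [] = boundary I"
  by (simp add: elementary_def)

lemma elementary_iff:
  "\<omega> \<in> elementary I w \<longleftrightarrow> \<omega> \<in> boundary I \<and> (\<forall>i<length w. \<omega> i = w ! i)"
  unfolding elementary_def list_eq_iff_nth_eq by simp

lemma lcat_prepend:
  assumes "clique_arrow I R (\<omega> 0)" "normal_seq I \<omega>"
  shows "lcat I R \<omega> = case_nat R \<omega>"
proof -
  have c: "carry I R \<omega> (Suc i) = \<omega> i" for i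
  proof (induction i)
    case 0
    show ?case using assms(1) by (auto simp: clique_arrow_def)
  next
    case (Suc i)
    have "clique_arrow I (\<omega> i) (\<omega> (Suc i))" using assms(2) by (simp add: normal_seq_def)
    then show ?case unfolding carry.simps(2)[of I R \<omega> "Suc i"] Suc
      by (auto simp: clique_arrow_def)
  qed
  show ?thesis
  proof
    fix i show "lcat I R \<omega> i = case_nat R \<omega> i"
      by (cases i) (auto simp: lcat_def c simp del: carry.simps(2))
  qed
qed

context independence
begin

declare tle_trans [trans]

definition below :: "'a list \<Rightarrow> (nat \<Rightarrow> 'a set) \<Rightarrow> bool" where
  "below u \<omega> \<longleftrightarrow> (\<exists>n. tle I u (word_upto \<omega> n))"

lemma cylinder_iff: "\<omega> \<in> cylinder I (trace_of I u) \<longleftrightarrow> \<omega> \<in> boundary I \<and> below u \<omega>"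
  by (simp add: cylinder_def prefix_of_iff below_def)

lemma clique_carry: "clique I R \<Longrightarrow> normal_seq I \<omega> \<Longrightarrow> clique I (carry I R \<omega> i)"
  by (cases i) (auto simp: normal_seq_def intro: clique_subset)

lemma normal_seq_lcat:
  assumes R: "clique I R" and \<omega>: "normal_seq I \<omega>"
  shows "normal_seq I (lcat I R \<omega>)"
  unfolding normal_seq_def
proof (intro allI conjI)
  fix i
  have i: "clique I (\<omega> i)" "clique_arrow I (\<omega> i) (\<omega> (Suc i))" using \<omega> by (simp_all add: normal_seq_def)
  show "clique I (lcat I R \<omega> i)"
  proof -
    have "(a, b) \<in> I \<and> (b, a) \<in> I" if "a \<in> carry I R \<omega> i" "b \<in> \<omega> i - carry I R \<omega> (Suc i)" for a b
      using that I_sym by auto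
    then show ?thesis
      using clique_carry[OF R \<omega>, of i] i(1) unfolding clique_def lcat_def by blast
  qed
  show "clique_arrow I (lcat I R \<omega> i) (lcat I R \<omega> (Suc i))"
    unfolding clique_arrow_def
  proof
    fix b assume "b \<in> lcat I R \<omega> (Suc i)"
    then consider "b \<in> carry I R \<omega> (Suc i)" | "b \<in> \<omega> (Suc i)" "b \<notin> carry I R \<omega> (Suc (Suc i))"
      unfolding lcat_def by blast
    then show "\<exists>a\<in>lcat I R \<omega> i. (a, b) \<notin> I"
    proof cases
      case 1
      then show ?thesis unfolding lcat_def by auto
    next
      case 2
      then obtain a where "a \<in> \<omega> i" "(a, b) \<notin> I" using i unfolding clique_arrow_def by blast
      moreover have "a \<notin> carry I R \<omega> (Suc i)" using 2 calculation by (metis (mono_tags, lifting) carry.simps(2) mem_Collect_eq)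
      ultimately show ?thesis unfolding lcat_def by blast
    qed
  qed
qed

lemma lcat_boundary:
  assumes "clique I R" "\<omega> \<in> boundary I" shows "lcat I R \<omega> \<in> boundary I"
proof -
  have "lcat I R \<omega> i \<noteq> {}" for i
  proof
    assume "lcat I R \<omega> i = {}"
    then have "carry I R \<omega> i = {}" "\<omega> i \<subseteq> carry I R \<omega> (Suc i)" unfolding lcat_def by auto
    then show False using assms(2) by (auto simp: boundary_iff)
  qed
  with assms normal_seq_lcat show ?thesis by (simp add: boundary_iff)
qed

lemma teq_clique_word_Un:
  assumes "clique I (c \<union> d)" "c \<inter> d = {}"
  shows "teq I (clique_word (c \<union> d)) (clique_word c @ clique_word d)"
  using assms by (intro teq_clique_word_if_word) auto

text \<open>What has been carried out of the first \<open>n\<close> levels is what is still missing from the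
  product there.\<close>

lemma lcat_word:
  assumes R: "clique I R" and \<omega>: "normal_seq I \<omega>"
  shows "teq I (clique_word R @ word_upto \<omega> n) (word_upto (lcat I R \<omega>) n @ clique_word (carry I R \<omega> n))"
proof (induction n)
  case (Suc n)
  let ?c = "carry I R \<omega> n" and ?d = "\<omega> n - carry I R \<omega> (Suc n)" and ?e = "carry I R \<omega> (Suc n)"
  have "?c \<inter> ?d = {}" unfolding carry.simps(2) using not_I_refl by blast
  moreover have "clique I (?c \<union> ?d)"
    using normal_seq_lcat[OF R \<omega>] unfolding normal_seq_def lcat_def by simp
  ultimately have 1: "teq I (clique_word (lcat I R \<omega> n)) (clique_word ?c @ clique_word ?d)"
    unfolding lcat_def by (intro teq_clique_word_Un)
  have de: "?d \<union> ?e = \<omega> n" by auto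
  moreover have "clique I (\<omega> n)" using \<omega> by (simp add: normal_seq_def)
  ultimately have 2: "teq I (clique_word (\<omega> n)) (clique_word ?d @ clique_word ?e)"
    using teq_clique_word_Un[of ?d ?e] by auto
  have 3: "teq I ((clique_word R @ word_upto \<omega> n) @ clique_word (\<omega> n))
      ((word_upto (lcat I R \<omega>) n @ clique_word ?c) @ (clique_word ?d @ clique_word ?e))"
    using Suc 2 by (rule teq_append)
  have 4: "teq I (word_upto (lcat I R \<omega>) n @ (clique_word ?c @ clique_word ?d) @ clique_word ?e)
      (word_upto (lcat I R \<omega>) n @ clique_word (lcat I R \<omega> n) @ clique_word ?e)"
    using teq_sym[OF 1] by (intro teq_append teq_refl)
  show ?case using teq_trans[OF 3[unfolded append_assoc] 4[unfolded append_assoc]]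
    by (simp only: word_upto_Suc append_assoc)
qed simp

text \<open>The first \<open>n + 1\<close> levels of the product contain the first \<open>n\<close> levels of
  \<open>\<omega>\<close>, since the carry into level \<open>n\<close> is part of that level.\<close>

lemma below_lcat:
  assumes R: "clique I R" and \<omega>: "normal_seq I \<omega>"
  shows "below u (lcat I R \<omega>) \<longleftrightarrow> (\<exists>n. tle I u (clique_word R @ word_upto \<omega> n))"
proof
  assume "below u (lcat I R \<omega>)"
  then obtain n where "tle I u (word_upto (lcat I R \<omega>) n)" unfolding below_def ..
  also have "tle I \<dots> (word_upto (lcat I R \<omega>) n @ clique_word (carry I R \<omega> n))" by simp
  also have "tle I \<dots> (clique_word R @ word_upto \<omega> n)"
    by (rule teq_imp_tle[OF teq_sym[OF lcat_word[OF R \<omega>]]])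
  finally show "\<exists>n. tle I u (clique_word R @ word_upto \<omega> n)" ..
next
  assume "\<exists>n. tle I u (clique_word R @ word_upto \<omega> n)"
  then obtain n where "tle I u (clique_word R @ word_upto \<omega> n)" ..
  also have "tle I \<dots> (word_upto (lcat I R \<omega>) n @ clique_word (carry I R \<omega> n))"
    by (rule teq_imp_tle[OF lcat_word[OF R \<omega>]])
  also have "tle I (clique_word (carry I R \<omega> n)) (clique_word (lcat I R \<omega> n))"
    using normal_seq_lcat[OF R \<omega>] by (intro tle_clique_word) (auto simp: normal_seq_def lcat_def)
  then have "tle I (word_upto (lcat I R \<omega>) n @ clique_word (carry I R \<omega> n)) (word_upto (lcat I R \<omega>) (Suc n))"
    by simp
  finally show "below u (lcat I R \<omega>)" unfolding below_def ..
qed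

lemma normal_seq_lcats:
  "\<forall>c\<in>set p. clique I c \<Longrightarrow> normal_seq I \<omega> \<Longrightarrow> normal_seq I (lcats I p \<omega>)"
  by (induction p) (simp_all add: normal_seq_lcat)

lemma lcats_boundary:
  "\<forall>c\<in>set p. clique I c \<Longrightarrow> \<omega> \<in> boundary I \<Longrightarrow> lcats I p \<omega> \<in> boundary I"
  by (induction p) (simp_all add: lcat_boundary)

lemma below_lcats:
  assumes "\<forall>c\<in>set p. clique I c" "normal_seq I \<omega>"
  shows "below u (lcats I p \<omega>) \<longleftrightarrow> (\<exists>n. tle I u (cliques_word p @ word_upto \<omega> n))"
  using assms(1)
proof (induction p arbitrary: u)
  case Nil
  show ?case by (simp add: below_def)
next
  case (Cons R p)
  let ?\<eta> = "lcats I p \<omega>"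
  have "below u (lcats I (R # p) \<omega>) \<longleftrightarrow> (\<exists>n. tle I u (clique_word R @ word_upto ?\<eta> n))"
    using Cons.prems assms(2) by (simp add: below_lcat normal_seq_lcats)
  also have "\<dots> \<longleftrightarrow> (\<exists>n. tle I u (clique_word R @ cliques_word p @ word_upto \<omega> n))"
  proof
    assume "\<exists>n. tle I u (clique_word R @ word_upto ?\<eta> n)"
    then obtain n where n: "tle I u (clique_word R @ word_upto ?\<eta> n)" ..
    have "below (word_upto ?\<eta> n) ?\<eta>" unfolding below_def by (rule exI[of _ n]) simp
    then obtain m where "tle I (word_upto ?\<eta> n) (cliques_word p @ word_upto \<omega> m)"
      using Cons.IH[of "word_upto ?\<eta> n"] Cons.prems by auto
    then have "tle I (clique_word R @ word_upto ?\<eta> n) (clique_word R @ cliques_word p @ word_upto \<omega> m)"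
      by simp
    with n show "\<exists>n. tle I u (clique_word R @ cliques_word p @ word_upto \<omega> n)"
      using tle_trans by blast
  next
    assume "\<exists>n. tle I u (clique_word R @ cliques_word p @ word_upto \<omega> n)"
    then obtain n where n: "tle I u (clique_word R @ cliques_word p @ word_upto \<omega> n)" ..
    have "\<exists>m. tle I (cliques_word p @ word_upto \<omega> n) (cliques_word p @ word_upto \<omega> m)"
      by (rule exI[of _ n]) simp
    then have "below (cliques_word p @ word_upto \<omega> n) ?\<eta>"
      using Cons.IH[of "cliques_word p @ word_upto \<omega> n"] Cons.prems by auto
    then obtain m where "tle I (cliques_word p @ word_upto \<omega> n) (word_upto ?\<eta> m)"
      unfolding below_def ..
    then have "tle I (clique_word R @ cliques_word p @ word_upto \<omega> n) (clique_word R @ word_upto ?\<eta> m)"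
      by simp
    with n show "\<exists>n. tle I u (clique_word R @ word_upto ?\<eta> n)" using tle_trans by blast
  qed
  finally show ?case by simp
qed

text \<open>The prefixes of a product depend only on the trace that is put in front, and they determine the
  product.\<close>

lemma lcats_cong:
  assumes "\<forall>c\<in>set p. clique I c" "\<forall>c\<in>set q. clique I c" "normal_seq I \<omega>"
    and e: "teq I (cliques_word p) (cliques_word q)"
  shows "lcats I p \<omega> = lcats I q \<omega>"
proof (rule normal_seq_eqI)
  show "normal_seq I (lcats I p \<omega>)" "normal_seq I (lcats I q \<omega>)"
    using assms by (simp_all add: normal_seq_lcats)
  have *: "below u (lcats I p' \<omega>) \<Longrightarrow> below u (lcats I q' \<omega>)"
    if "\<forall>c\<in>set p'. clique I c" "\<forall>c\<in>set q'. clique I c" "teq I (cliques_word p') (cliques_word q')"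
    for u p' q'
    unfolding below_lcats[OF that(1) assms(3)] below_lcats[OF that(2) assms(3)]
    using teq_imp_tle[OF teq_append[OF that(3) teq_refl]] tle_trans by blast
  have self: "below (word_upto \<eta> n) \<eta>" for \<eta> n unfolding below_def by (rule exI[of _ n]) simp
  show "\<exists>m. tle I (word_upto (lcats I p \<omega>) n) (word_upto (lcats I q \<omega>) m)" for n
    using *[OF assms(1,2) e self] unfolding below_def .
  show "\<exists>m. tle I (word_upto (lcats I q \<omega>) n) (word_upto (lcats I p \<omega>) m)" for n
    using *[OF assms(2,1) teq_sym[OF e] self] unfolding below_def .
qed

lemma below_lcat_append:
  assumes "clique I R" "normal_seq I \<omega>"
  shows "below (clique_word R @ u) (lcat I R \<omega>) \<longleftrightarrow> below u \<omega>"
  using below_lcat[OF assms] by (simp add: below_def)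

lemma lcat_inj:
  assumes R: "clique I R" and "normal_seq I \<omega>" "normal_seq I \<eta>" "lcat I R \<omega> = lcat I R \<eta>"
  shows "\<omega> = \<eta>"
proof (rule normal_seq_eqI[OF assms(2,3)])
  have iff: "below u \<omega> \<longleftrightarrow> below u \<eta>" for u
    using below_lcat_append[OF R assms(2), of u] below_lcat_append[OF R assms(3), of u] assms(4) by simp
  have self: "below (word_upto \<eta> n) \<eta>" for \<eta> n unfolding below_def by (rule exI[of _ n]) simp
  show "\<exists>m. tle I (word_upto \<omega> n) (word_upto \<eta> m)" for n
    using self[of \<omega> n] iff unfolding below_def by blast
  show "\<exists>m. tle I (word_upto \<eta> n) (word_upto \<omega> m)" for n
    using self[of \<eta> n] iff unfolding below_def by blast
qed

lemma lcats_inj: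
  "\<forall>c\<in>set p. clique I c \<Longrightarrow> normal_seq I \<omega> \<Longrightarrow> normal_seq I \<eta> \<Longrightarrow>
    lcats I p \<omega> = lcats I p \<eta> \<Longrightarrow> \<omega> = \<eta>"
proof (induction p)
  case (Cons R p)
  then have "lcats I p \<omega> = lcats I p \<eta>"
    using lcat_inj[of R "lcats I p \<omega>" "lcats I p \<eta>"] by (simp add: normal_seq_lcats)
  with Cons show ?case by simp
qed simp

lemma inj_on_lcats: "\<forall>c\<in>set p. clique I c \<Longrightarrow> inj_on (lcats I p) (boundary I)"
  using lcats_inj by (intro inj_onI) (auto simp: boundary_iff)

lemma lcat_surj:
  assumes \<omega>: "\<omega> \<in> boundary I" and R: "R \<subseteq> \<omega> 0"
  shows "\<exists>\<eta>\<in>boundary I. lcat I R \<eta> = \<omega>"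
proof -
  let ?u = "uncarry I R \<omega>"
  define \<eta> where "\<eta> i = (\<omega> i - ?u i) \<union> ?u (Suc i)" for i
  have nw: "normal_seq I \<omega>" and ne: "\<And>i. \<omega> i \<noteq> {}" using \<omega> by (auto simp: boundary_iff)
  have cl: "clique I (\<omega> i)" and ar: "clique_arrow I (\<omega> i) (\<omega> (Suc i))" for i
    using nw by (auto simp: normal_seq_def)
  have sub: "?u i \<subseteq> \<omega> i" for i using R by (cases i) auto
  have uSuc: "b \<in> ?u (Suc i) \<longleftrightarrow> b \<in> \<omega> (Suc i) \<and> (\<forall>c\<in>\<omega> i - ?u i. (c, b) \<in> I)" for b i by simp
  have dep: "\<exists>c\<in>?u i. (c, b) \<notin> I" if "b \<in> ?u (Suc i)" for b i
    using ar[of i] that uSuc[of b i] unfolding clique_arrow_def by blast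
  have free: "\<exists>c\<in>\<omega> i - ?u i. (c, b) \<notin> I" if "b \<in> \<omega> (Suc i) - ?u (Suc i)" for b i
    using that uSuc[of b i] by blast
  have "clique I (\<eta> i)" for i
  proof -
    have "clique I (?u (Suc i))" using cl sub by (rule clique_subset)
    then show ?thesis using cl[of i] uSuc[of _ i] I_commute unfolding \<eta>_def clique_def by blast
  qed
  moreover have "\<eta> i \<noteq> {}" for i
  proof
    assume "\<eta> i = {}"
    then have "?u (Suc i) = {}" "\<omega> i - ?u i = {}" by (auto simp: \<eta>_def)
    then show False using uSuc[of _ i] ne[of "Suc i"] by blast
  qed
  moreover have "clique_arrow I (\<eta> i) (\<eta> (Suc i))" for i
    unfolding clique_arrow_def \<eta>_def using free[of _ i] dep[of _ "Suc i"] by blast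
  ultimately have "\<eta> \<in> boundary I" by (auto simp: boundary_iff normal_seq_def)
  moreover have "lcat I R \<eta> = \<omega>"
  proof -
    have c: "carry I R \<eta> i = ?u i" for i
    proof (induction i)
      case (Suc i)
      have "b \<in> carry I R \<eta> (Suc i) \<longleftrightarrow> b \<in> ?u (Suc i)" for b
      proof
        assume "b \<in> carry I R \<eta> (Suc i)"
        then obtain a where a: "b \<in> \<eta> i" "a \<in> ?u i" "(a, b) \<notin> I" using Suc by auto
        have "b \<notin> \<omega> i - ?u i"
        proof
          assume b: "b \<in> \<omega> i - ?u i"
          then have "a \<noteq> b" using a(2) by (metis DiffD2)
          moreover have "a \<in> \<omega> i" "b \<in> \<omega> i" using b a(2) sub[of i] by (auto simp del: uncarry.simps)
          ultimately show False using a(3) cl[of i] unfolding clique_def by metis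
        qed
        moreover have "b \<in> \<omega> i - ?u i \<or> b \<in> ?u (Suc i)" using a(1) unfolding \<eta>_def by (simp only: Un_iff)
        ultimately show "b \<in> ?u (Suc i)" by (simp only: simp_thms)
      next
        assume b: "b \<in> ?u (Suc i)"
        then have "b \<in> \<eta> i" unfolding \<eta>_def by (rule UnI2)
        with dep[OF b] Suc show "b \<in> carry I R \<eta> (Suc i)" by auto
      qed
      then show ?case by blast
    qed simp
    have "lcat I R \<eta> i = \<omega> i" for i
    proof -
      have "(\<omega> i - ?u i) \<inter> ?u (Suc i) = {}" using uSuc[of _ i] not_I_refl by blast
      then show ?thesis unfolding lcat_def c \<eta>_def using sub[of i] by blast
    qed
    then show ?thesis by blast
  qed
  ultimately show ?thesis by blast
qed

lemma cylinder_clique: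
  assumes "clique I c"
  shows "cylinder I (trace_of I (clique_word c)) = {\<omega> \<in> boundary I. c \<subseteq> \<omega> 0}"
proof (intro equalityI subsetI)
  fix \<omega> assume "\<omega> \<in> cylinder I (trace_of I (clique_word c))"
  then obtain n where n: "tle I (clique_word c) (word_upto \<omega> n)" and \<omega>: "\<omega> \<in> boundary I"
    by (auto simp: cylinder_iff below_def)
  have "a \<in> \<omega> 0" if "a \<in> c" for a
    using letter_below_normal_seq tle_trans[OF tle_letter_clique_word[OF assms that] n] \<omega>
    by (auto simp: boundary_iff)
  with \<omega> show "\<omega> \<in> {\<omega> \<in> boundary I. c \<subseteq> \<omega> 0}" by blast
next
  fix \<omega> assume "\<omega> \<in> {\<omega> \<in> boundary I. c \<subseteq> \<omega> 0}"
  then have \<omega>: "\<omega> \<in> boundary I" "c \<subseteq> \<omega> 0" by auto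
  then have "tle I (clique_word c) (word_upto \<omega> (Suc 0))"
    using tle_clique_word by (simp add: boundary_iff normal_seq_def)
  with \<omega> show "\<omega> \<in> cylinder I (trace_of I (clique_word c))" unfolding cylinder_iff below_def by blast
qed

lemma cylinder_lcat:
  assumes R: "clique I R"
  shows "cylinder I (trace_of I (clique_word R @ u)) = lcat I R ` cylinder I (trace_of I u)"
proof (intro equalityI subsetI)
  fix \<omega> assume w: "\<omega> \<in> cylinder I (trace_of I (clique_word R @ u))"
  then have "\<omega> \<in> cylinder I (trace_of I (clique_word R))"
    unfolding cylinder_iff below_def using tle_trans[OF tle_append] by blast
  then obtain \<eta> where \<eta>: "\<eta> \<in> boundary I" "lcat I R \<eta> = \<omega>"
    using lcat_surj[of \<omega> R] by (auto simp: cylinder_clique[OF R])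
  then have "below u \<eta>" using w below_lcat_append[OF R, of \<eta> u] by (auto simp: cylinder_iff boundary_iff)
  with \<eta> show "\<omega> \<in> lcat I R ` cylinder I (trace_of I u)" by (auto simp: cylinder_iff)
next
  fix \<omega> assume "\<omega> \<in> lcat I R ` cylinder I (trace_of I u)"
  then obtain \<eta> where \<eta>: "\<eta> \<in> boundary I" "below u \<eta>" "\<omega> = lcat I R \<eta>" by (auto simp: cylinder_iff)
  then show "\<omega> \<in> cylinder I (trace_of I (clique_word R @ u))"
    using lcat_boundary[OF R \<eta>(1)] below_lcat_append[OF R, of \<eta> u] by (simp add: cylinder_iff boundary_iff)
qed

lemma cylinder_lcats:
  "\<forall>c\<in>set p. clique I c \<Longrightarrow>
    cylinder I (trace_of I (cliques_word p @ u)) = lcats I p ` cylinder I (trace_of I u)"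
proof (induction p)
  case Nil
  have "lcats I [] = id" by (simp add: fun_eq_iff)
  then show ?case by simp
next
  case (Cons R p)
  have "lcats I (R # p) = lcat I R \<circ> lcats I p" by (simp add: fun_eq_iff)
  with Cons show ?case by (simp add: cylinder_lcat image_comp comp_def)
qed

lemma cylinder_one: "cylinder I (trace_of I []) = boundary I"
  by (auto simp: cylinder_iff below_def)

lemma lcats_boundary_image:
  "\<forall>c\<in>set p. clique I c \<Longrightarrow> lcats I p ` boundary I = cylinder I (trace_of I (cliques_word p))"
  using cylinder_lcats[of p "[]"] by (simp add: cylinder_one)

text \<open>Continuity of the removal of \<open>p\<close>: each clique of \<open>p\<close> costs one level of
  information.\<close>

lemma lcats_local:
  assumes p: "\<forall>c\<in>set p. clique I c" and nw: "normal_seq I \<omega>" "normal_seq I \<eta>"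
    and agree: "\<And>i. i < n + length p \<Longrightarrow> lcats I p \<omega> i = lcats I p \<eta> i" and i: "i < n"
  shows "\<omega> i = \<eta> i"
  using p agree i
proof (induction p arbitrary: n i)
  case (Cons R p)
  let ?\<alpha> = "lcats I p \<omega>" and ?\<beta> = "lcats I p \<eta>"
  have R: "clique I R" and n\<alpha>: "normal_seq I ?\<alpha>" and n\<beta>: "normal_seq I ?\<beta>"
    using Cons.prems nw by (auto simp: normal_seq_lcats)
  have sub: "\<alpha> k \<subseteq> \<beta> k" if nw': "normal_seq I \<alpha>" "normal_seq I \<beta>" "k < m"
    and eq: "\<And>i. i < Suc m \<Longrightarrow> lcat I R \<alpha> i = lcat I R \<beta> i" for \<alpha> \<beta> :: "nat \<Rightarrow> 'a set" and m k
  proof -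
    have "tle I (clique_word R @ word_upto \<alpha> m) (word_upto (lcat I R \<alpha>) m @ clique_word (carry I R \<alpha> m))"
      by (rule teq_imp_tle[OF lcat_word[OF R nw'(1)]])
    also have "tle I (clique_word (carry I R \<alpha> m)) (clique_word (lcat I R \<alpha> m))"
      using normal_seq_lcat[OF R nw'(1)] by (intro tle_clique_word) (auto simp: normal_seq_def lcat_def)
    then have "tle I (word_upto (lcat I R \<alpha>) m @ clique_word (carry I R \<alpha> m)) (word_upto (lcat I R \<alpha>) (Suc m))"
      by simp
    also have "word_upto (lcat I R \<alpha>) (Suc m) = word_upto (lcat I R \<beta>) (Suc m)"
      by (rule word_upto_cong) (use eq in auto)
    finally have "below (clique_word R @ word_upto \<alpha> m) (lcat I R \<beta>)"
      unfolding below_def by blast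
    then obtain l where "tle I (word_upto \<alpha> m) (word_upto \<beta> l)"
      using below_lcat_append[OF R nw'(2)] unfolding below_def by blast
    with normal_seq_below nw' show ?thesis by blast
  qed
  have "?\<alpha> k = ?\<beta> k" if "k < n + length p" for k
    using sub[OF n\<alpha> n\<beta> that] sub[OF n\<beta> n\<alpha> that] Cons.prems by force
  from Cons.IH[of n i, OF _ this] Cons.prems show ?case by simp
qed simp

text \<open>If the arrow condition holds at the junction, every level is displaced entirely, and concatenation
  is juxtaposition.\<close>

lemma lcats_prepend:
  assumes "normal_list I w" "w \<noteq> []" "\<omega> \<in> boundary I" "clique_arrow I (last w) (\<omega> 0)"
  shows "lcats I w \<omega> = (\<lambda>i. if i < length w then w ! i else \<omega> (i - length w))
     \<and> lcats I w \<omega> \<in> boundary I"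
  using assms(1,2,4)
proof (induction w)
  case (Cons R w)
  have R: "clique I R" using Cons.prems by (simp add: normal_list_def)
  define \<eta> where "\<eta> = lcats I w \<omega>"
  have *: "\<eta> = (\<lambda>i. if i < length w then w ! i else \<omega> (i - length w)) \<and> \<eta> \<in> boundary I
     \<and> clique_arrow I R (\<eta> 0)"
  proof (cases "w = []")
    case True
    then show ?thesis using Cons.prems assms(3) by (simp add: \<eta>_def)
  next
    case False
    then have "normal_list I w" "clique_arrow I R (hd w)"
      using Cons.prems by (auto simp: normal_list_def successively_Cons)
    then have e: "\<eta> = (\<lambda>i. if i < length w then w ! i else \<omega> (i - length w))" and "\<eta> \<in> boundary I"
      using Cons False by (auto simp: \<eta>_def)
    moreover have "\<eta> 0 = hd w" using False by (subst e) (simp add: hd_conv_nth)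
    ultimately show ?thesis using \<open>clique_arrow I R (hd w)\<close> by simp
  qed
  then have "lcat I R \<eta> = case_nat R \<eta>" using lcat_prepend[of I R \<eta>] unfolding boundary_iff by blast
  moreover have "lcat I R \<eta> \<in> boundary I" using lcat_boundary[OF R] * by blast
  moreover have "case_nat R \<eta> = (\<lambda>i. if i < length (R # w) then (R # w) ! i else \<omega> (i - length (R # w)))"
    using * by (auto simp: fun_eq_iff split: nat.split)
  ultimately show ?case unfolding lcats_Cons \<eta>_def[symmetric] by metis
qed simp

lemma elementary_lcats:
  assumes w: "normal_list I (w @ [c])"
  shows "elementary I (w @ [c]) = lcats I w ` {\<omega> \<in> boundary I. \<omega> 0 = c}"
proof (cases "w = []")
  case True
  have "lcats I [] = id" by (simp add: fun_eq_iff)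
  then show ?thesis using True by (auto simp: elementary_iff)
next
  case False
  have nw: "normal_list I w" and ar: "clique_arrow I (last w) c"
    using w False by (auto simp: normal_list_def successively_append_iff)
  show ?thesis
  proof (intro equalityI subsetI)
    fix \<omega> assume \<omega>: "\<omega> \<in> elementary I (w @ [c])"
    define \<eta> where "\<eta> i = \<omega> (i + length w)" for i
    have "\<eta> \<in> boundary I" using \<omega> by (simp add: elementary_iff boundary_def \<eta>_def)
    moreover have "\<eta> 0 = c" using \<omega> by (simp add: elementary_iff \<eta>_def)
    moreover have "lcats I w \<eta> = \<omega>"
      using lcats_prepend[OF nw False calculation(1)] calculation(2) ar \<omega>
      by (auto simp: elementary_iff \<eta>_def fun_eq_iff nth_append)
    ultimately show "\<omega> \<in> lcats I w ` {\<omega> \<in> boundary I. \<omega> 0 = c}" by blast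
  next
    fix \<omega> assume "\<omega> \<in> lcats I w ` {\<omega> \<in> boundary I. \<omega> 0 = c}"
    then obtain \<eta> where \<eta>: "\<eta> \<in> boundary I" "\<eta> 0 = c" "\<omega> = lcats I w \<eta>" by blast
    then have "\<omega> = (\<lambda>i. if i < length w then w ! i else \<eta> (i - length w))" "\<omega> \<in> boundary I"
      using lcats_prepend[OF nw False, of \<eta>] ar by auto
    then show "\<omega> \<in> elementary I (w @ [c])"
      using \<eta>(2) unfolding elementary_iff by (auto simp: nth_append)
  qed
qed

lemma normal_list_upto: "\<omega> \<in> boundary I \<Longrightarrow> normal_list I (map \<omega> [0..<n])"
  by (auto simp: normal_list_def boundary_def successively_conv_nth)

lemma elementary_empty: "\<not> normal_list I w \<Longrightarrow> elementary I w = {}"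
proof (rule ccontr)
  assume w: "\<not> normal_list I w" and "elementary I w \<noteq> {}"
  then obtain \<omega> where "\<omega> \<in> boundary I" "w = map \<omega> [0..<length w]"
    unfolding elementary_def by force
  with w normal_list_upto show False by metis
qed

text \<open>Concatenation on the left only shifts letters by one level, so it changes the number of
  occurrences of a letter by at most one per clique.\<close>

lemma lcats_count:
  assumes "\<forall>c\<in>set p. clique I c" "normal_seq I \<omega>"
  shows "\<bar>real (count_list (word_upto (lcats I p \<omega>) n) a) - real (count_list (word_upto \<omega> n) a)\<bar> \<le> real (length p)"
  using assms(1)
proof (induction p)
  case (Cons R p)
  let ?\<eta> = "lcats I p \<omega>"
  have "count_list (clique_word R @ word_upto ?\<eta> n) a =
      count_list (word_upto (lcat I R ?\<eta>) n @ clique_word (carry I R ?\<eta> n)) a"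
    by (rule teq_count[OF lcat_word]) (use Cons.prems assms(2) normal_seq_lcats in auto)
  then have "\<bar>real (count_list (word_upto (lcat I R ?\<eta>) n) a) - real (count_list (word_upto ?\<eta> n) a)\<bar> \<le> 1"
    by (simp add: count_clique_word of_bool_def split: if_splits)
  with Cons show ?case by simp
qed simp

lemma first_clique_lcats_letters:
  "c \<in> lcats I (letters w) \<eta> 0 \<Longrightarrow>
    (\<exists>p q. w = p @ c # q \<and> c \<notin> set p \<and> (\<forall>b\<in>set p. (b, c) \<in> I)) \<or> (c \<notin> set w \<and> c \<in> \<eta> 0)"
proof (induction w)
  case (Cons b w)
  show ?case
  proof (cases "c = b")
    case True
    then have "b # w = [] @ c # w \<and> c \<notin> set [] \<and> (\<forall>b\<in>set []. (b, c) \<in> I)" by simp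
    then show ?thesis by blast
  next
    case False
    then have "c \<in> lcats I (letters w) \<eta> 0" "(b, c) \<in> I" using Cons.prems by (auto simp: lcat_0)
    from Cons.IH[OF this(1)] show ?thesis
    proof
      assume "\<exists>p q. w = p @ c # q \<and> c \<notin> set p \<and> (\<forall>b\<in>set p. (b, c) \<in> I)"
      then obtain p q where "w = p @ c # q" "c \<notin> set p" "\<forall>b\<in>set p. (b, c) \<in> I" by blast
      then have "b # w = (b # p) @ c # q \<and> c \<notin> set (b # p) \<and> (\<forall>x\<in>set (b # p). (x, c) \<in> I)"
        using False \<open>(b, c) \<in> I\<close> by simp
      then show ?thesis by blast
    qed (use False in simp)
  qed
qed simp

text \<open>As \<open>a\<close> is the only letter with which \<open>\<eta>\<close> can start, each letter of
  \<open>u\<close> in turn has to be found in \<open>x\<close> and can be cancelled there.\<close>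

lemma avoiding_below_imp_tle:
  assumes "normal_seq I \<eta>" "\<eta> 0 = {a}"
  shows "a \<notin> set u \<Longrightarrow> below u (lcats I (letters x) \<eta>) \<Longrightarrow> tle I u x"
proof (induction u arbitrary: x)
  case (Cons c u)
  have cl: "\<forall>c\<in>set (letters w). clique I c" for w :: "'a list" using clique_letters by blast
  note nf = normal_seq_lcats[OF cl assms(1)]
  obtain n where n: "tle I ([c] @ u) (word_upto (lcats I (letters x) \<eta>) n)"
    using Cons.prems(2) unfolding below_def by auto
  have "c \<in> lcats I (letters x) \<eta> 0"
    using letter_below_normal_seq[OF nf tle_trans[OF tle_append n]] .
  from first_clique_lcats_letters[OF this] Cons.prems(1) assms(2)
  obtain p q where x: "x = p @ c # q" and p: "\<forall>b\<in>set p. (b, c) \<in> I" by auto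
  have e: "teq I x ([c] @ p @ q)" unfolding x using teq_move[OF p] by simp
  obtain m where "tle I (c # u) (x @ word_upto \<eta> m)"
    using Cons.prems(2) below_lcats[OF cl assms(1)] by auto
  then have "tle I ([c] @ u) (([c] @ p @ q) @ word_upto \<eta> m)"
    using teq_imp_tle[OF teq_append[OF e teq_refl]] tle_trans by force
  then have "tle I u ((p @ q) @ word_upto \<eta> m)" by (simp only: append_assoc tle_append_same)
  then have "below u (lcats I (letters (p @ q)) \<eta>)"
    using below_lcats[OF cl assms(1), of u "p @ q"] by auto
  then have "tle I u (p @ q)" using Cons by simp
  then have "tle I ([c] @ u) ([c] @ p @ q)" by (simp only: tle_append_same)
  then show ?case using teq_imp_tle[OF teq_sym[OF e]] tle_trans by force
qed simp

end

section \<open>Markov measures on cylinders\<close>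

lemma openin_elementary: "openin (boundary_topology I) (elementary I w)"
proof -
  let ?U = "\<Pi>\<^sub>E i\<in>UNIV. (if i < length w then {w ! i} else (UNIV :: 'a set set))"
  have "finite {i. (if i < length w then {w ! i} else (UNIV :: 'a set set)) \<noteq> UNIV}"
    by (rule finite_subset[of _ "{..<length w}"]) auto
  then have "openin (product_topology (\<lambda>_. discrete_topology UNIV) UNIV) ?U"
    by (subst openin_PiE_gen) simp
  moreover have "elementary I w = ?U \<inter> boundary I"
    by (auto simp: elementary_iff PiE_iff split: if_splits)
  ultimately show ?thesis unfolding boundary_topology_def openin_subtopology by blast
qed

lemma openin_boundary_Union_elementary:
  assumes "openin (boundary_topology I) U"
  shows "U = (\<Union>w\<in>{w. elementary I w \<subseteq> U}. elementary I w)"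
proof (intro equalityI subsetI)
  fix \<omega> assume \<omega>: "\<omega> \<in> U"
  obtain T where T: "openin (product_topology (\<lambda>_. discrete_topology UNIV) UNIV) T" "U = T \<inter> boundary I"
    using assms unfolding boundary_topology_def openin_subtopology by blast
  then obtain V where V: "finite {i. V i \<noteq> (UNIV :: 'a set set)}" "\<omega> \<in> Pi\<^sub>E UNIV V" "Pi\<^sub>E UNIV V \<subseteq> T"
    using \<omega> unfolding openin_product_topology_alt by fastforce
  then obtain n where n: "\<And>i. V i \<noteq> UNIV \<Longrightarrow> i < n"
    using finite_nat_set_iff_bounded by auto
  have "elementary I (map \<omega> [0..<n]) \<subseteq> U"
  proof
    fix \<eta> assume \<eta>: "\<eta> \<in> elementary I (map \<omega> [0..<n])"
    have "\<eta> i \<in> V i" for i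
      using n[of i] \<eta> V(2) by (cases "i < n") (auto simp: elementary_iff PiE_iff)
    then show "\<eta> \<in> U" using V(3) \<eta> T(2) by (auto simp: elementary_iff PiE_iff)
  qed
  moreover have "\<omega> \<in> elementary I (map \<omega> [0..<n])" using \<omega> T by (simp add: elementary_iff)
  ultimately show "\<omega> \<in> (\<Union>w\<in>{w. elementary I w \<subseteq> U}. elementary I w)" by blast
qed auto

lemma elementary_snoc_iff:
  "\<omega> \<in> elementary I (w @ [d]) \<longleftrightarrow> \<omega> \<in> elementary I w \<and> \<omega> (length w) = d"
  by (auto simp: elementary_iff nth_append less_Suc_eq)

lemma space_boundary_borel [simp]: "space (boundary_borel I) = boundary I"
  by (simp add: boundary_borel_def space_measure_of_conv)

lemma sets_boundary_borel:
  "sets (boundary_borel (I :: ('a::finite \<times> 'a) set)) = sigma_sets (boundary I) (range (elementary I))"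
proof -
  have sub: "{U. openin (boundary_topology I) U} \<subseteq> Pow (boundary I)"
    using openin_subset by (force simp: boundary_topology_def)
  have "sigma_sets (boundary I) {U. openin (boundary_topology I) U}
      = sigma_sets (boundary I) (range (elementary I))"
  proof (rule sigma_sets_eqI)
    fix U assume "U \<in> {U. openin (boundary_topology I) U}"
    then have U: "U = (\<Union>w\<in>{w. elementary I w \<subseteq> U}. elementary I w)"
      using openin_boundary_Union_elementary by blast
    interpret sigma_algebra "boundary I" "sigma_sets (boundary I) (range (elementary I))"
      by (rule sigma_algebra_sigma_sets) (auto simp: elementary_def)
    show "U \<in> sigma_sets (boundary I) (range (elementary I))"
      by (subst U, intro countable_UN') auto
  qed (use openin_elementary in auto)
  then show ?thesis using sub by (simp add: boundary_borel_def sets_measure_of)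
qed

lemma Int_stable_elementary: "Int_stable (range (elementary I))"
proof (rule Int_stableI)
  have *: "\<exists>u. elementary I v \<inter> elementary I w = elementary I u" if "length v \<le> length w" for v w
  proof (cases "take (length v) w = v")
    case True
    then have "v ! i = w ! i" if "i < length v" for i using that by (metis nth_take)
    then have "elementary I v \<inter> elementary I w = elementary I w"
      using that by (auto simp: elementary_iff)
    then show ?thesis by blast
  next
    case False
    then have "elementary I v \<inter> elementary I w = {}"
      using that by (auto simp: elementary_iff list_eq_iff_nth_eq)
    moreover have "elementary I [{}] = {}" by (auto simp: elementary_iff boundary_def)
    ultimately show ?thesis by metis
  qed
  fix a b assume "a \<in> range (elementary I)" "b \<in> range (elementary I)"
  then obtain v w where "a = elementary I v" "b = elementary I w" by blast
  then show "a \<inter> b \<in> range (elementary I)"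
    using *[of v w] *[of w v] by (cases "length v \<le> length w") (auto simp: Int_commute)
qed

lemma sets_elementary [measurable, simp]:
  "elementary (I :: ('a::finite \<times> 'a) set) w \<in> sets (boundary_borel I)"
  unfolding sets_boundary_borel by blast

lemma sets_finite_coordinates:
  fixes I :: "('a::finite \<times> 'a) set"
  assumes "A \<subseteq> boundary I"
    and "\<And>\<omega> \<eta>. \<omega> \<in> A \<Longrightarrow> \<eta> \<in> boundary I \<Longrightarrow> (\<And>i. i < n \<Longrightarrow> \<eta> i = \<omega> i) \<Longrightarrow> \<eta> \<in> A"
  shows "A \<in> sets (boundary_borel I)"
proof -
  have "A = (\<Union>w\<in>(\<lambda>\<omega>. map \<omega> [0..<n]) ` A. elementary I w)"
    using assms by (fastforce simp: elementary_iff)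
  moreover have "(\<Union>w\<in>(\<lambda>\<omega>. map \<omega> [0..<n]) ` A. elementary I w) \<in> sets (boundary_borel I)"
    by (intro sets.countable_UN') auto
  ultimately show ?thesis by simp
qed

lemma sum_alternating_Pow:
  assumes "finite D" shows "(\<Sum>X\<in>Pow D. (-1) ^ card X) = (of_bool (D = {}) :: real)"
proof -
  have "(\<Sum>X\<in>Pow D. (-1) ^ card X) = (\<Prod>x\<in>D. 1 - 1 :: real)"
    using prod_diff_conv_sum[OF assms, of "\<lambda>_. 1 :: real" "\<lambda>_. 1"] by simp
  then show ?thesis using assms by (cases "D = {}") (simp_all add: card_gt_0_iff)
qed

text \<open>Moebius inversion on the lattice of subsets. It is stated for a down-closed family, since between
  two cliques there are only cliques.\<close>

lemma moebius_upward:
  fixes m :: "'a::finite set \<Rightarrow> real"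
  assumes "\<And>c d. P d \<Longrightarrow> c \<subseteq> d \<Longrightarrow> P c" and "P c"
  shows "(\<Sum>d | P d \<and> c \<subseteq> d. (-1) ^ (card d - card c) * (\<Sum>e | P e \<and> d \<subseteq> e. m e)) = m c"
proof -
  have "(\<Sum>d | P d \<and> c \<subseteq> d. (-1) ^ (card d - card c) * (\<Sum>e | P e \<and> d \<subseteq> e. m e))
      = (\<Sum>d | P d \<and> c \<subseteq> d. \<Sum>e | P e \<and> d \<subseteq> e. (-1) ^ (card d - card c) * m e)"
    by (simp add: sum_distrib_left)
  also have "\<dots> = (\<Sum>e | P e \<and> c \<subseteq> e. \<Sum>d | c \<subseteq> d \<and> d \<subseteq> e. (-1) ^ (card d - card c) * m e)"
    by (subst sum.Sigma, simp, simp, subst sum.Sigma, simp, simp,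
        rule sum.reindex_bij_witness[of _ "\<lambda>(x, y). (y, x)" "\<lambda>(x, y). (y, x)"]) (use assms(1) in auto)
  also have "\<dots> = (\<Sum>e | P e \<and> c \<subseteq> e. of_bool (e = c) * m e)"
  proof (rule sum.cong[OF refl])
    fix e assume "e \<in> {e. P e \<and> c \<subseteq> e}"
    then have ce: "c \<subseteq> e" by simp
    have "(\<Sum>d | c \<subseteq> d \<and> d \<subseteq> e. (-1) ^ (card d - card c) :: real) = (\<Sum>X\<in>Pow (e - c). (-1) ^ card X)"
      by (rule sum.reindex_bij_witness[of _ "\<lambda>X. X \<union> c" "\<lambda>d. d - c"])
        (use ce in \<open>auto simp: card_Diff_subset\<close>)
    also have "\<dots> = of_bool (e = c)" by (subst sum_alternating_Pow) (use ce in auto)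
    finally show "(\<Sum>d | c \<subseteq> d \<and> d \<subseteq> e. (-1) ^ (card d - card c) * m e) = of_bool (e = c) * m e"
      by (simp flip: sum_distrib_right)
  qed
  also have "\<dots> = (\<Sum>e\<in>{c}. m e)"
    by (rule sum.mono_neutral_cong_right) (use assms(2) in auto)
  finally show ?thesis by simp
qed

context independence
begin

text \<open>For elementary sets this follows from \<open>lcats_local\<close>; injectivity of the concatenation
  lets the claim pass to complements.\<close>

lemma sets_lcats_image:
  assumes p: "\<forall>c\<in>set p. clique I c" and A: "A \<in> sets (boundary_borel I)"
  shows "lcats I p ` A \<in> sets (boundary_borel I)"
  using A unfolding sets_boundary_borel
proof (induction rule: sigma_sets.induct)
  case (Basic A)
  then obtain w where A: "A = elementary I w" by blast
  let ?h = "ht (cliques_word p)"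
  show ?case unfolding sets_boundary_borel[symmetric]
  proof (rule sets_finite_coordinates[where n = "length w + length p + ?h"])
    show "lcats I p ` A \<subseteq> boundary I" using p lcats_boundary unfolding A by (auto simp: elementary_iff)
    fix \<omega> \<eta> assume \<omega>: "\<omega> \<in> lcats I p ` A" and \<eta>: "\<eta> \<in> boundary I"
      and agree: "\<And>i. i < length w + length p + ?h \<Longrightarrow> \<eta> i = \<omega> i"
    from \<omega> obtain \<omega>' where \<omega>': "\<omega>' \<in> elementary I w" "\<omega> = lcats I p \<omega>'" unfolding A by blast
    then have b: "\<omega>' \<in> boundary I" and n\<omega>': "normal_seq I \<omega>'" by (auto simp: elementary_iff boundary_iff)
    have "\<omega> \<in> cylinder I (trace_of I (cliques_word p))"
      using lcats_boundary_image[OF p] \<omega>' b by blast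
    then obtain n where "tle I (cliques_word p) (word_upto \<omega> n)" "normal_seq I \<omega>"
      by (auto simp: cylinder_iff below_def boundary_iff)
    then have "tle I (cliques_word p) (word_upto \<omega> ?h)" using tle_word_upto_height by blast
    also have "word_upto \<omega> ?h = word_upto \<eta> ?h" by (rule word_upto_cong) (simp add: agree)
    finally have "\<eta> \<in> cylinder I (trace_of I (cliques_word p))"
      using \<eta> unfolding cylinder_iff below_def by blast
    then obtain \<eta>' where \<eta>': "\<eta>' \<in> boundary I" "\<eta> = lcats I p \<eta>'"
      using lcats_boundary_image[OF p] by blast
    have "\<eta>' i = \<omega>' i" if "i < length w" for i
      by (rule lcats_local[OF p _ n\<omega>' _ that]) (use \<eta>' agree \<omega>' in \<open>auto simp: boundary_iff\<close>)
    with \<omega>' \<eta>' have "\<eta>' \<in> elementary I w" by (simp add: elementary_iff)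
    with \<eta>' A show "\<eta> \<in> lcats I p ` A" by blast
  qed
next
  case Empty
  then show ?case by (simp add: sigma_sets.Empty)
next
  case (Compl A)
  have sub: "A \<subseteq> boundary I"
    using Compl.hyps sets.sets_into_space[of A "boundary_borel I"] unfolding sets_boundary_borel by simp
  have "lcats I p ` (boundary I - A) = cylinder I (trace_of I (cliques_word p)) - lcats I p ` A"
    unfolding lcats_boundary_image[OF p, symmetric]
    by (rule inj_on_image_set_diff[OF inj_on_lcats[OF p]]) (use sub in auto)
  moreover have "cylinder I (trace_of I (cliques_word p)) \<in> sets (boundary_borel I)"
  proof (rule sets_finite_coordinates[where n = "ht (cliques_word p)"])
    show "cylinder I (trace_of I (cliques_word p)) \<subseteq> boundary I" by (auto simp: cylinder_def)
    fix \<omega> \<eta> assume \<omega>: "\<omega> \<in> cylinder I (trace_of I (cliques_word p))" and \<eta>: "\<eta> \<in> boundary I"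
      and agree: "\<And>i. i < ht (cliques_word p) \<Longrightarrow> \<eta> i = \<omega> i"
    then obtain n where "tle I (cliques_word p) (word_upto \<omega> n)" "normal_seq I \<omega>"
      by (auto simp: cylinder_iff below_def boundary_iff)
    then have "tle I (cliques_word p) (word_upto \<omega> (ht (cliques_word p)))"
      using tle_word_upto_height by blast
    also have "word_upto \<omega> (ht (cliques_word p)) = word_upto \<eta> (ht (cliques_word p))"
      by (rule word_upto_cong) (simp add: agree)
    finally show "\<eta> \<in> cylinder I (trace_of I (cliques_word p))"
      using \<eta> unfolding cylinder_iff below_def by blast
  qed
  ultimately show ?case using Compl.IH unfolding sets_boundary_borel[symmetric] by simp
next
  case (Union A)
  then show ?case unfolding image_UN by (intro sigma_sets.Union)
qed

lemma sets_cylinder [simp]: "cylinder I (trace_of I u) \<in> sets (boundary_borel I)"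
proof -
  have c: "\<forall>c\<in>set (letters u). clique I c" using clique_letters by blast
  have "boundary I \<in> sets (boundary_borel I)" using sets.top[of "boundary_borel I"] by simp
  from sets_lcats_image[OF c this] show ?thesis by (simp add: lcats_boundary_image[OF c])
qed

end

abbreviation first_is :: "('a \<times> 'a) set \<Rightarrow> 'a set \<Rightarrow> (nat \<Rightarrow> 'a set) set" where
  "first_is I c \<equiv> {\<omega> \<in> boundary I. \<omega> 0 = c}"

lemma first_is_elementary: "first_is I c = elementary I [c]"
  by (auto simp: elementary_iff)

locale markov_system = concurrent_system I act
  for I :: "('a::finite \<times> 'a) set" and act :: "'s::finite option \<Rightarrow> 'a list set \<Rightarrow> 's option" +
  fixes \<nu> :: "'s \<Rightarrow> (nat \<Rightarrow> 'a set) measure"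
  assumes markov: "markov_measure I act \<nu>"
begin

abbreviation run :: "'s option \<Rightarrow> 'a list \<Rightarrow> 's option" where
  "run p u \<equiv> act p (trace_of I u)"

text \<open>\<open>f_val\<close>, transported to words.\<close>

abbreviation F :: "'s \<Rightarrow> 'a list \<Rightarrow> real" where
  "F \<alpha> u \<equiv> measure (\<nu> \<alpha>) (cylinder I (trace_of I u))"

lemma trace_carrier [simp]: "trace_of I u \<in> carrier (trace_monoid I)"
  by (simp add: carrier_trace_monoid)

lemma run_append: "run p (u @ v) = run (run p u) v"
  using act_mult[of "trace_of I u" "trace_of I v" p] by (simp add: trace_mult)

lemma run_Nil [simp]: "run p [] = p"
  using act_one[of p] by (simp add: one_trace)

lemma run_None [simp]: "run None u = None"
  using act_bot[of "trace_of I u"] by simp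

lemma traces_from_iff: "trace_of I u \<in> traces_from I act \<alpha> \<longleftrightarrow> run (Some \<alpha>) u \<noteq> None"
  by (simp add: traces_from_def)

lemma prob_space_nu [simp]: "prob_space (\<nu> \<alpha>)"
  and space_nu [simp]: "space (\<nu> \<alpha>) = boundary I"
  and sets_nu [simp, measurable_cong]: "sets (\<nu> \<alpha>) = sets (boundary_borel I)"
  using markov by (simp_all add: markov_measure_def)

lemma finite_measure_nu [simp]: "finite_measure (\<nu> \<alpha>)"
  using prob_space_nu by (rule prob_space.axioms)

lemma measure_boundary [simp]: "measure (\<nu> \<alpha>) (boundary I) = 1"
  using prob_space.prob_space[OF prob_space_nu, of \<alpha>] by simp

lemma F_pos_iff: "F \<alpha> u > 0 \<longleftrightarrow> run (Some \<alpha>) u \<noteq> None"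
  using markov unfolding markov_measure_def traces_from_iff[symmetric]
  using trace_carrier by blast

lemma F_None: "run (Some \<alpha>) u = None \<Longrightarrow> F \<alpha> u = 0"
  using F_pos_iff[of \<alpha> u] measure_nonneg[of "\<nu> \<alpha>"] by (simp add: less_le)

lemma F_append: "run (Some \<alpha>) u = Some \<beta> \<Longrightarrow> F \<alpha> (u @ v) = F \<alpha> u * F \<beta> v"
  using markov trace_carrier[of u] trace_carrier[of v]
  unfolding markov_measure_def trace_mult[symmetric] by (simp split: option.splits)

lemma AE_boundary_from: "AE \<omega> in \<nu> \<alpha>. \<omega> \<in> boundary_from I act \<alpha>"
proof -
  have 1: "measure (\<nu> \<alpha>) (boundary_from I act \<alpha>) = 1"
    using markov by (simp add: markov_measure_def)
  then have "boundary_from I act \<alpha> \<in> sets (\<nu> \<alpha>)"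
    using measure_notin_sets by fastforce
  from prob_space.AE_in_set_eq_1[OF prob_space_nu this] 1 show ?thesis by simp
qed

text \<open>A cylinder is the disjoint union of the events that prescribe one clique exactly. Reading this as
  a triangular system of equations determines the exact events from cylinders.\<close>

lemma measure_lcats_supset:
  assumes p: "\<forall>c\<in>set p. clique I c" and c: "clique I c"
  shows "F \<alpha> (cliques_word p @ clique_word c) =
    (\<Sum>d | clique I d \<and> c \<subseteq> d. measure (\<nu> \<alpha>) (lcats I p ` first_is I d))"
proof -
  have "cylinder I (trace_of I (cliques_word p @ clique_word c)) =
      lcats I p ` {\<omega> \<in> boundary I. c \<subseteq> \<omega> 0}"
    using cylinder_lcats[OF p] cylinder_clique[OF c] by simp
  also have "{\<omega> \<in> boundary I. c \<subseteq> \<omega> 0} = (\<Union>d\<in>{d. clique I d \<and> c \<subseteq> d}. first_is I d)"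
    by (auto simp: boundary_def)
  finally have e: "cylinder I (trace_of I (cliques_word p @ clique_word c)) =
      (\<Union>d\<in>{d. clique I d \<and> c \<subseteq> d}. lcats I p ` first_is I d)" by (simp add: image_UN)
  show ?thesis unfolding e
  proof (rule finite_measure.finite_measure_finite_Union[OF finite_measure_nu])
    show "(\<lambda>d. lcats I p ` first_is I d) ` {d. clique I d \<and> c \<subseteq> d} \<subseteq> sets (\<nu> \<alpha>)"
      using sets_lcats_image[OF p] by (auto simp: first_is_elementary)
    show "disjoint_family_on (\<lambda>d. lcats I p ` first_is I d) {d. clique I d \<and> c \<subseteq> d}"
      using inj_on_lcats[OF p] by (auto simp: disjoint_family_on_def inj_on_def)
  qed simp
qed

lemma h_val_eq:
  assumes c: "clique I c" shows "h_val I \<nu> \<alpha> c = measure (\<nu> \<alpha>) (first_is I c)"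
proof -
  have le: "trace_le I (clique_trace I c) (clique_trace I d) \<longleftrightarrow> c \<subseteq> d" if "clique I d" for d
  proof
    assume "trace_le I (clique_trace I c) (clique_trace I d)"
    then have "tle I (clique_word c) (clique_word d)" by (simp add: clique_trace_word trace_le_iff_tle)
    then have "a \<in> c \<Longrightarrow> a \<in> d" for a
      using tle_count[of "clique_word c" "clique_word d" a] by (cases "a \<in> d") (simp_all add: count_clique_word)
    then show "c \<subseteq> d" by blast
  next
    assume "c \<subseteq> d"
    then show "trace_le I (clique_trace I c) (clique_trace I d)"
      using tle_clique_word[OF that] by (simp add: clique_trace_word trace_le_iff_tle)
  qed
  have id: "lcats I [] = id" by (simp add: fun_eq_iff)
  have f: "f_val I \<nu> \<alpha> (clique_trace I d) = (\<Sum>e | clique I e \<and> d \<subseteq> e. measure (\<nu> \<alpha>) (first_is I e))"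
    if "clique I d" for d
    using measure_lcats_supset[of "[]" d \<alpha>] that unfolding id by (simp add: f_val_def clique_trace_word)
  have "h_val I \<nu> \<alpha> c = (\<Sum>d | clique I d \<and> c \<subseteq> d.
      (-1) ^ (card d - card c) * (\<Sum>e | clique I e \<and> d \<subseteq> e. measure (\<nu> \<alpha>) (first_is I e)))"
    unfolding h_val_def using le f by (intro sum.cong) auto
  also have "\<dots> = measure (\<nu> \<alpha>) (first_is I c)"
    by (rule moebius_upward) (use c in \<open>auto intro: clique_subset\<close>)
  finally show ?thesis .
qed

lemma measure_lcats_first:
  assumes p: "\<forall>c\<in>set p. clique I c" and q: "\<forall>c\<in>set q. clique I c" and c: "clique I c"
    and run: "run (Some \<alpha>) (cliques_word p) = Some \<beta>"
  shows "measure (\<nu> \<alpha>) (lcats I (p @ q) ` first_is I c)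
    = F \<alpha> (cliques_word p) * measure (\<nu> \<beta>) (lcats I q ` first_is I c)"
proof -
  have pq: "\<forall>c\<in>set (p @ q). clique I c" using p q by auto
  let ?K = "F \<alpha> (cliques_word p)"
  let ?m = "\<lambda>d. measure (\<nu> \<alpha>) (lcats I (p @ q) ` first_is I d)"
  let ?n = "\<lambda>d. ?K * measure (\<nu> \<beta>) (lcats I q ` first_is I d)"
  have eq: "(\<Sum>d | clique I d \<and> e \<subseteq> d. ?m d) = (\<Sum>d | clique I d \<and> e \<subseteq> d. ?n d)" if "clique I e" for e
    using measure_lcats_supset[OF pq that, of \<alpha>] measure_lcats_supset[OF q that, of \<beta>]
      F_append[OF run, of "cliques_word q @ clique_word e"] by (simp add: sum_distrib_left)
  have "?m c = (\<Sum>e | clique I e \<and> c \<subseteq> e. (-1) ^ (card e - card c) * (\<Sum>d | clique I d \<and> e \<subseteq> d. ?m d))"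
    by (rule moebius_upward[symmetric]) (use c in \<open>auto intro: clique_subset\<close>)
  also have "\<dots> = (\<Sum>e | clique I e \<and> c \<subseteq> e. (-1) ^ (card e - card c) * (\<Sum>d | clique I d \<and> e \<subseteq> d. ?n d))"
    by (rule sum.cong[OF refl]) (simp only: eq mem_Collect_eq)
  also have "\<dots> = ?n c"
    by (rule moebius_upward) (use c in \<open>auto intro: clique_subset\<close>)
  finally show ?thesis .
qed

text \<open>On cylinders this is the defining property of a Markov measure. Moebius inversion transfers it to
  elementary sets, which generate the Borel sets and are stable under intersection.\<close>

lemma measure_lcats:
  assumes p: "\<forall>c\<in>set p. clique I c" and run: "run (Some \<alpha>) (cliques_word p) = Some \<beta>"
    and A: "A \<in> sets (boundary_borel I)"
  shows "measure (\<nu> \<alpha>) (lcats I p ` A) = F \<alpha> (cliques_word p) * measure (\<nu> \<beta>) A"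
proof -
  have "range (elementary I) \<subseteq> Pow (boundary I)" by (auto simp: elementary_def)
  from Int_stable_elementary[of I] this A[unfolded sets_boundary_borel] show ?thesis
  proof (induction rule: sigma_sets_induct_disjoint)
    case (basic A)
    then obtain w where A: "A = elementary I w" by blast
    show ?case
    proof (cases w rule: rev_cases)
      case Nil
      then show ?thesis using lcats_boundary_image[OF p] by (simp add: A)
    next
      case (snoc q c)
      show ?thesis
      proof (cases "normal_list I w")
        case True
        then have q: "\<forall>c\<in>set q. clique I c" and c: "clique I c" by (auto simp: normal_list_def snoc)
        have e: "A = lcats I q ` first_is I c"
          using elementary_lcats True unfolding A snoc by blast
        have "lcats I p ` A = lcats I (p @ q) ` first_is I c"
          unfolding e image_image lcats_append ..
        then show ?thesis using measure_lcats_first[OF p q c run] e by simp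
      next
        case False
        then show ?thesis by (simp add: A elementary_empty)
      qed
    qed
  next
    case empty
    show ?case by simp
  next
    case (compl A)
    have As: "A \<in> sets (boundary_borel I)" using compl by (simp add: sets_boundary_borel)
    then have sub: "A \<subseteq> boundary I" using sets.sets_into_space by fastforce
    have "lcats I p ` (boundary I - A) = cylinder I (trace_of I (cliques_word p)) - lcats I p ` A"
      unfolding lcats_boundary_image[OF p, symmetric]
      by (rule inj_on_image_set_diff[OF inj_on_lcats[OF p]]) (use sub in auto)
    moreover have "lcats I p ` A \<subseteq> cylinder I (trace_of I (cliques_word p))"
      unfolding lcats_boundary_image[OF p, symmetric] using sub by blast
    ultimately have "measure (\<nu> \<alpha>) (lcats I p ` (boundary I - A)) = F \<alpha> (cliques_word p) - measure (\<nu> \<alpha>) (lcats I p ` A)"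
      using sets_lcats_image[OF p As] finite_measure.finite_measure_Diff[OF finite_measure_nu] by simp
    moreover have "measure (\<nu> \<beta>) (boundary I - A) = 1 - measure (\<nu> \<beta>) A"
      using prob_space.prob_compl[OF prob_space_nu, of A \<beta>] As by simp
    moreover have "measure (\<nu> \<alpha>) (lcats I p ` A) = F \<alpha> (cliques_word p) * measure (\<nu> \<beta>) A"
      using compl by simp
    ultimately show ?case by (simp only: right_diff_distrib mult_1_right)
  next
    case (union A)
    have As: "A i \<in> sets (boundary_borel I)" for i using union by (auto simp: sets_boundary_borel)
    then have sub: "A i \<subseteq> boundary I" for i using sets.sets_into_space by fastforce
    have "disjoint_family (\<lambda>i. lcats I p ` A i)"
      unfolding disjoint_family_on_def
    proof (intro ballI impI)
      fix i j :: nat assume "i \<noteq> j"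
      then have "A i \<inter> A j = {}" using union(1) by (simp add: disjoint_family_on_def)
      then show "lcats I p ` A i \<inter> lcats I p ` A j = {}"
        using inj_on_image_Int[OF inj_on_lcats[OF p] sub sub, of i j] by simp
    qed
    then have "(\<lambda>i. measure (\<nu> \<alpha>) (lcats I p ` A i)) sums measure (\<nu> \<alpha>) (\<Union>i. lcats I p ` A i)"
      using sets_lcats_image[OF p As]
      by (intro finite_measure.finite_measure_UNION[OF finite_measure_nu]) auto
    then have 1: "(\<lambda>i. F \<alpha> (cliques_word p) * measure (\<nu> \<beta>) (A i)) sums measure (\<nu> \<alpha>) (lcats I p ` (\<Union>i. A i))"
      using union(3) by (simp add: image_UN)
    have "(\<lambda>i. measure (\<nu> \<beta>) (A i)) sums measure (\<nu> \<beta>) (\<Union>i. A i)"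
      using As union(1) by (intro finite_measure.finite_measure_UNION[OF finite_measure_nu]) auto
    from sums_mult[OF this, of "F \<alpha> (cliques_word p)"] 1 show ?case using sums_unique2 by blast
  qed
qed

lemma measure_lcats_None:
  assumes p: "\<forall>c\<in>set p. clique I c" and run: "run (Some \<alpha>) (cliques_word p) = None"
    and A: "A \<subseteq> boundary I"
  shows "measure (\<nu> \<alpha>) (lcats I p ` A) = 0"
proof -
  have "lcats I p ` A \<subseteq> cylinder I (trace_of I (cliques_word p))"
    unfolding lcats_boundary_image[OF p, symmetric] using A by blast
  then have "measure (\<nu> \<alpha>) (lcats I p ` A) \<le> F \<alpha> (cliques_word p)"
    by (intro finite_measure.finite_measure_mono[OF finite_measure_nu]) auto
  then show ?thesis using F_None[OF run] measure_nonneg[of "\<nu> \<alpha>"] by (simp add: order_antisym)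
qed

text \<open>\<open>H\<close> agrees with \<open>h_val\<close> on cliques, but it is also defined, with value
  0, on all other sets of letters, so that sums may range over the whole type.\<close>

abbreviation H :: "'s \<Rightarrow> 'a set \<Rightarrow> real" where
  "H \<alpha> c \<equiv> measure (\<nu> \<alpha>) (first_is I c)"

abbreviation W :: "'s \<Rightarrow> 'a set list \<Rightarrow> real" where
  "W \<alpha> w \<equiv> measure (\<nu> \<alpha>) (elementary I w)"

lemma W_snoc:
  assumes "normal_list I (w @ [c])" "run (Some \<alpha>) (cliques_word w) = Some \<beta>"
  shows "W \<alpha> (w @ [c]) = F \<alpha> (cliques_word w) * H \<beta> c"
proof -
  have "\<forall>c\<in>set w. clique I c" using assms(1) by (auto simp: normal_list_def)
  from measure_lcats[OF this assms(2), of "first_is I c"] show ?thesis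
    unfolding elementary_lcats[OF assms(1)] by (simp add: first_is_elementary)
qed

lemma W_not_normal: "\<not> normal_list I w \<Longrightarrow> W \<alpha> w = 0"
  by (simp add: elementary_empty)

lemma W_None:
  assumes "run (Some \<alpha>) (cliques_word w) = None" shows "W \<alpha> (w @ v) = 0"
proof (cases "normal_list I (w @ v)")
  case True
  have "elementary I (w @ v) \<subseteq> cylinder I (trace_of I (cliques_word w))"
  proof
    fix \<omega> assume \<omega>: "\<omega> \<in> elementary I (w @ v)"
    then have "map \<omega> [0..<length w] = w" by (auto simp: elementary_iff nth_append intro!: nth_equalityI)
    then have "cliques_word w = word_upto \<omega> (length w)" using cliques_word_map[of \<omega> "length w"] by simp
    then show "\<omega> \<in> cylinder I (trace_of I (cliques_word w))"
      using \<omega> tle_refl unfolding cylinder_iff below_def elementary_iff by metis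
  qed
  then have "W \<alpha> (w @ v) \<le> F \<alpha> (cliques_word w)"
    by (intro finite_measure.finite_measure_mono[OF finite_measure_nu]) auto
  then show ?thesis using F_None[OF assms] measure_nonneg[of "\<nu> \<alpha>"] by (simp add: order_antisym)
qed (rule W_not_normal)

lemma H_pos_run: "H \<alpha> c > 0 \<Longrightarrow> clique I c \<and> c \<noteq> {} \<and> run (Some \<alpha>) (clique_word c) \<noteq> None"
proof -
  assume pos: "H \<alpha> c > 0"
  then have "normal_list I [c]" using W_not_normal[of "[c]" \<alpha>] by (auto simp: first_is_elementary)
  moreover have "run (Some \<alpha>) (clique_word c) \<noteq> None"
    using W_None[of \<alpha> "[c]" "[]"] pos by (auto simp: first_is_elementary)
  ultimately show ?thesis by (simp add: normal_list_def)
qed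

lemma measure_partition_next:
  "W \<alpha> w = (\<Sum>d\<in>UNIV. W \<alpha> (w @ [d]))"
proof -
  have e: "elementary I w = (\<Union>d\<in>UNIV. elementary I (w @ [d]))"
    by (auto simp: elementary_snoc_iff)
  show ?thesis by (subst e, rule finite_measure.finite_measure_finite_Union[OF finite_measure_nu])
      (auto simp: disjoint_family_on_def elementary_snoc_iff)
qed

text \<open>Summation of the probabilities of all possible second cliques.\<close>

lemma H_eq_g:
  assumes c: "clique I c" "c \<noteq> {}" and run: "run (Some \<gamma>) (clique_word c) = Some \<beta>"
  shows "H \<gamma> c = F \<gamma> (clique_word c) * g_val I act \<nu> \<beta> c"
proof -
  have "H \<gamma> c = (\<Sum>d\<in>UNIV. W \<gamma> [c, d])"
    using measure_partition_next[of \<gamma> "[c]"] by (simp add: first_is_elementary)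
  also have "\<dots> = (\<Sum>d | d \<in> cliques_from I act \<beta> \<and> clique_arrow I c d. W \<gamma> [c, d])"
  proof (rule sum.mono_neutral_right)
    show "\<forall>d\<in>UNIV - {d. d \<in> cliques_from I act \<beta> \<and> clique_arrow I c d}. W \<gamma> [c, d] = 0"
    proof
      fix d assume d: "d \<in> UNIV - {d. d \<in> cliques_from I act \<beta> \<and> clique_arrow I c d}"
      show "W \<gamma> [c, d] = 0"
      proof (cases "normal_list I [c, d]")
        case True
        then have "run (Some \<beta>) (clique_word d) = None"
          using d by (auto simp: normal_list_def cliques_from_def clique_trace_word traces_from_iff)
        then show ?thesis using W_None[of \<gamma> "[c, d]" "[]"] run by (simp add: run_append)
      qed (rule W_not_normal)
    qed
  qed auto
  also have "\<dots> = (\<Sum>d | d \<in> cliques_from I act \<beta> \<and> clique_arrow I c d. F \<gamma> (clique_word c) * h_val I \<nu> \<beta> d)"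
  proof (rule sum.cong[OF refl])
    fix d assume "d \<in> {d. d \<in> cliques_from I act \<beta> \<and> clique_arrow I c d}"
    then have d: "clique I d" "clique_arrow I c d" by (auto simp: cliques_from_def)
    show "W \<gamma> [c, d] = F \<gamma> (clique_word c) * h_val I \<nu> \<beta> d"
    proof (cases "d = {}")
      case True
      have "first_is I {} = {}" by (auto simp: boundary_def)
      then have "H \<beta> {} = 0" by (simp only: measure_empty)
      then show ?thesis using True W_not_normal[of "[c, d]" \<gamma>] h_val_eq[OF d(1), of \<beta>]
        by (simp add: normal_list_def)
    next
      case False
      then have "normal_list I ([c] @ [d])" using c d by (simp add: normal_list_def)
      from W_snoc[OF this, of \<gamma> \<beta>] run show ?thesis using h_val_eq[OF d(1)] by simp
    qed
  qed
  finally show ?thesis by (simp add: g_val_def sum_distrib_left)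
qed

end

section \<open>Every letter occurs almost surely\<close>

text \<open>A word whose letters all lie above its first letter \<open>a\<close>. Only the immediate reason is
  required, a dependent letter further to the left.\<close>

definition pyramid :: "('a \<times> 'a) set \<Rightarrow> 'a \<Rightarrow> 'a list \<Rightarrow> bool" where
  "pyramid I a p \<longleftrightarrow> p \<noteq> [] \<and> hd p = a \<and>
     (\<forall>p1 c p2. p = p1 @ c # p2 \<and> p1 \<noteq> [] \<longrightarrow> (\<exists>b\<in>set p1. (b, c) \<notin> I))"

lemma pyramid_snoc:
  assumes "pyramid I a p" "b \<in> set p" "(b, c) \<notin> I" shows "pyramid I a (p @ [c])"
  unfolding pyramid_def
proof (intro conjI allI impI)
  fix p1 d p2 assume e: "p @ [c] = p1 @ d # p2 \<and> p1 \<noteq> []"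
  show "\<exists>b\<in>set p1. (b, d) \<notin> I"
  proof (cases p2 rule: rev_cases)
    case Nil
    then show ?thesis using e assms by auto
  next
    case (snoc q x)
    then have "p = p1 @ d # q" using e by auto
    then show ?thesis using assms(1) e unfolding pyramid_def by blast
  qed
qed (use assms in \<open>auto simp: pyramid_def\<close>)

context independence
begin

text \<open>A letter that depends on the pyramid joins it. Any other letter commutes with the pyramid and
  moves to the part in front of it; that part stays free of \<open>a\<close>, because \<open>a\<close> depends
  on itself.\<close>

lemma pyramid_extend:
  assumes "teq I t (u @ p)" "a \<notin> set u" "pyramid I a p"
  shows "\<exists>u' p'. teq I (t @ s) (u' @ p') \<and> a \<notin> set u' \<and> pyramid I a p' \<and> set p \<subseteq> set p'"
proof (induction s rule: rev_induct)
  case Nil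
  show ?case by (rule exI[of _ u], rule exI[of _ p]) (use assms in simp)
next
  case (snoc c s)
  then obtain u' p' where 1: "teq I (t @ s) (u' @ p')" "a \<notin> set u'" "pyramid I a p'" "set p \<subseteq> set p'"
    by blast
  have t: "teq I (t @ s @ [c]) (u' @ p' @ [c])"
    using teq_append[OF 1(1) teq_refl[of I "[c]"]] by simp
  show ?case
  proof (cases "\<exists>b\<in>set p'. (b, c) \<notin> I")
    case True
    then obtain b where "b \<in> set p'" "(b, c) \<notin> I" ..
    with 1(3) have "pyramid I a (p' @ [c])" by (rule pyramid_snoc)
    with t 1 show ?thesis by (intro exI[of _ u'] exI[of _ "p' @ [c]"]) auto
  next
    case False
    have "a \<in> set p'" using 1(3) hd_in_set unfolding pyramid_def by blast
    then have "c \<noteq> a" using False by auto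
    have "teq I (p' @ c # []) (c # p' @ [])" by (rule teq_move) (use False in blast)
    then have "teq I (p' @ [c]) ([c] @ p')" by (simp only: append_Cons append_Nil append_Nil2)
    from teq_trans[OF t teq_append[OF teq_refl this]]
    have "teq I (t @ s @ [c]) ((u' @ [c]) @ p')" by (simp only: append_assoc)
    with 1 \<open>c \<noteq> a\<close> show ?thesis by (intro exI[of _ "u' @ [c]"] exI[of _ p']) auto
  qed
qed

lemma pyramid_extend_dependent:
  assumes "teq I t (u @ p)" "a \<notin> set u" "pyramid I a p" "b \<in> set p" "(b, c) \<notin> I"
  shows "\<exists>u' p'. teq I (t @ s @ [c]) (u' @ p') \<and> a \<notin> set u' \<and> pyramid I a p' \<and> insert c (set p) \<subseteq> set p'"
proof -
  obtain u' p' where 1: "teq I (t @ s) (u' @ p')" "a \<notin> set u'" "pyramid I a p'" "set p \<subseteq> set p'"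
    using pyramid_extend[OF assms(1-3)] by blast
  have "teq I (t @ s @ [c]) (u' @ p' @ [c])"
    using teq_append[OF 1(1) teq_refl[of I "[c]"]] by simp
  moreover have "pyramid I a (p' @ [c])" using pyramid_snoc[OF 1(3) _ assms(5)] 1(4) assms(4) by blast
  ultimately show ?thesis using 1 by (intro exI[of _ u'] exI[of _ "p' @ [c]"]) auto
qed

lemma pyramid_first_clique:
  assumes "pyramid I a p" "set p = UNIV" "\<omega> \<in> boundary I"
  shows "lcats I (letters p) \<omega> 0 = {a}"
proof -
  have "c = a" if c: "c \<in> lcats I (letters p) \<omega> 0" for c
  proof -
    obtain p1 q where p: "p = p1 @ c # q" "\<forall>b\<in>set p1. (b, c) \<in> I"
      using first_clique_lcats_letters[OF c] assms(2) by auto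
    then have "p1 = []" using assms(1) unfolding pyramid_def by blast
    with p assms(1) show "c = a" by (simp add: pyramid_def)
  qed
  moreover have "lcats I (letters p) \<omega> \<in> boundary I"
    by (rule lcats_boundary) (use assms clique_letters in auto)
  then have "lcats I (letters p) \<omega> 0 \<noteq> {}" by (auto simp: boundary_iff)
  ultimately show ?thesis by blast
qed

lemma normal_list_unique:
  assumes "normal_list I v" "normal_list I w" "teq I (cliques_word v) (cliques_word w)"
  shows "v = w"
proof -
  have "is_normal_form I (trace_of I (cliques_word w)) u"
    if "normal_list I u" "teq I (cliques_word u) (cliques_word w)" for u
    using that unfolding is_normal_form_def normal_list_def
    by (simp add: clique_product_cliques_word trace_of_eq_iff_teq)
  from normal_form_eqI[OF this] assms show ?thesis by (metis teq_refl)
qed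

end

locale irreducible_markov_system = markov_system I act \<nu>
  for I :: "('a::finite \<times> 'a) set" and act :: "'s::finite option \<Rightarrow> 'a list set \<Rightarrow> 's option"
    and \<nu> :: "'s \<Rightarrow> (nat \<Rightarrow> 'a set) measure" +
  assumes irreducible: "irreducible_system I act"
begin

lemma reach_state: "\<exists>u. run (Some \<alpha>) u = Some \<beta>"
proof -
  have "traces_between I act \<alpha> \<beta> \<noteq> {}"
    using irreducible unfolding irreducible_system_def transitive_system_def by blast
  then show ?thesis unfolding traces_between_def carrier_trace_monoid by auto
qed

lemma enable_letter: "\<exists>u. run (Some \<alpha>) (u @ [a]) \<noteq> None"
proof -
  obtain x where "x \<in> carrier (trace_monoid I)" "act (Some \<alpha>) (x \<otimes>\<^bsub>trace_monoid I\<^esub> trace_of I [a]) \<noteq> None"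
    using irreducible unfolding irreducible_system_def by blast
  then show ?thesis unfolding carrier_trace_monoid by (metis imageE trace_mult)
qed

lemma dependence_connected:
  assumes "T \<noteq> {}" "T \<noteq> UNIV" shows "\<exists>b\<in>T. \<exists>c\<in>-T. (b, c) \<notin> I"
proof (rule ccontr)
  assume no: "\<not> ?thesis"
  obtain u v where uv: "u \<in> T" "v \<notin> T" using assms by blast
  let ?G = "with_proj (mk_symmetric (with_proj \<lparr> pverts = UNIV, parcs = UNIV \<times> UNIV - I \<rparr>))"
  have "u \<rightarrow>\<^sup>*\<^bsub>?G\<^esub> v"
    using irreducible unfolding irreducible_system_def irreducible_trace_monoid_def
      Digraph_Component.connected_def strongly_connected_def by (simp add: mk_symmetric_def)
  then have "v \<in> T" unfolding reachable_def
  proof (induction rule: rtrancl_on_induct)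
    case base
    show ?case by (rule uv)
  next
    case (step x y)
    then have "(x, y) \<notin> I" using I_sym by (auto simp: mk_symmetric_def)
    with step no show ?case by blast
  qed
  with uv show False by simp
qed

lemma run_teq: "teq I u v \<Longrightarrow> run p u = run p v"
  by (metis trace_of_eq_iff_teq)

text \<open>As long as the pyramid misses a letter, connectedness provides a missing letter \<open>c\<close>
  that depends on the pyramid, and irreducibility of the system provides a continuation that ends with
  \<open>c\<close>. Once all letters are present, every further letter joins the pyramid, in particular those
  of a path back to the initial state.\<close>

lemma insertion_word_exists:
  "\<exists>u p. run (Some \<beta>) (u @ p) = Some \<beta> \<and> a \<notin> set u \<and> pyramid I a p \<and> set p = UNIV"
proof -
  have grow: "\<exists>t u p. run (Some \<beta>) t \<noteq> None \<and> teq I t (u @ p) \<and> a \<notin> set u \<and> pyramid I a p \<and> set p = UNIV"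
    if "run (Some \<beta>) t \<noteq> None" "teq I t (u @ p)" "a \<notin> set u" "pyramid I a p" for t u p
    using that
  proof (induction "card (UNIV - set p)" arbitrary: t u p rule: less_induct)
    case less
    show ?case
    proof (cases "set p = UNIV")
      case False
      have "set p \<noteq> {}" using less.prems by (simp add: pyramid_def)
      with False obtain b c where bc: "b \<in> set p" "c \<notin> set p" "(b, c) \<notin> I"
        using dependence_connected[of "set p"] by auto
      obtain \<gamma> where \<gamma>: "run (Some \<beta>) t = Some \<gamma>" using less.prems by auto
      obtain s where s: "run (Some \<gamma>) (s @ [c]) \<noteq> None" using enable_letter by blast
      obtain u' p' where *: "teq I (t @ s @ [c]) (u' @ p')" "a \<notin> set u'" "pyramid I a p'"
        "insert c (set p) \<subseteq> set p'"
        using pyramid_extend_dependent[OF less.prems(2-4) bc(1,3)] by blast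
      have "run (Some \<beta>) (t @ s @ [c]) \<noteq> None" using s \<gamma> by (simp add: run_append)
      moreover have "card (UNIV - set p') < card (UNIV - set p)"
        by (rule psubset_card_mono) (use * bc in auto)
      ultimately show ?thesis using less.hyps * by blast
    qed (use less.prems in blast)
  qed
  obtain u0 where u0: "run (Some \<beta>) (u0 @ [a]) \<noteq> None" using enable_letter by blast
  obtain u r where ur: "u0 @ [a] = u @ a # r" "a \<notin> set u"
    by (meson in_set_conv_decomp split_list_first)
  have "pyramid I a [a]" by (auto simp: pyramid_def Cons_eq_append_conv)
  then have "\<exists>u' p'. teq I ((u @ [a]) @ r) (u' @ p') \<and> a \<notin> set u' \<and> pyramid I a p' \<and> set [a] \<subseteq> set p'"
    using ur by (intro pyramid_extend) auto
  then obtain u' p' where "teq I (u0 @ [a]) (u' @ p')" "a \<notin> set u'" "pyramid I a p'"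
    using ur(1) by auto
  from grow[OF u0 this] obtain t u p
    where t: "run (Some \<beta>) t \<noteq> None" "teq I t (u @ p)" "a \<notin> set u" "pyramid I a p" "set p = UNIV"
    by blast
  then obtain \<gamma> where \<gamma>: "run (Some \<beta>) t = Some \<gamma>" by auto
  obtain r where r: "run (Some \<gamma>) r = Some \<beta>" using reach_state by blast
  obtain u' p' where *: "teq I (t @ r) (u' @ p')" "a \<notin> set u'" "pyramid I a p'" "set p \<subseteq> set p'"
    using pyramid_extend[OF t(2-4)] by blast
  have "run (Some \<beta>) (u' @ p') = Some \<beta>" using run_teq[OF *(1), of "Some \<beta>"] \<gamma> r by (metis run_append)
  with * t show ?thesis by blast
qed

definition avoids :: "'a \<Rightarrow> (nat \<Rightarrow> 'a set) set" where
  "avoids a = {\<omega> \<in> boundary I. \<forall>i. a \<notin> \<omega> i}"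

lemma sets_coordinate [measurable]: "{\<omega> \<in> boundary I. P (\<omega> i)} \<in> sets (boundary_borel I)"
  by (rule sets_finite_coordinates[where n = "Suc i"]) auto

lemma sets_avoids [measurable]: "avoids a \<in> sets (boundary_borel I)"
proof -
  have "avoids a = (\<Inter>i. {\<omega> \<in> boundary I. a \<notin> \<omega> i})" by (auto simp: avoids_def)
  then show ?thesis using sets_coordinate by auto
qed

text \<open>Insert a pyramid after \<open>n\<close> cliques of an infinite trace that avoids \<open>a\<close>.
  The result reveals where the insertion took place, up to the state reached there, because the part that
  precedes the pyramid consists of what is not above the first occurrence of \<open>a\<close>. So the images
  of these insertions for different \<open>n\<close> overlap boundedly, while each of them keeps a fixed
  proportion of the mass; a set of positive mass would not leave room for all of them.\<close>

lemma measure_avoids: "measure (\<nu> \<alpha>) (avoids a) = 0"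
proof -
  obtain u p where up: "\<And>\<beta>. run (Some \<beta>) (u \<beta> @ p \<beta>) = Some \<beta>" "\<And>\<beta>. a \<notin> set (u \<beta>)"
      "\<And>\<beta>. pyramid I a (p \<beta>)" "\<And>\<beta>. set (p \<beta>) = UNIV"
    using insertion_word_exists[of _ a] by metis
  define \<delta> where "\<delta> = Min (range (\<lambda>\<beta>. F \<beta> (u \<beta> @ p \<beta>)))"
  have \<delta>: "\<delta> > 0" unfolding \<delta>_def by (subst Min_gr_iff) (use up(1) F_pos_iff in auto)
  have \<delta>_le: "\<delta> \<le> F \<beta> (u \<beta> @ p \<beta>)" for \<beta> unfolding \<delta>_def by (rule Min_le) auto
  define A where "A w = {\<omega> \<in> avoids a. w = [] \<or> clique_arrow I (last w) (\<omega> 0)}" for w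
  have A_sets [measurable]: "A w \<in> sets (boundary_borel I)" for w
  proof -
    have "A w = avoids a \<inter> {\<omega> \<in> boundary I. w = [] \<or> clique_arrow I (last w) (\<omega> 0)}"
      by (auto simp: A_def avoids_def)
    then show ?thesis by simp
  qed
  have A_boundary: "A w \<subseteq> boundary I" for w by (auto simp: A_def avoids_def)
  define S where "S w \<beta> = lcats I (w @ letters (u \<beta> @ p \<beta>)) ` A w" for w \<beta>
  define good where "good w \<longleftrightarrow> normal_list I w \<and> a \<notin> set (cliques_word w)" for w
  have good_clique: "\<forall>c\<in>set w. clique I c" if "good w" for w
    using that by (auto simp: good_def normal_list_def)
  have cl: "\<forall>c\<in>set (w @ letters v). clique I c" if "good w" for w v
    using good_clique[OF that] clique_letters by auto
  have split: "measure (\<nu> \<alpha>) (elementary I w \<inter> avoids a) \<le>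
      (if good w then F \<alpha> (cliques_word w) * (case run (Some \<alpha>) (cliques_word w) of None \<Rightarrow> 0
         | Some \<beta> \<Rightarrow> measure (\<nu> \<beta>) (A w)) else 0)" for w
  proof (cases "good w")
    case True
    have "elementary I w \<inter> avoids a \<subseteq> lcats I w ` A w"
    proof
      fix \<omega> assume \<omega>: "\<omega> \<in> elementary I w \<inter> avoids a"
      then have b: "\<omega> \<in> boundary I" by (simp add: avoids_def)
      show "\<omega> \<in> lcats I w ` A w"
      proof (cases "w = []")
        case True
        then show ?thesis using \<omega> by (auto simp: A_def)
      next
        case False
        define \<eta> where "\<eta> i = \<omega> (i + length w)" for i
        have \<eta>: "\<eta> \<in> boundary I" using b by (simp add: boundary_def \<eta>_def)
        have "last w = \<omega> (length w - 1)" using \<omega> False by (simp add: elementary_iff last_conv_nth)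
        moreover have "clique_arrow I (\<omega> (length w - 1)) (\<omega> (Suc (length w - 1)))"
          using b unfolding boundary_def by blast
        ultimately have ar: "clique_arrow I (last w) (\<eta> 0)" using False by (simp add: \<eta>_def)
        have "lcats I w \<eta> = (\<lambda>i. if i < length w then w ! i else \<eta> (i - length w))"
          using lcats_prepend[OF _ False \<eta> ar] \<open>good w\<close> by (simp add: good_def)
        then have "lcats I w \<eta> = \<omega>" using \<omega> by (auto simp: elementary_iff \<eta>_def fun_eq_iff)
        moreover have "\<eta> \<in> A w" using \<eta> ar \<omega> by (auto simp: A_def avoids_def \<eta>_def)
        ultimately show ?thesis by blast
      qed
    qed
    then have "measure (\<nu> \<alpha>) (elementary I w \<inter> avoids a) \<le> measure (\<nu> \<alpha>) (lcats I w ` A w)"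
      using sets_lcats_image[OF good_clique[OF True] A_sets]
      by (intro finite_measure.finite_measure_mono[OF finite_measure_nu]) auto
    also have "\<dots> = F \<alpha> (cliques_word w) * (case run (Some \<alpha>) (cliques_word w) of None \<Rightarrow> 0
         | Some \<beta> \<Rightarrow> measure (\<nu> \<beta>) (A w))"
      using measure_lcats[OF good_clique[OF True] _ A_sets]
        measure_lcats_None[OF good_clique[OF True] _ A_boundary] by (simp split: option.split)
    finally show ?thesis using True by simp
  next
    case False
    have "elementary I w \<inter> avoids a = {}"
    proof (rule ccontr)
      assume "elementary I w \<inter> avoids a \<noteq> {}"
      then obtain \<omega> where \<omega>: "\<omega> \<in> elementary I w" "\<omega> \<in> avoids a" by blast
      then have "normal_list I w" using elementary_empty by blast
      moreover have "a \<notin> set (cliques_word w)"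
      proof
        assume "a \<in> set (cliques_word w)"
        then obtain i where "i < length w" "a \<in> w ! i"
          by (auto simp: cliques_word_def in_set_conv_nth)
        with \<omega> show False by (metis (mono_tags, lifting) avoids_def elementary_iff mem_Collect_eq)
      qed
      ultimately show False using False by (simp add: good_def)
    qed
    then show ?thesis using False by simp
  qed
  have S_measure: "measure (\<nu> \<alpha>) (S w \<beta>) = F \<alpha> (cliques_word w) * F \<beta> (u \<beta> @ p \<beta>) * measure (\<nu> \<beta>) (A w)"
    if "good w" "run (Some \<alpha>) (cliques_word w) = Some \<beta>" for w \<beta>
    using measure_lcats[OF cl[OF that(1)] _ A_sets, of \<alpha> "u \<beta> @ p \<beta>" \<beta> w] that(2) up(1)
      F_append[OF that(2), of "u \<beta> @ p \<beta>"] run_append[of "Some \<alpha>" "cliques_word w" "u \<beta> @ p \<beta>"]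
    unfolding S_def by simp
  have S_sets: "S w \<beta> \<in> sets (\<nu> \<alpha>)" if "good w" for w \<beta>
    unfolding S_def sets_nu by (rule sets_lcats_image[OF cl[OF that] A_sets])
  have inj: "v = w" if v: "good v" and w: "good w" and S: "\<omega> \<in> S v \<beta>" "\<omega> \<in> S w \<beta>" for v w \<omega> \<beta>
  proof -
    obtain \<eta> \<zeta> where \<eta>: "\<eta> \<in> boundary I" "\<omega> = lcats I (v @ letters (u \<beta> @ p \<beta>)) \<eta>"
      and \<zeta>: "\<zeta> \<in> boundary I" "\<omega> = lcats I (w @ letters (u \<beta> @ p \<beta>)) \<zeta>"
      using S A_boundary unfolding S_def by blast
    have *: "\<omega> = lcats I (letters (cliques_word w @ u \<beta>)) (lcats I (letters (p \<beta>)) \<eta>)"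
      if "good w" "\<eta> \<in> boundary I" "\<omega> = lcats I (w @ letters (u \<beta> @ p \<beta>)) \<eta>" for w \<eta>
    proof -
      have "lcats I (w @ letters (u \<beta> @ p \<beta>)) \<eta> = lcats I (letters (cliques_word w @ u \<beta> @ p \<beta>)) \<eta>"
        by (rule lcats_cong[OF cl[OF that(1)]])
          (use that(2) clique_letters in \<open>auto simp: boundary_iff simp flip: letters_simps(3)\<close>)
      then show ?thesis using that(3) by (simp add: lcats_append)
    qed
    have le: "tle I (cliques_word v @ u \<beta>) (cliques_word w @ u \<beta>)"
      if v: "good v" "\<eta> \<in> boundary I" "\<omega> = lcats I (v @ letters (u \<beta> @ p \<beta>)) \<eta>"
        and w: "good w" "\<zeta> \<in> boundary I" "\<omega> = lcats I (w @ letters (u \<beta> @ p \<beta>)) \<zeta>" for v w \<eta> \<zeta>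
    proof (rule avoiding_below_imp_tle)
      have clp: "\<forall>c\<in>set (letters q). clique I c" for q :: "'a list" using clique_letters by blast
      show "normal_seq I (lcats I (letters (p \<beta>)) \<zeta>)"
        using w(2) normal_seq_lcats[OF clp] by (simp add: boundary_iff)
      show "lcats I (letters (p \<beta>)) \<zeta> 0 = {a}" using up w(2) pyramid_first_clique by blast
      show "a \<notin> set (cliques_word v @ u \<beta>)" using v(1) up(2) by (simp add: good_def)
      have "normal_seq I (lcats I (letters (p \<beta>)) \<eta>)"
        using v(2) normal_seq_lcats[OF clp] by (simp add: boundary_iff)
      then have "below (cliques_word v @ u \<beta>) \<omega>"
        unfolding *[OF v] by (subst below_lcats[OF clp]) auto
      then show "below (cliques_word v @ u \<beta>) (lcats I (letters (cliques_word w @ u \<beta>)) (lcats I (letters (p \<beta>)) \<zeta>))"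
        unfolding *[OF w] .
    qed
    have "teq I (cliques_word v @ u \<beta>) (cliques_word w @ u \<beta>)"
      using le[OF v \<eta> w \<zeta>] le[OF w \<zeta> v \<eta>] by (rule tle_antisym)
    then show ?thesis using normal_list_unique v w by (simp add: good_def)
  qed
  have bound: "real N * measure (\<nu> \<alpha>) (avoids a) * \<delta> \<le> real CARD('s)" for N
  proof -
    define L where "L = {w :: 'a set list. length w < N \<and> good w}"
    have "{w :: 'a set list. length w < N} \<subseteq> {w. set w \<subseteq> UNIV \<and> length w \<le> N}" by auto
    then have finL: "finite L"
      unfolding L_def using finite_lists_length_le[of "UNIV :: 'a set set" N] finite_subset by fastforce
    have fin: "finite {w :: 'a set list. length w = n}" for n
      using finite_lists_length_eq[of "UNIV :: 'a set set" n] by simp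
    define T where "T w = (if good w then F \<alpha> (cliques_word w) * (case run (Some \<alpha>) (cliques_word w) of None \<Rightarrow> 0
         | Some \<beta> \<Rightarrow> measure (\<nu> \<beta>) (A w)) else 0)" for w
    have level: "measure (\<nu> \<alpha>) (avoids a) \<le> (\<Sum>w | length w = n. T w)" for n
    proof -
      have e: "avoids a = (\<Union>w\<in>{w. length w = n}. elementary I w \<inter> avoids a)"
      proof (intro equalityI subsetI)
        fix \<omega> assume "\<omega> \<in> avoids a"
        then have "\<omega> \<in> elementary I (map \<omega> [0..<n]) \<inter> avoids a" by (simp add: avoids_def elementary_iff)
        then show "\<omega> \<in> (\<Union>w\<in>{w. length w = n}. elementary I w \<inter> avoids a)" by force
      qed auto
      have "measure (\<nu> \<alpha>) (avoids a) \<le> (\<Sum>w | length w = n. measure (\<nu> \<alpha>) (elementary I w \<inter> avoids a))"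
        by (subst e, rule finite_measure.finite_measure_subadditive_finite[OF finite_measure_nu fin]) auto
      also have "\<dots> \<le> (\<Sum>w | length w = n. T w)" by (rule sum_mono) (use split T_def in auto)
      finally show ?thesis .
    qed
    have "real N * measure (\<nu> \<alpha>) (avoids a) = (\<Sum>n<N. measure (\<nu> \<alpha>) (avoids a))" by simp
    also have "\<dots> \<le> (\<Sum>n<N. \<Sum>w | length w = n. T w)" by (intro sum_mono level)
    also have "\<dots> = (\<Sum>w\<in>(\<Union>n<N. {w. length w = n}). T w)"
      by (rule sum.UNION_disjoint[symmetric]) (use fin in auto)
    also have "\<dots> = (\<Sum>w\<in>L. T w)"
      by (rule sum.mono_neutral_right) (use fin in \<open>auto simp: L_def T_def\<close>)
    finally have 1: "real N * measure (\<nu> \<alpha>) (avoids a) \<le> (\<Sum>w\<in>L. T w)" .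
    have "(\<Sum>w\<in>L. T w) * \<delta> = (\<Sum>w\<in>L. T w * \<delta>)" by (simp add: sum_distrib_right)
    also have "\<dots> \<le> (\<Sum>w\<in>L. \<Sum>\<beta>\<in>UNIV. if run (Some \<alpha>) (cliques_word w) = Some \<beta> then measure (\<nu> \<alpha>) (S w \<beta>) else 0)"
    proof (rule sum_mono)
      fix w assume "w \<in> L"
      then have g: "good w" by (simp add: L_def)
      show "T w * \<delta> \<le> (\<Sum>\<beta>\<in>UNIV. if run (Some \<alpha>) (cliques_word w) = Some \<beta> then measure (\<nu> \<alpha>) (S w \<beta>) else 0)"
      proof (cases "run (Some \<alpha>) (cliques_word w)")
        case (Some \<beta>)
        then have "T w * \<delta> = F \<alpha> (cliques_word w) * measure (\<nu> \<beta>) (A w) * \<delta>" using g by (simp add: T_def)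
        also have "\<dots> \<le> F \<alpha> (cliques_word w) * measure (\<nu> \<beta>) (A w) * F \<beta> (u \<beta> @ p \<beta>)"
          by (intro mult_left_mono \<delta>_le) simp
        also have "\<dots> = measure (\<nu> \<alpha>) (S w \<beta>)" using S_measure[OF g Some] by simp
        finally show ?thesis using Some by simp
      qed (simp add: T_def)
    qed
    also have "\<dots> = (\<Sum>\<beta>\<in>UNIV. \<Sum>w\<in>L. if run (Some \<alpha>) (cliques_word w) = Some \<beta> then measure (\<nu> \<alpha>) (S w \<beta>) else 0)"
      by (rule sum.swap)
    also have "\<dots> \<le> (\<Sum>\<beta>\<in>(UNIV :: 's set). 1)"
    proof (rule sum_mono)
      fix \<beta>
      have "(\<Sum>w\<in>L. if run (Some \<alpha>) (cliques_word w) = Some \<beta> then measure (\<nu> \<alpha>) (S w \<beta>) else 0)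
          \<le> (\<Sum>w\<in>L. measure (\<nu> \<alpha>) (S w \<beta>))" by (rule sum_mono) simp
      also have "\<dots> = measure (\<nu> \<alpha>) (\<Union>w\<in>L. S w \<beta>)"
        by (rule finite_measure.finite_measure_finite_Union[OF finite_measure_nu finL, symmetric])
          (use S_sets inj in \<open>auto simp: L_def disjoint_family_on_def\<close>)
      also have "\<dots> \<le> 1" by (rule prob_space.prob_le_1[OF prob_space_nu])
      finally show "(\<Sum>w\<in>L. if run (Some \<alpha>) (cliques_word w) = Some \<beta> then measure (\<nu> \<alpha>) (S w \<beta>) else 0) \<le> 1" .
    qed
    finally have "(\<Sum>w\<in>L. T w) * \<delta> \<le> real CARD('s)" by simp
    with mult_right_mono[OF 1 less_imp_le[OF \<delta>]] show ?thesis by linarith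
  qed
  show ?thesis
  proof (rule ccontr)
    assume "measure (\<nu> \<alpha>) (avoids a) \<noteq> 0"
    then have pos: "measure (\<nu> \<alpha>) (avoids a) * \<delta> > 0" using \<delta> by (simp add: zero_less_measure_iff)
    obtain N where "real CARD('s) < real N * (measure (\<nu> \<alpha>) (avoids a) * \<delta>)"
      using reals_Archimedean3[OF pos] by blast
    with bound[of N] show False by (simp add: mult.assoc)
  qed
qed

lemma AE_letters_occur: "AE \<omega> in \<nu> \<alpha>. \<forall>a. \<exists>i. a \<in> \<omega> i"
proof -
  have "AE \<omega> in \<nu> \<alpha>. \<exists>i. a \<in> \<omega> i" for a
  proof -
    have "avoids a \<in> null_sets (\<nu> \<alpha>)"
      using measure_avoids[of \<alpha> a]
      by (intro null_setsI) (simp_all add: finite_measure.emeasure_eq_measure[OF finite_measure_nu])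
    then have "AE \<omega> in \<nu> \<alpha>. \<omega> \<notin> avoids a" by (rule AE_not_in)
    moreover have "AE \<omega> in \<nu> \<alpha>. \<omega> \<in> boundary I" using AE_space[of "\<nu> \<alpha>"] by simp
    ultimately show ?thesis by eventually_elim (auto simp: avoids_def)
  qed
  then show ?thesis by (simp add: AE_all_countable)
qed

section \<open>Stability means positive probability\<close>

lemma stable_witness:
  assumes "stable I act (\<alpha>, c)"
  shows "\<exists>u. run (Some \<alpha>) u \<noteq> None \<and> cylinder I (trace_of I u) \<inter> boundary_from I act \<alpha> \<subseteq> first_is I c"
proof -
  obtain x where x: "x \<in> traces_from I act \<alpha>"
    and st: "\<And>z. z \<in> traces_from I act \<alpha> \<Longrightarrow> trace_le I x z \<Longrightarrow> nf_clique I z 0 = c"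
    using assms unfolding stable_def by auto
  then obtain u where u: "x = trace_of I u" unfolding traces_from_def carrier_trace_monoid by auto
  have "\<omega> \<in> first_is I c" if \<omega>: "\<omega> \<in> cylinder I (trace_of I u)" "\<omega> \<in> boundary_from I act \<alpha>" for \<omega>
  proof -
    obtain n where n: "tle I u (word_upto \<omega> n)" and b: "\<omega> \<in> boundary I"
      using \<omega>(1) by (auto simp: cylinder_iff below_def)
    let ?z = "trace_of I (word_upto \<omega> (Suc n))"
    have "tle I u (word_upto \<omega> (Suc n))" using n tle_trans by fastforce
    moreover have "?z \<in> traces_from I act \<alpha>"
      using \<omega>(2) unfolding boundary_from_def prefix_of_iff using trace_carrier
      by (metis (mono_tags, lifting) mem_Collect_eq prefix_of_iff tle_refl)
    ultimately have "nf_clique I ?z 0 = c" using st by (simp add: u trace_le_iff_tle)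
    then have "\<omega> 0 = c"
      unfolding nf_clique_eq using nf_seq_word_upto[of \<omega> "Suc n"] b by (simp add: boundary_iff)
    with b show ?thesis by simp
  qed
  with x show ?thesis unfolding u traces_from_iff by blast
qed

text \<open>From positive probability to stability: a typical trace with first clique \<open>c\<close> has a
  prefix \<open>x\<close> that contains all letters. A letter in the first clique of some \<open>z\<close>
  above \<open>x\<close> then occurs in \<open>x\<close>, so its first occurrence in \<open>z\<close> lies in
  \<open>x\<close>, and it belongs to the first clique of \<open>x\<close>, which is \<open>c\<close>.\<close>

lemma stable_iff: "stable I act (\<alpha>, c) \<longleftrightarrow> H \<alpha> c > 0"
proof
  assume "stable I act (\<alpha>, c)"
  from stable_witness[OF this] obtain u where u: "run (Some \<alpha>) u \<noteq> None"
      "cylinder I (trace_of I u) \<inter> boundary_from I act \<alpha> \<subseteq> first_is I c"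
    by (elim exE conjE)
  have "F \<alpha> u \<le> H \<alpha> c"
  proof (rule finite_measure.finite_measure_mono_AE[OF finite_measure_nu])
    show "AE \<omega>\<in>cylinder I (trace_of I u) in \<nu> \<alpha>. \<omega> \<in> first_is I c"
      using AE_boundary_from[of \<alpha>] by eventually_elim (use u(2) in blast)
  qed (simp add: first_is_elementary)
  with u(1) F_pos_iff show "H \<alpha> c > 0" by force
next
  assume pos: "H \<alpha> c > 0"
  have "\<exists>\<omega>. \<omega> \<in> first_is I c \<and> \<omega> \<in> boundary_from I act \<alpha> \<and> (\<forall>a. \<exists>i. a \<in> \<omega> i)"
  proof (rule ccontr)
    assume "\<not> ?thesis"
    moreover have "AE \<omega> in \<nu> \<alpha>. \<omega> \<in> boundary_from I act \<alpha> \<and> (\<forall>a. \<exists>i. a \<in> \<omega> i)"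
      using AE_boundary_from AE_letters_occur by (rule AE_conjI)
    ultimately have "AE \<omega> in \<nu> \<alpha>. \<omega> \<notin> first_is I c"
      by (elim eventually_mono) blast
    then have "H \<alpha> c = 0"
      using prob_space.prob_eq_0[OF prob_space_nu, of "first_is I c" \<alpha>] by (simp add: first_is_elementary)
    with pos show False by simp
  qed
  then obtain \<omega> where \<omega>: "\<omega> \<in> boundary I" "\<omega> 0 = c" "\<omega> \<in> boundary_from I act \<alpha>" "\<And>a. \<exists>i. a \<in> \<omega> i"
    by blast
  then obtain i where i: "\<And>a. a \<in> \<omega> (i a)" by metis
  define n where "n = Suc (Max (range i))"
  have n: "i a < n" for a by (simp add: n_def less_Suc_eq_le)
  let ?u = "word_upto \<omega> n"
  have nw: "normal_seq I \<omega>" using \<omega>(1) by (simp add: boundary_iff)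
  have "trace_of I ?u \<in> traces_from I act \<alpha>"
    using \<omega>(3) unfolding boundary_from_def using trace_carrier
    by (metis (mono_tags, lifting) mem_Collect_eq prefix_of_iff tle_refl)
  moreover have "nf_clique I z 0 = c" if z: "z \<in> traces_from I act \<alpha>" "trace_le I (trace_of I ?u) z" for z
  proof -
    obtain v where v: "z = trace_of I v" using z(1) unfolding traces_from_def carrier_trace_monoid by auto
    have uv: "tle I ?u v" using z(2) by (simp add: v trace_le_iff_tle)
    have "c \<subseteq> nf_seq v 0"
      using nf_seq_mono[OF uv, of 0] nf_seq_word_upto[OF nw, of n] \<omega>(2) by (simp add: n_def)
    moreover have "b \<in> c" if b: "b \<in> nf_seq v 0" for b
    proof -
      have "0 < ht v" using height_empty[of v] b by (cases "ht v") (auto simp: empty_from_def)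
      then have "tle I [b] (word_upto (nf_seq v) (ht v))"
        using letter_below_normal_seq_iff[OF normal_nf_seq] b by blast
      then have bv: "tle I [b] v" using teq_imp_tle[OF teq_word_upto_height] tle_trans by blast
      have "count_list [b] x \<le> count_list ?u x" for x
      proof (cases "x = b")
        case True
        have "b \<in> set ?u" using i[of b] n[of b] by (auto simp: word_upto_def)
        then show ?thesis using True count_list_0_iff[of ?u b] by (simp add: Suc_le_eq)
      qed simp
      then have "tle I [b] ?u" by (rule tle_if_count_le[OF bv uv])
      then show "b \<in> c" using letter_below_normal_seq[OF nw] \<omega>(2) by blast
    qed
    ultimately show ?thesis unfolding v nf_clique_eq by blast
  qed
  moreover have "state_clique I act (\<alpha>, c)"
    using H_pos_run[OF pos] by (simp add: state_clique_def clique_trace_word)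
  ultimately show "stable I act (\<alpha>, c)" unfolding stable_def by blast
qed

end

section \<open>A law of large numbers for bounded martingale differences\<close>

text \<open>Between \<open>k\<^sup>2\<close> and \<open>(k + 1)\<^sup>2\<close> a sequence with bounded
  increments changes by \<open>O(k)\<close> only.\<close>

lemma average_tendsto_0_if_squares:
  fixes s :: "nat \<Rightarrow> real"
  assumes step: "\<And>n. \<bar>s (Suc n) - s n\<bar> \<le> B" and B: "0 \<le> B"
    and sq: "(\<lambda>k. s (k\<^sup>2) / real (k\<^sup>2)) \<longlonglongrightarrow> 0"
  shows "(\<lambda>n. s n / real n) \<longlonglongrightarrow> 0"
proof -
  define k where "k n = nat \<lfloor>sqrt (real n)\<rfloor>" for n
  have k_le: "(k n)\<^sup>2 \<le> n" and k_gr: "n < (Suc (k n))\<^sup>2" for n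
  proof -
    have r: "real (k n) \<le> sqrt (real n)" "sqrt (real n) < real (Suc (k n))"
      unfolding k_def by (simp_all add: of_nat_nat) linarith
    have "(real (k n))\<^sup>2 \<le> real n" using power_mono[OF r(1), of 2] by simp
    then show "(k n)\<^sup>2 \<le> n" by (metis of_nat_le_iff of_nat_power)
    have "real n < (real (Suc (k n)))\<^sup>2"
      using power_strict_mono[OF r(2), of 2] by (simp del: of_nat_Suc)
    then show "n < (Suc (k n))\<^sup>2" by (metis of_nat_less_iff of_nat_power)
  qed
  have k_top: "filterlim k at_top sequentially"
    unfolding k_def by (intro filterlim_compose[OF filterlim_nat_sequentially]
        filterlim_compose[OF filterlim_floor_sequentially] filterlim_compose[OF sqrt_at_top] filterlim_real_sequentially)
  have far: "\<bar>s (m + j) - s m\<bar> \<le> B * real j" for m j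
  proof (induction j)
    case (Suc j)
    then show ?case using step[of "m + j"] by (simp add: algebra_simps)
  qed simp
  have bound: "\<bar>s n / real n\<bar> \<le> \<bar>s ((k n)\<^sup>2) / real ((k n)\<^sup>2)\<bar> + 2 * B / real (k n)" if "1 \<le> k n" for n
  proof -
    let ?k = "real (k n)"
    have kn: "?k\<^sup>2 \<le> real n" using k_le[of n] by (metis of_nat_le_iff of_nat_power)
    have kp: "0 < ?k" using that by simp
    have "0 < ?k\<^sup>2" using kp by simp
    with kn have np: "0 < real n" by linarith
    obtain j where j: "n = (k n)\<^sup>2 + j" using k_le[of n] le_Suc_ex by blast
    have "j \<le> 2 * k n" using k_gr[of n] j by (simp add: power2_eq_square)
    then have "\<bar>s n\<bar> \<le> \<bar>s ((k n)\<^sup>2)\<bar> + 2 * B * ?k"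
      using far[of "(k n)\<^sup>2" j] j B mult_left_mono[of "real j" "2 * ?k" B] by (simp add: algebra_simps)
    then have "\<bar>s n\<bar> / real n \<le> (\<bar>s ((k n)\<^sup>2)\<bar> + 2 * B * ?k) / real n"
      using np by (simp add: divide_right_mono)
    also have "\<dots> \<le> (\<bar>s ((k n)\<^sup>2)\<bar> + 2 * B * ?k) / ?k\<^sup>2"
      using kn kp np B by (intro divide_left_mono mult_pos_pos) auto
    also have "\<dots> = \<bar>s ((k n)\<^sup>2) / real ((k n)\<^sup>2)\<bar> + 2 * B / ?k"
      using kp by (simp add: add_divide_distrib power2_eq_square abs_mult)
    finally show ?thesis by simp
  qed
  have lim: "((\<lambda>n. \<bar>s ((k n)\<^sup>2) / real ((k n)\<^sup>2)\<bar> + 2 * B / real (k n)) \<longlongrightarrow> 0 + 0) sequentially"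
  proof (intro tendsto_add)
    show "((\<lambda>n. \<bar>s ((k n)\<^sup>2) / real ((k n)\<^sup>2)\<bar>) \<longlongrightarrow> 0) sequentially"
      using tendsto_rabs[OF filterlim_compose[OF sq k_top]] by simp
    show "((\<lambda>n. 2 * B / real (k n)) \<longlongrightarrow> 0) sequentially"
      by (intro tendsto_divide_0[OF tendsto_const] filterlim_at_top_imp_at_infinity
          filterlim_compose[OF filterlim_real_sequentially k_top])
  qed
  have "eventually (\<lambda>n. norm (s n / real n) \<le> \<bar>s ((k n)\<^sup>2) / real ((k n)\<^sup>2)\<bar> + 2 * B / real (k n)) sequentially"
    using filterlim_at_top[THEN iffD1, OF k_top, rule_format, of 1]
    by eventually_elim (use bound in simp)
  then show ?thesis by (rule Lim_null_comparison) (use lim in simp)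
qed

text \<open>Chebyshev bounds the probability of a deviation at time \<open>k\<^sup>2\<close> by a multiple of
  \<open>1 / k\<^sup>2\<close>, which is summable.\<close>

lemma AE_average_tendsto_0:
  fixes M :: "'w measure" and S :: "nat \<Rightarrow> 'w \<Rightarrow> real"
  assumes M: "prob_space M" and meas [measurable]: "\<And>n. S n \<in> borel_measurable M"
    and int: "\<And>n. integrable M (\<lambda>\<omega>. (S n \<omega>)\<^sup>2)"
    and second_moment: "\<And>n. (\<integral>\<omega>. (S n \<omega>)\<^sup>2 \<partial>M) \<le> C * real n"
    and step: "\<And>n \<omega>. \<bar>S (Suc n) \<omega> - S n \<omega>\<bar> \<le> B" and B: "0 \<le> B"
  shows "AE \<omega> in M. (\<lambda>n. S n \<omega> / real n) \<longlonglongrightarrow> 0"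
proof -
  interpret prob_space M by fact
  define A where "A m k = {\<omega> \<in> space M. ((real (k\<^sup>2)) / real (Suc m))\<^sup>2 \<le> (S (k\<^sup>2) \<omega>)\<^sup>2}" for m k
  have [measurable]: "A m k \<in> sets M" for m k unfolding A_def by measurable
  have "AE \<omega> in M. eventually (\<lambda>k. \<omega> \<in> space M - A m k) sequentially" for m
  proof (rule borel_cantelli_AE1)
    show "summable (\<lambda>k. measure M (A m k))"
    proof (rule summable_comparison_test)
      show "summable (\<lambda>k. C * (real (Suc m))\<^sup>2 * (inverse (real k ^ 2)))"
        by (intro summable_mult inverse_power_summable) simp
      have "measure M (A m k) \<le> C * (real (Suc m))\<^sup>2 * inverse (real k ^ 2)" if "k \<ge> 1" for k
      proof -
        let ?c = "((real (k\<^sup>2)) / real (Suc m))\<^sup>2"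
        have c: "0 < ?c" using that by simp
        have "measure M (A m k) \<le> (\<integral>\<omega>. (S (k\<^sup>2) \<omega>)\<^sup>2 \<partial>M) / ?c"
          unfolding A_def by (rule integral_Markov_inequality_measure[OF int sets.top]) (use c in auto)
        also have "\<dots> \<le> (C * real (k\<^sup>2)) / ?c" using second_moment[of "k\<^sup>2"] c by (intro divide_right_mono) auto
        also have "\<dots> = C * (real (Suc m))\<^sup>2 * inverse (real k ^ 2)"
          using that by (simp add: power_divide power2_eq_square divide_simps)
        finally show ?thesis .
      qed
      then show "\<exists>N. \<forall>n\<ge>N. norm (measure M (A m n)) \<le> C * (real (Suc m))\<^sup>2 * inverse (real n ^ 2)"
        by (intro exI[of _ 1]) simp
    qed
  qed (auto simp: emeasure_eq_measure)
  then have "AE \<omega> in M. \<forall>m. eventually (\<lambda>k. \<omega> \<in> space M - A m k) sequentially"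
    by (simp add: AE_all_countable)
  then show ?thesis
  proof (rule eventually_mono)
    fix \<omega> assume \<omega>: "\<forall>m. eventually (\<lambda>k. \<omega> \<in> space M - A m k) sequentially"
    have sq: "\<bar>x\<bar> < y" if "x\<^sup>2 < y\<^sup>2" "0 \<le> y" for x y :: real
      using that by (metis abs_le_square_iff abs_of_nonneg not_le)
    have "(\<lambda>k. S (k\<^sup>2) \<omega> / real (k\<^sup>2)) \<longlonglongrightarrow> 0"
    proof (rule tendstoI)
      fix e :: real assume "0 < e"
      then obtain m where m: "inverse (real (Suc m)) < e" using reals_Archimedean by blast
      show "eventually (\<lambda>k. dist (S (k\<^sup>2) \<omega> / real (k\<^sup>2)) 0 < e) sequentially"
        using \<omega>[rule_format, of m] eventually_gt_at_top[of 0]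
      proof eventually_elim
        case (elim k)
        then have "(S (k\<^sup>2) \<omega>)\<^sup>2 < (real (k\<^sup>2) / real (Suc m))\<^sup>2" by (auto simp: A_def)
        then have "\<bar>S (k\<^sup>2) \<omega>\<bar> < real (k\<^sup>2) / real (Suc m)"
          by (rule sq) (intro divide_nonneg_nonneg of_nat_0_le_iff)
        moreover have "0 < real (k\<^sup>2)" using elim(2) by simp
        ultimately have "\<bar>S (k\<^sup>2) \<omega>\<bar> / real (k\<^sup>2) < inverse (real (Suc m))"
          unfolding pos_divide_less_eq[OF \<open>0 < real (k\<^sup>2)\<close>] by (simp only: divide_inverse mult.commute)
        with m show ?case by (simp add: abs_divide)
      qed
    qed
    then show "(\<lambda>n. S n \<omega> / real n) \<longlonglongrightarrow> 0"
      using step B by (intro average_tendsto_0_if_squares[where s = "\<lambda>n. S n \<omega>" and B = B])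
  qed
qed

lemma (in prob_space) expectation_finite_history:
  fixes X :: "nat \<Rightarrow> 'a \<Rightarrow> 'c::finite" and G :: "'c list \<Rightarrow> real"
  assumes X [measurable]: "\<And>i. X i \<in> measurable M (count_space UNIV)"
  shows "integrable M (\<lambda>\<omega>. G (map (\<lambda>i. X i \<omega>) [0..<n]))" (is ?int)
    and "expectation (\<lambda>\<omega>. G (map (\<lambda>i. X i \<omega>) [0..<n]))
      = (\<Sum>w | length w = n. G w * prob {\<omega> \<in> space M. map (\<lambda>i. X i \<omega>) [0..<n] = w})" (is ?exp)
proof -
  let ?h = "\<lambda>\<omega>. map (\<lambda>i. X i \<omega>) [0..<n]"
  let ?E = "\<lambda>w. {\<omega> \<in> space M. ?h \<omega> = w}"
  have fin: "finite {w :: 'c list. length w = n}"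
    using finite_lists_length_eq[of "UNIV :: 'c set" n] by simp
  have meas: "?E w \<in> events" if "length w = n" for w
  proof -
    have "?E w = {\<omega> \<in> space M. \<forall>i\<in>{..<n}. X i \<omega> = w ! i}" using that by (auto simp: list_eq_iff_nth_eq)
    also have "\<dots> \<in> events" by measurable
    finally show ?thesis .
  qed
  have eq: "G (?h \<omega>) = (\<Sum>w | length w = n. G w * indicator (?E w) \<omega>)" if "\<omega> \<in> space M" for \<omega>
  proof -
    have "(\<Sum>w | length w = n. G w * indicator (?E w) \<omega>) = (\<Sum>w | length w = n. if w = ?h \<omega> then G w else 0)"
      by (rule sum.cong) (use that in \<open>auto simp: indicator_def\<close>)
    then show ?thesis using fin by simp
  qed
  have int: "integrable M (\<lambda>\<omega>. G w * indicator (?E w) \<omega>)" if "length w = n" for w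
    using meas[OF that] by (intro integrable_mult_right integrable_real_indicator) (auto simp: emeasure_eq_measure)
  have "integrable M (\<lambda>\<omega>. \<Sum>w | length w = n. G w * indicator (?E w) \<omega>)"
    by (intro Bochner_Integration.integrable_sum int) simp
  then show ?int by (rule Bochner_Integration.integrable_cong[THEN iffD1, rotated -1]) (use eq in auto)
  have "expectation (\<lambda>\<omega>. G (?h \<omega>)) = expectation (\<lambda>\<omega>. \<Sum>w | length w = n. G w * indicator (?E w) \<omega>)"
    by (rule Bochner_Integration.integral_cong) (use eq in auto)
  also have "\<dots> = (\<Sum>w | length w = n. expectation (\<lambda>\<omega>. G w * indicator (?E w) \<omega>))"
    by (rule Bochner_Integration.integral_sum) (use int in simp)
  also have "\<dots> = (\<Sum>w | length w = n. G w * prob (?E w))"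
    by (rule sum.cong[OF refl]) (use meas in \<open>simp add: Int_absorb1 sets.sets_into_space\<close>)
  finally show ?exp .
qed

lemma sum_lists_Suc:
  fixes G :: "'c::finite list \<Rightarrow> real"
  shows "(\<Sum>w | length w = Suc n. G w) = (\<Sum>w | length w = n. \<Sum>c\<in>UNIV. G (w @ [c]))"
proof -
  have "finite {w :: 'c list. length w = n}"
    using finite_lists_length_eq[of "UNIV :: 'c set" n] by simp
  then have "(\<Sum>w | length w = n. \<Sum>c\<in>UNIV. G (w @ [c])) = (\<Sum>(w, c)\<in>{w. length w = n} \<times> UNIV. G (w @ [c]))"
    by (subst sum.cartesian_product) simp
  also have "\<dots> = (\<Sum>w | length w = Suc n. G w)"
    by (rule sum.reindex_bij_witness[of _ "\<lambda>w. (butlast w, last w)" "\<lambda>(w, c). w @ [c]"])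
      (auto simp: length_Suc_conv_rev)
  finally show ?thesis by simp
qed

text \<open>Martingale differences are orthogonal, so the second moment of their sum grows linearly.\<close>

theorem (in prob_space) AE_martingale_differences_average:
  fixes X :: "nat \<Rightarrow> 'a \<Rightarrow> 'c::finite" and d :: "'c list \<Rightarrow> real"
  assumes X [measurable]: "\<And>i. X i \<in> measurable M (count_space UNIV)"
    and bounded: "\<And>w. \<bar>d w\<bar> \<le> B"
    and centred: "\<And>w. (\<Sum>c\<in>UNIV. d (w @ [c]) *
      prob {\<omega> \<in> space M. map (\<lambda>i. X i \<omega>) [0..<Suc (length w)] = w @ [c]}) = 0"
  shows "AE \<omega> in M. (\<lambda>n. (\<Sum>i<n. d (map (\<lambda>j. X j \<omega>) [0..<Suc i])) / real n) \<longlonglongrightarrow> 0"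
proof -
  let ?h = "\<lambda>n \<omega>. map (\<lambda>i. X i \<omega>) [0..<n]"
  define g where "g w = (\<Sum>i<length w. d (take (Suc i) w))" for w
  define S where "S n \<omega> = g (?h n \<omega>)" for n \<omega>
  have S_eq: "S n \<omega> = (\<Sum>i<n. d (?h (Suc i) \<omega>))" for n \<omega>
    unfolding S_def g_def by (intro sum.cong) (auto simp: take_map)
  have S_Suc: "S (Suc n) \<omega> = S n \<omega> + d (?h (Suc n) \<omega>)" for n \<omega> by (simp add: S_eq)
  have B: "0 \<le> B" using bounded[of "[]"] by linarith
  have int: "integrable M (\<lambda>\<omega>. (S n \<omega>)\<^sup>2)" "integrable M (S n)" for n
    unfolding S_def using expectation_finite_history(1)[OF X, where G = "\<lambda>w. (g w)\<^sup>2" and n = n]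
      expectation_finite_history(1)[OF X, where G = g and n = n] by auto
  have zero: "expectation (\<lambda>\<omega>. S n \<omega> * d (?h (Suc n) \<omega>)) = 0" for n
  proof -
    have "expectation (\<lambda>\<omega>. S n \<omega> * d (?h (Suc n) \<omega>)) = expectation (\<lambda>\<omega>. g (butlast (?h (Suc n) \<omega>)) * d (?h (Suc n) \<omega>))"
      by (simp add: S_def)
    also have "\<dots> = (\<Sum>w | length w = Suc n. g (butlast w) * d w * prob {\<omega> \<in> space M. ?h (Suc n) \<omega> = w})"
      by (rule expectation_finite_history(2)[OF X, where G = "\<lambda>w. g (butlast w) * d w"])
    also have "\<dots> = (\<Sum>w | length w = n. g w * (\<Sum>c\<in>UNIV. d (w @ [c]) * prob {\<omega> \<in> space M. ?h (Suc n) \<omega> = w @ [c]}))"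
      unfolding sum_lists_Suc by (simp add: sum_distrib_left mult.assoc)
    also have "\<dots> = 0" using centred by (intro sum.neutral) auto
    finally show ?thesis .
  qed
  have sec: "expectation (\<lambda>\<omega>. (S n \<omega>)\<^sup>2) \<le> B\<^sup>2 * real n" for n
  proof (induction n)
    case 0
    show ?case by (simp add: S_eq)
  next
    case (Suc n)
    have i1: "integrable M (\<lambda>\<omega>. 2 * (S n \<omega> * d (?h (Suc n) \<omega>)))"
      using expectation_finite_history(1)[OF X, where G = "\<lambda>w. 2 * (g (butlast w) * d w)" and n = "Suc n"] by (simp add: S_def)
    have i2: "integrable M (\<lambda>\<omega>. (d (?h (Suc n) \<omega>))\<^sup>2)"
      by (rule expectation_finite_history(1)[OF X, where G = "\<lambda>w. (d w)\<^sup>2"])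
    have "expectation (\<lambda>\<omega>. (S (Suc n) \<omega>)\<^sup>2) =
        expectation (\<lambda>\<omega>. (S n \<omega>)\<^sup>2 + 2 * (S n \<omega> * d (?h (Suc n) \<omega>)) + (d (?h (Suc n) \<omega>))\<^sup>2)"
      unfolding S_Suc by (simp add: power2_sum algebra_simps)
    also have "\<dots> = expectation (\<lambda>\<omega>. (S n \<omega>)\<^sup>2) + expectation (\<lambda>\<omega>. 2 * (S n \<omega> * d (?h (Suc n) \<omega>)))
        + expectation (\<lambda>\<omega>. (d (?h (Suc n) \<omega>))\<^sup>2)"
      using int i1 i2 by simp
    also have "\<dots> = expectation (\<lambda>\<omega>. (S n \<omega>)\<^sup>2) + expectation (\<lambda>\<omega>. (d (?h (Suc n) \<omega>))\<^sup>2)"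
      using zero[of n] by simp
    also have "expectation (\<lambda>\<omega>. (d (?h (Suc n) \<omega>))\<^sup>2) \<le> expectation (\<lambda>\<omega>. B\<^sup>2)"
      using i2 bounded B by (intro integral_mono) (auto simp: abs_le_square_iff[symmetric])
    finally show ?case using Suc by (simp add: prob_space algebra_simps)
  qed
  have "AE \<omega> in M. (\<lambda>n. S n \<omega> / real n) \<longlonglongrightarrow> 0"
  proof (rule AE_average_tendsto_0[OF prob_space_axioms _ int(1) sec _ B])
    show "S n \<in> borel_measurable M" for n using int(2) by auto
    show "\<bar>S (Suc n) \<omega> - S n \<omega>\<bar> \<le> B" for n \<omega> using bounded by (simp add: S_Suc)
  qed
  then show ?thesis unfolding S_eq .
qed

section \<open>Irreducible finite Markov chains\<close>

text \<open>Irreducibility is expressed by the absence of proper closed subsets, which is the form in which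
  maximum principles use it and which final components satisfy directly.\<close>

locale irreducible_chain =
  fixes Q :: "'n::finite \<Rightarrow> 'n \<Rightarrow> real" and J :: "'n set"
  assumes nonneg: "\<And>p q. p \<in> J \<Longrightarrow> q \<in> J \<Longrightarrow> 0 \<le> Q p q"
    and row_sum: "\<And>p. p \<in> J \<Longrightarrow> (\<Sum>q\<in>J. Q p q) = 1"
    and nonempty: "J \<noteq> {}"
    and no_closed_subset: "\<And>K. K \<subseteq> J \<Longrightarrow> K \<noteq> {} \<Longrightarrow>
      (\<And>p q. p \<in> K \<Longrightarrow> q \<in> J \<Longrightarrow> 0 < Q p q \<Longrightarrow> q \<in> K) \<Longrightarrow> K = J"
begin

text \<open>The set where a harmonic function attains its maximum is closed.\<close>

lemma harmonic_constant:
  assumes harmonic: "\<And>p. p \<in> J \<Longrightarrow> u p = (\<Sum>q\<in>J. Q p q * u q)" and "p \<in> J" "q \<in> J"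
  shows "u p = u q"
proof -
  define m where "m = Max (u ` J)"
  have le: "u q \<le> m" if "q \<in> J" for q using that by (simp add: m_def)
  have "{p \<in> J. u p = m} = J"
  proof (rule no_closed_subset)
    have "m \<in> u ` J" unfolding m_def using nonempty by (intro Max_in) auto
    then show "{p \<in> J. u p = m} \<noteq> {}" by auto
    fix p q assume p: "p \<in> {p \<in> J. u p = m}" and q: "q \<in> J" "0 < Q p q"
    have "(\<Sum>q\<in>J. Q p q * (m - u q)) = m * (\<Sum>q\<in>J. Q p q) - (\<Sum>q\<in>J. Q p q * u q)"
      by (simp add: algebra_simps sum_subtractf sum_distrib_left)
    also have "\<dots> = 0" using p row_sum[of p] harmonic[of p] by simp
    finally have "\<forall>q\<in>J. Q p q * (m - u q) = 0"
      using p le nonneg by (subst (asm) sum_nonneg_eq_0_iff) auto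
    with q show "q \<in> {p \<in> J. u p = m}" by fastforce
  qed auto
  with assms(2,3) show ?thesis by (metis (mono_tags, lifting) mem_Collect_eq)
qed

definition stationary :: "('n \<Rightarrow> real) \<Rightarrow> bool" where
  "stationary x \<longleftrightarrow> (\<forall>p. 0 \<le> x p) \<and> (\<forall>p. p \<notin> J \<longrightarrow> x p = 0) \<and> (\<Sum>p\<in>J. x p) = 1 \<and>
     (\<forall>q\<in>J. (\<Sum>p\<in>J. x p * Q p q) = x q)"

text \<open>Brouwer's theorem on the simplex of probability vectors that are supported by \<open>J\<close>.\<close>

lemma stationary_exists: "\<exists>x. stationary x"
proof -
  define S where "S = {x :: real ^ 'n. (\<forall>p. 0 \<le> x $ p) \<and> (\<forall>p. p \<notin> J \<longrightarrow> x $ p = 0) \<and> (\<Sum>p\<in>UNIV. x $ p) = 1}"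
  define f where "f x = (\<chi> q. if q \<in> J then \<Sum>p\<in>J. x $ p * Q p q else 0)" for x :: "real ^ 'n"
  have J_sum: "(\<Sum>p\<in>UNIV. x $ p) = (\<Sum>p\<in>J. x $ p)" if "\<forall>p. p \<notin> J \<longrightarrow> x $ p = 0" for x :: "real ^ 'n"
    by (rule sum.mono_neutral_right) (use that in auto)
  have "S = (\<Inter>p. {x. 0 \<le> x $ p}) \<inter> (\<Inter>p\<in>-J. {x. x $ p = 0}) \<inter> {x. (\<Sum>p\<in>UNIV. x $ p) = 1}"
    by (auto simp: S_def)
  also have "closed \<dots>"
    by (intro closed_Int closed_INT ballI closed_Collect_le closed_Collect_eq continuous_intros)
  finally have "closed S" .
  moreover have "bounded S"
  proof -
    have "norm x \<le> 1" if "x \<in> S" for x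
      using norm_le_l1_cart[of x] that by (simp add: S_def)
    then show ?thesis by (auto simp: bounded_iff)
  qed
  ultimately have "compact S" by (simp add: compact_eq_bounded_closed)
  moreover have "convex S"
    unfolding convex_def S_def
    by (auto simp: sum.distrib simp flip: sum_distrib_left)
  moreover have "S \<noteq> {}"
  proof -
    obtain p where "p \<in> J" using nonempty by blast
    then have "axis p 1 \<in> S" by (auto simp: S_def axis_def)
    then show ?thesis by blast
  qed
  moreover have "continuous_on S f"
  proof -
    have "continuous_on S (\<lambda>x. if q \<in> J then \<Sum>p\<in>J. x $ p * Q p q else 0)" for q
      by (cases "q \<in> J") (auto intro!: continuous_intros)
    then show ?thesis unfolding f_def by (rule continuous_on_vec_lambda)
  qed
  moreover have "f \<in> S \<rightarrow> S"
  proof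
    fix x assume x: "x \<in> S"
    have "(\<Sum>q\<in>J. \<Sum>p\<in>J. x $ p * Q p q) = (\<Sum>p\<in>J. x $ p * (\<Sum>q\<in>J. Q p q))"
      by (subst sum.swap) (simp add: sum_distrib_left)
    also have "\<dots> = 1" using row_sum x J_sum[of x] by (simp add: S_def)
    finally show "f x \<in> S" using x nonneg
      by (auto simp: S_def f_def if_distrib sum.If_cases intro!: sum_nonneg)
  qed
  ultimately obtain x where x: "x \<in> S" "f x = x" by (rule brouwer)
  have "(\<Sum>p\<in>J. x $ p * Q p q) = x $ q" if "q \<in> J" for q
    using arg_cong[OF x(2), of "\<lambda>y. y $ q"] that by (simp add: f_def)
  then have "stationary (\<lambda>p. x $ p)"
    unfolding stationary_def using x(1) J_sum[of x] by (auto simp: S_def)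
  then show ?thesis by blast
qed

lemma stationary_positive:
  assumes x: "stationary x" and "p \<in> J" shows "0 < x p"
proof -
  have "{p \<in> J. 0 < x p} = J"
  proof (rule no_closed_subset)
    show "{p \<in> J. 0 < x p} \<noteq> {}"
    proof
      assume "{p \<in> J. 0 < x p} = {}"
      then have "\<forall>p\<in>J. x p = 0" using x unfolding stationary_def by (auto simp: order_less_le)
      then show False using x by (simp add: stationary_def)
    qed
    fix p q assume p: "p \<in> {p \<in> J. 0 < x p}" and q: "q \<in> J" "0 < Q p q"
    have "0 < x p * Q p q" using p q by simp
    also have "\<dots> \<le> (\<Sum>p\<in>J. x p * Q p q)"
      by (rule member_le_sum) (use p q x nonneg in \<open>auto simp: stationary_def\<close>)
    also have "\<dots> = x q" using x q by (simp add: stationary_def)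
    finally show "q \<in> {p \<in> J. 0 < x p}" using q by simp
  qed auto
  with assms(2) show ?thesis by blast
qed

text \<open>Subtract the largest multiple of \<open>y\<close> that leaves \<open>x - t y\<close> nonnegative.
  The result is invariant and vanishes somewhere, so its support is a closed proper subset and therefore
  empty.\<close>

lemma stationary_unique:
  assumes x: "stationary x" and y: "stationary y" shows "x = y"
proof -
  define t where "t = Min ((\<lambda>p. x p / y p) ` J)"
  have ypos: "0 < y p" if "p \<in> J" for p using stationary_positive[OF y that] .
  define z where "z p = x p - t * y p" for p
  have z_nonneg: "0 \<le> z p" if "p \<in> J" for p
  proof -
    have "t \<le> x p / y p" unfolding t_def using that by (intro Min_le) auto
    then show ?thesis using ypos[OF that] by (simp add: z_def pos_le_divide_eq)
  qed
  have z_inv: "(\<Sum>p\<in>J. z p * Q p q) = z q" if "q \<in> J" for q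
    using x y that
    by (simp add: z_def stationary_def left_diff_distrib sum_subtractf mult.assoc flip: sum_distrib_left)
  have "t \<in> (\<lambda>p. x p / y p) ` J" unfolding t_def using nonempty by (intro Min_in) auto
  then obtain p0 where p0: "p0 \<in> J" and "t = x p0 / y p0" by blast
  then have "z p0 = 0" using ypos[of p0] by (simp add: z_def)
  have "{p \<in> J. 0 < z p} = {}"
  proof (rule ccontr)
    assume ne: "{p \<in> J. 0 < z p} \<noteq> {}"
    have "{p \<in> J. 0 < z p} = J"
    proof (rule no_closed_subset[OF _ ne])
      fix p q assume p: "p \<in> {p \<in> J. 0 < z p}" and q: "q \<in> J" "0 < Q p q"
      have "0 < z p * Q p q" using p q by simp
      also have "\<dots> \<le> (\<Sum>p\<in>J. z p * Q p q)"
        by (rule member_le_sum) (use p q z_nonneg nonneg in auto)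
      finally show "q \<in> {p \<in> J. 0 < z p}" using q z_inv by simp
    qed auto
    with p0 \<open>z p0 = 0\<close> show False by (metis (mono_tags, lifting) less_irrefl mem_Collect_eq)
  qed
  then have z0: "x p = t * y p" if "p \<in> J" for p using z_nonneg[OF that] that by (force simp: z_def)
  then have "1 = t * (\<Sum>p\<in>J. y p)" using x by (simp add: stationary_def sum_distrib_left)
  then have "t = 1" using y by (simp add: stationary_def)
  show ?thesis
  proof
    fix p show "x p = y p" using z0[of p] \<open>t = 1\<close> x y by (cases "p \<in> J") (auto simp: stationary_def)
  qed
qed

text \<open>Adding the mean to \<open>u - Q u\<close> turns the Poisson equation into an injective linear
  system: if the sum vanishes, then so does the mean of \<open>u\<close>, and \<open>u\<close> is harmonic,
  hence constant.\<close>

lemma poisson_equation: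
  assumes x: "stationary x"
  shows "\<exists>u. \<forall>p\<in>J. u p - (\<Sum>q\<in>J. Q p q * u q) = \<phi> p - (\<Sum>q\<in>J. x q * \<phi> q)"
proof -
  define T where "T u = (\<chi> p. if p \<in> J then u $ p - (\<Sum>q\<in>J. Q p q * u $ q) + (\<Sum>q\<in>J. x q * u $ q) else u $ p)"
    for u :: "real ^ 'n"
  have mean: "(\<Sum>p\<in>J. x p * (u p - (\<Sum>q\<in>J. Q p q * u q) + c)) = c" for u :: "'n \<Rightarrow> real" and c
  proof -
    have "(\<Sum>p\<in>J. x p * (\<Sum>q\<in>J. Q p q * u q)) = (\<Sum>p\<in>J. \<Sum>q\<in>J. x p * Q p q * u q)"
      by (simp add: sum_distrib_left mult.assoc)
    also have "\<dots> = (\<Sum>q\<in>J. (\<Sum>p\<in>J. x p * Q p q) * u q)"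
      by (subst sum.swap) (simp add: sum_distrib_right)
    also have "\<dots> = (\<Sum>q\<in>J. x q * u q)" using x by (simp add: stationary_def)
    finally have "(\<Sum>p\<in>J. x p * (\<Sum>q\<in>J. Q p q * u q)) = (\<Sum>q\<in>J. x q * u q)" .
    moreover have "(\<Sum>p\<in>J. x p * c) = c" using x by (simp add: stationary_def flip: sum_distrib_right)
    ultimately show ?thesis by (simp add: algebra_simps sum.distrib sum_subtractf)
  qed
  have lin: "linear T"
    by (rule linearI)
      (auto simp: T_def vec_eq_iff algebra_simps sum.distrib sum_distrib_left)
  have "inj T"
  proof (rule linear_injective_0[OF lin, THEN iffD2], intro allI impI)
    fix u assume T0: "T u = 0"
    have Tp: "u $ p - (\<Sum>q\<in>J. Q p q * u $ q) + (\<Sum>q\<in>J. x q * u $ q) = 0" if "p \<in> J" for p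
    proof -
      have "T u $ p = 0" using T0 by simp
      then show ?thesis using that by (simp add: T_def)
    qed
    have m0: "(\<Sum>q\<in>J. x q * u $ q) = 0"
      using mean[of "\<lambda>p. u $ p" "\<Sum>q\<in>J. x q * u $ q"] Tp by simp
    have const: "u $ p = u $ q" if "p \<in> J" "q \<in> J" for p q
      by (rule harmonic_constant[OF _ that]) (use Tp m0 in force)
    have "u $ p = 0" for p
    proof (cases "p \<in> J")
      case True
      have "(\<Sum>q\<in>J. x q * u $ q) = (\<Sum>q\<in>J. x q * u $ p)"
        by (rule sum.cong[OF refl]) (simp only: const[OF _ True])
      also have "\<dots> = u $ p" using x by (simp add: stationary_def flip: sum_distrib_right)
      finally show ?thesis using m0 by simp
    next
      case False
      moreover have "T u $ p = 0" using T0 by simp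
      ultimately show ?thesis by (simp add: T_def)
    qed
    then show "u = 0" by (simp add: vec_eq_iff)
  qed
  then have "surj T" by (rule linear_injective_imp_surjective[OF lin]) (rule refl)
  then obtain u where u: "T u = (\<chi> p. if p \<in> J then \<phi> p - (\<Sum>q\<in>J. x q * \<phi> q) else 0)" by (metis surjD)
  have Tp: "u $ p - (\<Sum>q\<in>J. Q p q * u $ q) + (\<Sum>q\<in>J. x q * u $ q) = \<phi> p - (\<Sum>q\<in>J. x q * \<phi> q)" if "p \<in> J" for p
  proof -
    have "T u $ p = \<phi> p - (\<Sum>q\<in>J. x q * \<phi> q)" using u that by simp
    then show ?thesis using that by (simp add: T_def)
  qed
  have "(\<Sum>q\<in>J. x q * u $ q) = (\<Sum>p\<in>J. x p * (\<phi> p - (\<Sum>q\<in>J. x q * \<phi> q)))"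
    using mean[of "\<lambda>p. u $ p" "\<Sum>q\<in>J. x q * u $ q"] Tp by simp
  also have "\<dots> = (\<Sum>p\<in>J. x p * \<phi> p) - (\<Sum>p\<in>J. x p) * (\<Sum>q\<in>J. x q * \<phi> q)"
    by (simp add: right_diff_distrib sum_subtractf sum_distrib_right)
  also have "\<dots> = 0" using x by (simp add: stationary_def)
  finally show ?thesis using Tp by (intro exI[of _ "\<lambda>p. u $ p"]) simp
qed

lemma invariant_distribution_iff: "invariant_distribution Q J \<pi> \<longleftrightarrow> stationary (pmf \<pi>)"
proof -
  have *: "(\<Sum>p\<in>J. pmf \<pi> p) = 1 \<longleftrightarrow> set_pmf \<pi> \<subseteq> J"
    using measure_measure_pmf_finite[of J \<pi>] measure_pmf.prob_eq_1[of J \<pi>]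
    by (auto simp: AE_measure_pmf_iff)
  moreover have "set_pmf \<pi> \<subseteq> J \<longleftrightarrow> (\<forall>p. p \<notin> J \<longrightarrow> pmf \<pi> p = 0)" by (auto simp: set_pmf_eq)
  ultimately show ?thesis unfolding invariant_distribution_def stationary_def by auto
qed

lemma invariant_distribution_ex1: "\<exists>!\<pi>. invariant_distribution Q J \<pi>"
proof -
  obtain x where x: "stationary x" using stationary_exists by blast
  have nn: "\<And>p. 0 \<le> x p" using x by (simp add: stationary_def)
  have "(\<Sum>p\<in>UNIV. x p) = (\<Sum>p\<in>J. x p)"
    by (rule sum.mono_neutral_right) (use x in \<open>auto simp: stationary_def\<close>)
  then have "(\<Sum>p\<in>UNIV. x p) = 1" using x by (simp add: stationary_def)
  then have "(\<integral>\<^sup>+ p. ennreal (x p) \<partial>count_space UNIV) = 1"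
    using nn by (simp add: nn_integral_count_space_finite sum_ennreal)
  then have "pmf (embed_pmf x) = x" using nn by (intro ext pmf_embed_pmf) auto
  then have "invariant_distribution Q J (embed_pmf x)" using x by (simp add: invariant_distribution_iff)
  moreover have "\<pi> = \<pi>'" if "invariant_distribution Q J \<pi>" "invariant_distribution Q J \<pi>'" for \<pi> \<pi>'
    using that stationary_unique pmf_eq_iff unfolding invariant_distribution_iff by metis
  ultimately show ?thesis by blast
qed

end

section \<open>The chain of states-and-cliques on a final component\<close>

context irreducible_markov_system
begin

text \<open>What is used of a final component. Describing it by closed subsets also gives existence at once,
  by choosing a closed set of stable nodes of least size.\<close>

definition recurrent :: "('s \<times> 'a set) set \<Rightarrow> bool" where
  "recurrent J \<longleftrightarrow> J \<noteq> {} \<and> (\<forall>p\<in>J. stable I act p) \<and>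
     (\<forall>p\<in>J. \<forall>q. stable I act q \<and> sc_arrow I act p q \<longrightarrow> q \<in> J) \<and>
     (\<forall>K\<subseteq>J. K \<noteq> {} \<and> (\<forall>p\<in>K. \<forall>q\<in>J. sc_arrow I act p q \<longrightarrow> q \<in> K) \<longrightarrow> K = J)"

lemma recurrent_if_final_component:
  assumes "final_component (DSC_plus I act) J" shows "recurrent J"
proof -
  let ?G = "DSC_plus I act"
  obtain H where H: "induced_subgraph H ?G" "strongly_connected H" and J: "J = verts H"
    using assms unfolding final_component_def pre_digraph.sccs_def by blast
  have tail: "tail ?G = fst" "head ?G = snd" and verts: "verts ?G = {p. stable I act p}"
    by (simp_all add: DSC_plus_def DSC_def)
  have arcs: "(p, q) \<in> arcs ?G \<longleftrightarrow> stable I act p \<and> stable I act q \<and> sc_arrow I act p q" for p q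
    by (cases p, cases q) (auto simp: DSC_plus_def DSC_def induce_subgraph_def stable_def)
  have sub: "J \<subseteq> {p. stable I act p}"
    using H(1) verts unfolding J induced_subgraph_def subgraph_def by auto
  have closed: "q \<in> J" if "p \<in> J" "stable I act q" "sc_arrow I act p q" for p q
  proof -
    have "(p, q) \<in> arcs ?G" using that sub arcs by auto
    then show ?thesis using assms that(1) tail unfolding final_component_def by force
  qed
  have min: "K = J" if K: "K \<subseteq> J" "K \<noteq> {}" "\<forall>p\<in>K. \<forall>q\<in>J. sc_arrow I act p q \<longrightarrow> q \<in> K" for K
  proof
    show "J \<subseteq> K"
    proof
      fix v assume v: "v \<in> J"
      obtain u where u: "u \<in> K" using K by blast
      then have "u \<rightarrow>\<^sup>*\<^bsub>H\<^esub> v" using H(2) v K unfolding J strongly_connected_def by blast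
      then show "v \<in> K" unfolding reachable_def
      proof (induction rule: rtrancl_on_induct)
        case (step x y)
        then obtain e where e: "e \<in> arcs H" "x = tail H e" "y = head H e" by (auto simp: arcs_ends_conv)
        then have "e = (x, y)" "e \<in> arcs ?G" "y \<in> J"
          using H(1) tail unfolding induced_subgraph_def subgraph_def compatible_def J by auto
        with K step show ?case using arcs by blast
      qed (use u in simp)
    qed
  qed (use K in simp)
  have "J \<noteq> {}" using H(2) unfolding J strongly_connected_def by simp
  then show ?thesis unfolding recurrent_def using sub closed min by blast
qed

lemma recurrent_exists: "\<exists>J. recurrent J"
proof -
  define C where "C J \<longleftrightarrow> J \<noteq> {} \<and> (\<forall>p\<in>J. stable I act p) \<and>
     (\<forall>p\<in>J. \<forall>q. stable I act q \<and> sc_arrow I act p q \<longrightarrow> q \<in> J)" for J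
  have "\<exists>p. stable I act p"
  proof (rule ccontr)
    assume "\<nexists>p. stable I act p"
    then have "W \<alpha> ([] @ [c]) = 0" for \<alpha> c
      using stable_iff[of \<alpha> c] measure_nonneg[of "\<nu> \<alpha>"] by (simp add: first_is_elementary order_less_le)
    then have "W undefined [] = 0" using measure_partition_next[of undefined "[]"] by simp
    then show False by simp
  qed
  then have "C {p. stable I act p}" by (auto simp: C_def)
  then obtain J where J: "C J" and min: "\<And>K. C K \<Longrightarrow> card J \<le> card K"
    using ex_has_least_nat[of C _ card] by blast
  have "K = J" if K: "K \<subseteq> J" "K \<noteq> {}" "\<forall>p\<in>K. \<forall>q\<in>J. sc_arrow I act p q \<longrightarrow> q \<in> K" for K
  proof -
    have "C K" using K J unfolding C_def by blast
    then show ?thesis using min K(1) by (meson card_seteq finite)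
  qed
  then have "recurrent J" using J unfolding recurrent_def C_def by blast
  then show ?thesis ..
qed

abbreviation Q :: "'s \<times> 'a set \<Rightarrow> 's \<times> 'a set \<Rightarrow> real" where
  "Q \<equiv> transition I act \<nu>"

lemma stable_run:
  assumes "stable I act (\<gamma>, b)"
  obtains \<beta> where "run (Some \<gamma>) (clique_word b) = Some \<beta>" "clique I b" "b \<noteq> {}" "g_val I act \<nu> \<beta> b > 0"
proof -
  have pos: "H \<gamma> b > 0" using assms stable_iff by simp
  then obtain \<beta> where \<beta>: "run (Some \<gamma>) (clique_word b) = Some \<beta>" and b: "clique I b" "b \<noteq> {}"
    using H_pos_run by blast
  have "g_val I act \<nu> \<beta> b > 0"
    using pos H_eq_g[OF b \<beta>] measure_nonneg[of "\<nu> \<gamma>"] by (simp add: zero_less_mult_iff)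
  with \<beta> b that show thesis by blast
qed

lemma H_empty [simp]: "H \<alpha> {} = 0"
proof -
  have "first_is I {} = {}" by (auto simp: boundary_def)
  then show ?thesis by (simp only: measure_empty)
qed

lemma g_val_eq: "g_val I act \<nu> \<beta> c = (\<Sum>d\<in>UNIV. if clique_arrow I c d then H \<beta> d else 0)"
proof -
  have "g_val I act \<nu> \<beta> c = (\<Sum>d | d \<in> cliques_from I act \<beta> \<and> clique_arrow I c d. H \<beta> d)"
    unfolding g_val_def by (rule sum.cong) (auto simp: cliques_from_def h_val_eq)
  also have "\<dots> = (\<Sum>d\<in>UNIV. if clique_arrow I c d then H \<beta> d else 0)"
  proof (rule sum.mono_neutral_cong_left)
    show "\<forall>d\<in>UNIV - {d. d \<in> cliques_from I act \<beta> \<and> clique_arrow I c d}.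
        (if clique_arrow I c d then H \<beta> d else 0) = 0"
    proof
      fix d assume d: "d \<in> UNIV - {d. d \<in> cliques_from I act \<beta> \<and> clique_arrow I c d}"
      have "H \<beta> d = 0" if "clique_arrow I c d"
      proof (rule ccontr)
        assume "H \<beta> d \<noteq> 0"
        then have "H \<beta> d > 0" using measure_nonneg[of "\<nu> \<beta>"] by (simp add: order_less_le)
        then show False using H_pos_run[of \<beta> d] d that
          by (auto simp: cliques_from_def clique_trace_word traces_from_iff)
      qed
      then show "(if clique_arrow I c d then H \<beta> d else 0) = 0" by simp
    qed
  qed auto
  finally show ?thesis .
qed

lemma sc_arrow_iff:
  "run (Some \<gamma>) (clique_word b) = Some \<beta> \<Longrightarrow>
    sc_arrow I act (\<gamma>, b) (\<beta>', e) \<longleftrightarrow> \<beta>' = \<beta> \<and> clique_arrow I b e"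
  by (auto simp: sc_arrow_def clique_trace_word)

text \<open>The transition probability from a node with clique \<open>b\<close> that leads to the state
  \<open>\<beta>\<close>, as a function on all sets of letters.\<close>

abbreviation next_prob :: "'s \<Rightarrow> 'a set \<Rightarrow> 'a set \<Rightarrow> real" where
  "next_prob \<beta> b e \<equiv> (if clique_arrow I b e then H \<beta> e / g_val I act \<nu> \<beta> b else 0)"

text \<open>A sum over \<open>J\<close> may be replaced by a sum over all sets of letters: possible successors
  outside \<open>J\<close> have probability 0, because stability is equivalent to positive probability.\<close>

lemma transition_sum:
  assumes J: "recurrent J" and p: "(\<gamma>, b) \<in> J" and \<beta>: "run (Some \<gamma>) (clique_word b) = Some \<beta>"
  shows "(\<Sum>q\<in>J. Q (\<gamma>, b) q * \<psi> q)
    = (\<Sum>e\<in>UNIV. next_prob \<beta> b e * \<psi> (\<beta>, e))"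
proof -
  have stab: "stable I act q" if "q \<in> J" for q using J that by (auto simp: recurrent_def)
  have Q_eq: "Q (\<gamma>, b) (\<beta>, e) = next_prob \<beta> b e"
    if "(\<beta>, e) \<in> J" for e
  proof -
    have "clique I e" using stab[OF that] by (auto elim: stable_run)
    then show ?thesis using sc_arrow_iff[OF \<beta>] by (simp add: transition_def h_val_eq)
  qed
  have "(\<Sum>q\<in>J. Q (\<gamma>, b) q * \<psi> q) = (\<Sum>q\<in>Pair \<beta> ` {e. (\<beta>, e) \<in> J}. Q (\<gamma>, b) q * \<psi> q)"
    by (rule sum.mono_neutral_right) (auto simp: transition_def sc_arrow_def clique_trace_word \<beta>)
  also have "\<dots> = (\<Sum>e | (\<beta>, e) \<in> J. Q (\<gamma>, b) (\<beta>, e) * \<psi> (\<beta>, e))"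
    by (subst sum.reindex) (auto simp: inj_on_def)
  also have "\<dots> = (\<Sum>e | (\<beta>, e) \<in> J. next_prob \<beta> b e * \<psi> (\<beta>, e))"
    by (rule sum.cong[OF refl]) (simp add: Q_eq)
  also have "\<dots> = (\<Sum>e\<in>UNIV. next_prob \<beta> b e * \<psi> (\<beta>, e))"
  proof (rule sum.mono_neutral_left)
    show "\<forall>e\<in>UNIV - {e. (\<beta>, e) \<in> J}. next_prob \<beta> b e * \<psi> (\<beta>, e) = 0"
    proof
      fix e assume e: "e \<in> UNIV - {e. (\<beta>, e) \<in> J}"
      have "H \<beta> e = 0" if "clique_arrow I b e"
      proof (rule ccontr)
        assume "H \<beta> e \<noteq> 0"
        then have "stable I act (\<beta>, e)"
          using stable_iff[of \<beta> e] measure_nonneg[of "\<nu> \<beta>"] by (simp add: order_less_le)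
        moreover have "sc_arrow I act (\<gamma>, b) (\<beta>, e)" using that sc_arrow_iff[OF \<beta>] by simp
        ultimately have "(\<beta>, e) \<in> J" using J p unfolding recurrent_def by blast
        with e show False by simp
      qed
      then show "next_prob \<beta> b e * \<psi> (\<beta>, e) = 0" by simp
    qed
  qed auto
  finally show ?thesis .
qed

lemma irreducible_chain_recurrent:
  assumes J: "recurrent J" shows "irreducible_chain Q J"
proof
  have stab: "stable I act q" if "q \<in> J" for q using J that by (auto simp: recurrent_def)
  have pos: "0 < Q p q \<longleftrightarrow> sc_arrow I act p q" and nn: "0 \<le> Q p q" if p: "p \<in> J" and q: "q \<in> J" for p q
  proof -
    obtain \<gamma> b \<beta>' e where pq: "p = (\<gamma>, b)" "q = (\<beta>', e)" by (cases p, cases q) blast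
    obtain \<beta> where \<beta>: "run (Some \<gamma>) (clique_word b) = Some \<beta>" "g_val I act \<nu> \<beta> b > 0"
      using stab[OF p] by (auto simp: pq elim: stable_run)
    have e: "H \<beta>' e > 0" "clique I e" using stab[OF q] stable_iff by (auto simp: pq elim: stable_run)
    show "0 < Q p q \<longleftrightarrow> sc_arrow I act p q" "0 \<le> Q p q"
      using \<beta> e sc_arrow_iff[OF \<beta>(1), of \<beta>' e] by (auto simp: pq transition_def h_val_eq)
  qed
  show "0 \<le> Q p q" if "p \<in> J" "q \<in> J" for p q using nn that .
  show "J \<noteq> {}" using J by (simp add: recurrent_def)
  show "(\<Sum>q\<in>J. Q p q) = 1" if p: "p \<in> J" for p
  proof -
    obtain \<gamma> b where pe: "p = (\<gamma>, b)" by (cases p)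
    obtain \<beta> where \<beta>: "run (Some \<gamma>) (clique_word b) = Some \<beta>" "g_val I act \<nu> \<beta> b > 0"
      using stab[OF p] by (auto simp: pe elim: stable_run)
    have "(\<Sum>q\<in>J. Q p q) = (\<Sum>e\<in>UNIV. (if clique_arrow I b e then H \<beta> e else 0) / g_val I act \<nu> \<beta> b)"
    proof -
      have "(\<Sum>q\<in>J. Q p q) = (\<Sum>e\<in>UNIV. next_prob \<beta> b e)"
        using transition_sum[OF J _ \<beta>(1), of "\<lambda>_. 1"] p by (simp add: pe)
      also have "\<dots> = (\<Sum>e\<in>UNIV. (if clique_arrow I b e then H \<beta> e else 0) / g_val I act \<nu> \<beta> b)"
        by (rule sum.cong) auto
      finally show ?thesis .
    qed
    also have "\<dots> = 1" using \<beta>(2) by (simp add: g_val_eq flip: sum_divide_distrib)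
    finally show ?thesis .
  qed
  show "K = J" if "K \<subseteq> J" "K \<noteq> {}" "\<And>p q. p \<in> K \<Longrightarrow> q \<in> J \<Longrightarrow> 0 < Q p q \<Longrightarrow> q \<in> K" for K
  proof -
    have "\<forall>p\<in>K. \<forall>q\<in>J. sc_arrow I act p q \<longrightarrow> q \<in> K" using that pos by blast
    then show ?thesis using J that(1,2) unfolding recurrent_def by blast
  qed
qed

text \<open>The state-and-clique reached at the last entry of a list of cliques.\<close>

definition node :: "'s \<Rightarrow> 'a set list \<Rightarrow> 's \<times> 'a set" where
  "node \<alpha> w = (the (run (Some \<alpha>) (cliques_word (butlast w))), last w)"

lemma hd_map_upt: "hd (map \<omega> [0..<Suc i]) = \<omega> 0"
  by (simp add: upt_conv_Cons del: upt_Suc)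

lemma W_pos_prefix: "W \<alpha> (v @ w) > 0 \<Longrightarrow> W \<alpha> v > 0"
proof -
  assume "W \<alpha> (v @ w) > 0"
  moreover have "W \<alpha> (v @ w) \<le> W \<alpha> v"
    by (rule finite_measure.finite_measure_mono[OF finite_measure_nu]) (auto simp: elementary_iff nth_append)
  ultimately show ?thesis by linarith
qed

text \<open>The Markov property of the sequence of cliques; the current state is a function of the history.\<close>

lemma W_step:
  assumes pos: "W \<alpha> (v @ [b]) > 0"
  shows "\<exists>\<gamma> \<beta>. run (Some \<alpha>) (cliques_word v) = Some \<gamma> \<and> run (Some \<gamma>) (clique_word b) = Some \<beta> \<and>
    g_val I act \<nu> \<beta> b > 0 \<and>
    (\<forall>e. W \<alpha> (v @ [b, e]) = W \<alpha> (v @ [b]) * next_prob \<beta> b e)"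
proof -
  have n: "normal_list I (v @ [b])" using pos W_not_normal[of "v @ [b]" \<alpha>] by fastforce
  obtain \<gamma> where \<gamma>: "run (Some \<alpha>) (cliques_word v) = Some \<gamma>"
    using pos W_None[of \<alpha> v "[b]"] by fastforce
  have Wb: "W \<alpha> (v @ [b]) = F \<alpha> (cliques_word v) * H \<gamma> b" by (rule W_snoc[OF n \<gamma>])
  then have Hb: "H \<gamma> b > 0"
    using pos measure_nonneg[of "\<nu> \<alpha>"] by (simp add: zero_less_mult_iff)
  then obtain \<beta> where \<beta>: "run (Some \<gamma>) (clique_word b) = Some \<beta>" "clique I b" "b \<noteq> {}" "g_val I act \<nu> \<beta> b > 0"
    using stable_run stable_iff by blast
  have run: "run (Some \<alpha>) (cliques_word (v @ [b])) = Some \<beta>" using \<gamma> \<beta> by (simp add: run_append)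
  have "W \<alpha> (v @ [b, e]) = W \<alpha> (v @ [b]) * next_prob \<beta> b e" for e
  proof (cases "normal_list I ((v @ [b]) @ [e])")
    case True
    then have ar: "clique_arrow I b e" by (simp add: normal_list_def successively_append_iff)
    have "W \<alpha> ((v @ [b]) @ [e]) = F \<alpha> (cliques_word (v @ [b])) * H \<beta> e" by (rule W_snoc[OF True run])
    also have "F \<alpha> (cliques_word (v @ [b])) = F \<alpha> (cliques_word v) * F \<gamma> (clique_word b)"
      using F_append[OF \<gamma>] by simp
    finally show ?thesis using ar Wb H_eq_g[OF \<beta>(2,3,1)] \<beta>(4) by simp
  next
    case False
    have "H \<beta> e = 0" if ar: "clique_arrow I b e"
    proof (rule ccontr)
      assume "H \<beta> e \<noteq> 0"
      then have "H \<beta> e > 0" using measure_nonneg[of "\<nu> \<beta>"] by (simp add: order_less_le)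
      then have "normal_list I ((v @ [b]) @ [e])"
        using H_pos_run n ar by (auto simp: normal_list_def successively_append_iff)
      with False show False by simp
    qed
    then show ?thesis using W_not_normal[OF False, of \<alpha>] by simp
  qed
  with \<gamma> \<beta> show ?thesis by blast
qed

lemma node_in_recurrent:
  assumes J: "recurrent J" and start: "(\<alpha>, c) \<in> J"
  shows "W \<alpha> w > 0 \<Longrightarrow> w \<noteq> [] \<Longrightarrow> hd w = c \<Longrightarrow> node \<alpha> w \<in> J"
proof (induction w rule: rev_induct)
  case (snoc e w)
  show ?case
  proof (cases w rule: rev_cases)
    case Nil
    then show ?thesis using snoc.prems start by (simp add: node_def)
  next
    case (snoc v b)
    have Wb: "W \<alpha> (v @ [b]) > 0"
      using W_pos_prefix[of \<alpha> "v @ [b]" "[e]"] snoc.prems(1) by (simp add: snoc)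
    from W_step[OF Wb] obtain \<gamma> \<beta> where *: "run (Some \<alpha>) (cliques_word v) = Some \<gamma>" "run (Some \<gamma>) (clique_word b) = Some \<beta>"
      "g_val I act \<nu> \<beta> b > 0"
      "\<forall>e. W \<alpha> (v @ [b, e]) = W \<alpha> (v @ [b]) * next_prob \<beta> b e"
      by (elim exE conjE)
    have "hd w = c" using snoc.prems snoc by (cases v) auto
    then have in_J: "(\<gamma>, b) \<in> J" using snoc.IH Wb *(1) by (simp add: node_def snoc)
    have "W \<alpha> (v @ [b, e]) > 0" using snoc.prems by (simp add: snoc)
    then have "clique_arrow I b e" "H \<beta> e > 0"
      using *(3) *(4)[rule_format, of e] Wb by (auto simp: zero_less_mult_iff zero_less_divide_iff split: if_splits)
    then have "stable I act (\<beta>, e)" "sc_arrow I act (\<gamma>, b) (\<beta>, e)"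
      using stable_iff sc_arrow_iff[OF *(2)] by auto
    with J in_J have "(\<beta>, e) \<in> J" unfolding recurrent_def by blast
    then show ?thesis using *(1,2) by (simp add: node_def snoc run_append butlast_append)
  qed
qed simp

lemma AE_history_positive: "AE \<omega> in \<nu> \<alpha>. \<forall>n. W \<alpha> (map \<omega> [0..<n]) > 0"
proof -
  have "AE \<omega> in \<nu> \<alpha>. \<omega> \<in> elementary I w \<longrightarrow> W \<alpha> w > 0" for w
  proof (cases "W \<alpha> w > 0")
    case False
    then have "W \<alpha> w = 0" using measure_nonneg[of "\<nu> \<alpha>"] by (simp add: order_less_le)
    then have "AE \<omega> in \<nu> \<alpha>. \<omega> \<notin> elementary I w"
      using prob_space.prob_eq_0[OF prob_space_nu, of "elementary I w" \<alpha>] by simp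
    then show ?thesis by (elim eventually_mono) simp
  qed simp
  then have "AE \<omega> in \<nu> \<alpha>. \<forall>w. \<omega> \<in> elementary I w \<longrightarrow> W \<alpha> w > 0"
    by (simp add: AE_all_countable)
  moreover have "AE \<omega> in \<nu> \<alpha>. \<omega> \<in> boundary I" using AE_space[of "\<nu> \<alpha>"] by simp
  ultimately show ?thesis by eventually_elim (auto simp: elementary_iff)
qed

lemma measurable_coordinate [measurable]: "(\<lambda>\<omega>. \<omega> i) \<in> measurable (\<nu> \<alpha>) (count_space UNIV)"
proof (rule measurableI)
  fix A :: "'a set set"
  have "(\<lambda>\<omega>. \<omega> i) -` A \<inter> space (\<nu> \<alpha>) = {\<omega> \<in> boundary I. \<omega> i \<in> A}" by auto
  then show "(\<lambda>\<omega>. \<omega> i) -` A \<inter> space (\<nu> \<alpha>) \<in> sets (\<nu> \<alpha>)"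
    using sets_coordinate[of "\<lambda>c. c \<in> A" i] by simp
qed simp

text \<open>The Poisson equation writes the fluctuation of a letter count as a martingale plus a bounded term.\<close>

lemma AE_letter_frequency_start:
  assumes J: "recurrent J" and start: "(\<alpha>, c) \<in> J"
    and \<pi>: "irreducible_chain.stationary Q J \<pi>"
  shows "AE \<omega> in \<nu> \<alpha>. \<omega> 0 = c \<longrightarrow>
    frequency \<omega> a \<longlonglongrightarrow> (\<Sum>p\<in>J. \<pi> p * of_bool (a \<in> snd p))"
proof -
  interpret chain: irreducible_chain Q J by (rule irreducible_chain_recurrent[OF J])
  define \<theta> where "\<theta> = (\<Sum>p\<in>J. \<pi> p * of_bool (a \<in> snd p))"
  define \<phi> where "\<phi> p = (of_bool (a \<in> snd p) :: real)" for p :: "'s \<times> 'a set"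
  obtain u where u: "\<And>p. p \<in> J \<Longrightarrow> u p - (\<Sum>q\<in>J. Q p q * u q) = \<phi> p - \<theta>"
    using chain.poisson_equation[OF \<pi>, of \<phi>] unfolding \<theta>_def \<phi>_def by blast
  define v where "v p = (\<Sum>q\<in>J. Q p q * u q)" for p
  define U where "U = Max (range (\<lambda>p. \<bar>u p\<bar>))"
  define V where "V = Max (range (\<lambda>p. \<bar>v p\<bar>))"
  have U: "\<bar>u p\<bar> \<le> U" and V: "\<bar>v p\<bar> \<le> V" for p by (simp_all add: U_def V_def)
  define d where "d w = (if 2 \<le> length w then u (node \<alpha> w) - v (node \<alpha> (butlast w)) else 0)" for w
  have d_le: "\<bar>d w\<bar> \<le> U + V" for w
  proof (cases "2 \<le> length w")
    case True
    then have "d w = u (node \<alpha> w) - v (node \<alpha> (butlast w))" by (simp add: d_def)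
    with U[of "node \<alpha> w"] V[of "node \<alpha> (butlast w)"] show ?thesis by linarith
  next
    case False
    then have "d w = 0" by (simp add: d_def)
    with U[of "node \<alpha> w"] V[of "node \<alpha> (butlast w)"] show ?thesis by linarith
  qed
  have Hc: "H \<alpha> c > 0" using J start stable_iff by (auto simp: recurrent_def)
  define M where "M = uniform_measure (\<nu> \<alpha>) (first_is I c)"
  have first: "first_is I c \<in> sets (\<nu> \<alpha>)" by (simp add: first_is_elementary)
  have M_prob: "prob_space M"
    unfolding M_def using Hc by (intro prob_space_uniform_measure)
      (simp_all add: finite_measure.emeasure_eq_measure[OF finite_measure_nu])
  have M_sets [measurable_cong]: "sets M = sets (\<nu> \<alpha>)" and M_space: "space M = boundary I" by (simp_all add: M_def)
  have M_elementary: "measure M (elementary I w) = (if hd w = c then W \<alpha> w / H \<alpha> c else 0)" if "w \<noteq> []" for w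
  proof -
    have "measure M (elementary I w) = measure (\<nu> \<alpha>) (first_is I c \<inter> elementary I w) / H \<alpha> c"
      unfolding M_def using Hc first by (subst measure_uniform_measure)
        (simp_all add: finite_measure.emeasure_eq_measure[OF finite_measure_nu])
    also have "first_is I c \<inter> elementary I w = (if hd w = c then elementary I w else {})"
      using that by (auto simp: elementary_iff hd_conv_nth)
    finally show ?thesis by simp
  qed
  interpret M: prob_space M by (rule M_prob)
  have X: "(\<lambda>\<omega>. \<omega> i) \<in> measurable M (count_space UNIV)" for i by measurable
  have event: "{\<omega> \<in> space M. map (\<lambda>i. \<omega> i) [0..<Suc (length w)] = w @ [e]} = elementary I (w @ [e])" for w e
    unfolding M_space elementary_def by simp
  have "AE \<omega> in M. (\<lambda>n. (\<Sum>i<n. d (map (\<lambda>j. \<omega> j) [0..<Suc i])) / real n) \<longlonglongrightarrow> 0"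
  proof (rule M.AE_martingale_differences_average[OF X d_le])
    fix w
    show "(\<Sum>e\<in>UNIV. d (w @ [e]) * measure M {\<omega> \<in> space M. map (\<lambda>i. \<omega> i) [0..<Suc (length w)] = w @ [e]}) = 0"
    proof (cases "w \<noteq> [] \<and> hd w = c \<and> W \<alpha> w > 0")
      case True
      then obtain v' b where w: "w = v' @ [b]" by (metis rev_exhaust)
      have Wb: "W \<alpha> (v' @ [b]) > 0" using True w by simp
      from W_step[OF Wb] obtain \<gamma> \<beta> where *: "run (Some \<alpha>) (cliques_word v') = Some \<gamma>" "run (Some \<gamma>) (clique_word b) = Some \<beta>"
        "g_val I act \<nu> \<beta> b > 0"
        "\<forall>e. W \<alpha> (v' @ [b, e]) = W \<alpha> (v' @ [b]) * next_prob \<beta> b e"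
        by (elim exE conjE)
      let ?q = "\<lambda>e. next_prob \<beta> b e"
      have node_w: "node \<alpha> w = (\<gamma>, b)" using *(1) by (simp add: node_def w)
      have node_we: "node \<alpha> (w @ [e]) = (\<beta>, e)" for e using *(1,2) by (simp add: node_def w run_append butlast_append)
      have in_J: "(\<gamma>, b) \<in> J" using node_in_recurrent[OF J start, of w] True node_w by simp
      have q1: "(\<Sum>e\<in>UNIV. ?q e) = 1"
        using transition_sum[OF J in_J *(2), of "\<lambda>_. 1"] chain.row_sum[OF in_J] by simp
      have hd: "hd (w @ [e]) = c" for e using True by simp
      have "(\<Sum>e\<in>UNIV. d (w @ [e]) * measure M (elementary I (w @ [e])))
          = (\<Sum>e\<in>UNIV. (u (\<beta>, e) - v (\<gamma>, b)) * (W \<alpha> w * ?q e / H \<alpha> c))"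
      proof (rule sum.cong[OF refl])
        fix e
        have "d (w @ [e]) = u (\<beta>, e) - v (\<gamma>, b)"
          using True by (simp add: d_def node_we node_w Suc_le_eq)
        moreover have "measure M (elementary I (w @ [e])) = W \<alpha> w * ?q e / H \<alpha> c"
          using M_elementary[of "w @ [e]"] hd[of e] *(4)[rule_format, of e] by (simp add: w)
        ultimately show "d (w @ [e]) * measure M (elementary I (w @ [e])) = (u (\<beta>, e) - v (\<gamma>, b)) * (W \<alpha> w * ?q e / H \<alpha> c)"
          by (simp only:)
      qed
      also have "\<dots> = (\<Sum>e\<in>UNIV. (W \<alpha> w / H \<alpha> c) * (?q e * u (\<beta>, e)) - (W \<alpha> w / H \<alpha> c) * v (\<gamma>, b) * ?q e)"
      proof (rule sum.cong[OF refl])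
        have "(x - y) * (k * q / h) = (k / h) * (q * x) - (k / h) * y * q" for x y k q h :: real
          by (simp add: algebra_simps diff_divide_distrib)
        then show "(u (\<beta>, e) - v (\<gamma>, b)) * (W \<alpha> w * ?q e / H \<alpha> c)
            = (W \<alpha> w / H \<alpha> c) * (?q e * u (\<beta>, e)) - (W \<alpha> w / H \<alpha> c) * v (\<gamma>, b) * ?q e" for e .
      qed
      also have "\<dots> = (W \<alpha> w / H \<alpha> c) * (\<Sum>e\<in>UNIV. ?q e * u (\<beta>, e)) - (W \<alpha> w / H \<alpha> c) * v (\<gamma>, b) * (\<Sum>e\<in>UNIV. ?q e)"
        by (simp only: sum_subtractf sum_distrib_left)
      also have "\<dots> = 0"
        using transition_sum[OF J in_J *(2), of u] q1 by (simp add: v_def)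
      finally show ?thesis unfolding event .
    next
      case False
      have "d (w @ [e]) * measure M (elementary I (w @ [e])) = 0" for e
      proof (cases "w = []")
        case True
        then show ?thesis by (simp add: d_def)
      next
        case ne: False
        have "W \<alpha> (w @ [e]) = 0" if "hd w = c"
        proof (rule ccontr)
          assume "W \<alpha> (w @ [e]) \<noteq> 0"
          then have "W \<alpha> (w @ [e]) > 0" using measure_nonneg[of "\<nu> \<alpha>"] by (simp add: order_less_le)
          then show False using W_pos_prefix False ne that by blast
        qed
        then have "measure M (elementary I (w @ [e])) = 0"
          using M_elementary[of "w @ [e]"] ne by simp
        then show ?thesis by simp
      qed
      then show ?thesis unfolding event by (intro sum.neutral ballI)
    qed
  qed
  then have avg: "AE \<omega> in \<nu> \<alpha>. \<omega> \<in> first_is I c \<longrightarrow> (\<lambda>n. (\<Sum>i<n. d (map \<omega> [0..<Suc i])) / real n) \<longlonglongrightarrow> 0"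
    unfolding M_def using Hc first by (subst (asm) AE_uniform_measure)
      (simp_all add: finite_measure.emeasure_eq_measure[OF finite_measure_nu])
  have "AE \<omega> in \<nu> \<alpha>. \<omega> \<in> boundary I" using AE_space[of "\<nu> \<alpha>"] by simp
  with avg AE_history_positive[of \<alpha>] show ?thesis
  proof eventually_elim
    case (elim \<omega>)
    show ?case unfolding \<theta>_def[symmetric]
    proof
      assume c: "\<omega> 0 = c"
      define Y where "Y i = node \<alpha> (map \<omega> [0..<Suc i])" for i
      have Y_J: "Y i \<in> J" for i
        unfolding Y_def by (rule node_in_recurrent[OF J start])
          (use elim c in \<open>simp_all add: hd_map_upt del: upt_Suc\<close>)
      have Y_\<phi>: "\<phi> (Y i) = of_bool (a \<in> \<omega> i)" for i by (simp add: \<phi>_def Y_def node_def)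
      have d0: "d (map \<omega> [0..<Suc 0]) = 0" by (simp add: d_def)
      have dS: "d (map \<omega> [0..<Suc (Suc i)]) = u (Y (Suc i)) - v (Y i)" for i
      proof -
        have "butlast (map \<omega> [0..<Suc (Suc i)]) = map \<omega> [0..<Suc i]" by (simp add: butlast_append)
        then show ?thesis unfolding d_def Y_def by (simp del: upt_Suc)
      qed
      define D where "D n = (\<Sum>i<n. d (map \<omega> [0..<Suc i]))" for n
      have count: "real (count_list (word_upto \<omega> n) a) = (\<Sum>i<n. \<phi> (Y i))" for n
        by (induction n) (simp_all add: count_clique_word Y_\<phi>)
      have tele: "D (Suc n) = (\<Sum>i<n. \<phi> (Y i)) - real n * \<theta> + u (Y n) - u (Y 0)" for n
      proof (induction n)
        case 0
        show ?case by (simp add: D_def d0 del: upt_Suc)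
      next
        case (Suc n)
        have "D (Suc (Suc n)) = D (Suc n) + (u (Y (Suc n)) - v (Y n))"
          unfolding D_def sum.lessThan_Suc[of _ "Suc n"] dS ..
        also have "v (Y n) = u (Y n) - \<phi> (Y n) + \<theta>" using u[OF Y_J[of n]] by (simp add: v_def)
        finally show ?case using Suc by (simp add: algebra_simps)
      qed
      have "D (Suc n) = D n + d (map \<omega> [0..<Suc n])" for n by (simp add: D_def del: upt_Suc)
      then have eq: "real (count_list (word_upto \<omega> n) a) / real n - \<theta>
          = D n / real n + (d (map \<omega> [0..<Suc n]) - u (Y n) + u (Y 0)) / real n" if "n > 0" for n
        using that tele[of n] unfolding count by (simp add: field_simps del: upt_Suc)
      have "(\<lambda>n. (d (map \<omega> [0..<Suc n]) - u (Y n) + u (Y 0)) / real n) \<longlonglongrightarrow> 0"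
      proof (rule Lim_null_comparison)
        show "(\<lambda>n. (3 * U + V) / real n) \<longlonglongrightarrow> 0" by (rule lim_const_over_n)
        have "\<bar>d (map \<omega> [0..<Suc n]) - u (Y n) + u (Y 0)\<bar> \<le> 3 * U + V" for n
          using d_le[of "map \<omega> [0..<Suc n]"] U[of "Y n"] U[of "Y 0"] by linarith
        then show "eventually (\<lambda>n. norm ((d (map \<omega> [0..<Suc n]) - u (Y n) + u (Y 0)) / real n) \<le> (3 * U + V) / real n) sequentially"
          by (intro always_eventually allI) (simp add: divide_right_mono del: upt_Suc)
      qed
      moreover have "(\<lambda>n. D n / real n) \<longlonglongrightarrow> 0" using elim c unfolding D_def by simp
      ultimately have "(\<lambda>n. D n / real n + (d (map \<omega> [0..<Suc n]) - u (Y n) + u (Y 0)) / real n) \<longlonglongrightarrow> 0 + 0"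
        by (intro tendsto_add)
      then have "(\<lambda>n. real (count_list (word_upto \<omega> n) a) / real n - \<theta>) \<longlonglongrightarrow> 0"
        unfolding add_0
      proof (rule Lim_transform_eventually)
        show "eventually (\<lambda>n. D n / real n + (d (map \<omega> [0..<Suc n]) - u (Y n) + u (Y 0)) / real n
            = real (count_list (word_upto \<omega> n) a) / real n - \<theta>) sequentially"
          using eventually_gt_at_top[of 0] by eventually_elim (rule eq[symmetric])
      qed
      then show "frequency \<omega> a \<longlonglongrightarrow> \<theta>" by (simp add: LIM_zero_iff)
    qed
  qed
qed

lemma letter_in_recurrent:
  assumes J: "recurrent J" shows "\<exists>p\<in>J. a \<in> snd p"
proof -
  obtain \<alpha> c where start: "(\<alpha>, c) \<in> J" using J by (auto simp: recurrent_def)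
  then have Hc: "H \<alpha> c > 0" using J stable_iff by (auto simp: recurrent_def)
  have "\<exists>\<omega>\<in>first_is I c. (\<forall>n. W \<alpha> (map \<omega> [0..<n]) > 0) \<and> (\<forall>a. \<exists>i. a \<in> \<omega> i)"
  proof (rule ccontr)
    assume "\<not> ?thesis"
    moreover have "AE \<omega> in \<nu> \<alpha>. (\<forall>n. W \<alpha> (map \<omega> [0..<n]) > 0) \<and> (\<forall>a. \<exists>i. a \<in> \<omega> i)"
      using AE_history_positive AE_letters_occur by (rule AE_conjI)
    ultimately have "AE \<omega> in \<nu> \<alpha>. \<omega> \<notin> first_is I c" by (elim eventually_mono) blast
    then have "H \<alpha> c = 0"
      using prob_space.prob_eq_0[OF prob_space_nu, of "first_is I c" \<alpha>] by (simp add: first_is_elementary)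
    with Hc show False by simp
  qed
  then obtain \<omega> i where \<omega>: "\<omega> 0 = c" "\<And>n. W \<alpha> (map \<omega> [0..<n]) > 0" "a \<in> \<omega> i" by blast
  have "node \<alpha> (map \<omega> [0..<Suc i]) \<in> J"
    by (rule node_in_recurrent[OF J start \<omega>(2)]) (simp_all add: hd_map_upt \<omega>(1) del: upt_Suc)
  moreover have "a \<in> snd (node \<alpha> (map \<omega> [0..<Suc i]))" using \<omega> by (simp add: node_def)
  ultimately show ?thesis by blast
qed

definition irregular :: "('a \<Rightarrow> real) \<Rightarrow> (nat \<Rightarrow> 'a set) set" where
  "irregular \<theta> = {\<omega> \<in> boundary I.
     \<not> (\<forall>a. frequency \<omega> a \<longlonglongrightarrow> \<theta> a)}"

lemma sets_irregular: "irregular \<theta> \<in> sets (boundary_borel I)"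
proof -
  have [measurable]: "(\<lambda>\<omega>. real (count_list (word_upto \<omega> n) a)) \<in> borel_measurable (boundary_borel I)" for n a
  proof (induction n)
    case (Suc n)
    have "(\<lambda>\<omega>. indicator {\<omega> \<in> boundary I. a \<in> \<omega> n} \<omega> :: real) \<in> borel_measurable (boundary_borel I)"
      using sets_coordinate[of "\<lambda>c. a \<in> c" n] by simp
    then have "(\<lambda>\<omega>. real (of_bool (a \<in> \<omega> n))) \<in> borel_measurable (boundary_borel I)"
      by (rule measurable_cong[THEN iffD1, rotated]) (simp add: indicator_def)
    with Suc show ?case by (simp add: count_clique_word)
  qed simp
  have "irregular \<theta> = {\<omega> \<in> space (boundary_borel I). \<not> (\<forall>a. \<forall>k. \<exists>N. \<forall>n. N \<le> n \<longrightarrow>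
      \<bar>real (count_list (word_upto \<omega> n) a) / real n - \<theta> a\<bar> < inverse (real (Suc k)))}"
  proof -
    have "X \<longlonglongrightarrow> L \<longleftrightarrow> (\<forall>k. \<exists>N. \<forall>n. N \<le> n \<longrightarrow> \<bar>X n - L\<bar> < inverse (real (Suc k)))" for X :: "nat \<Rightarrow> real" and L
    proof
      assume "X \<longlonglongrightarrow> L"
      then show "\<forall>k. \<exists>N. \<forall>n. N \<le> n \<longrightarrow> \<bar>X n - L\<bar> < inverse (real (Suc k))"
        unfolding LIMSEQ_iff by (metis inverse_positive_iff_positive of_nat_0_less_iff real_norm_def zero_less_Suc)
    next
      assume *: "\<forall>k. \<exists>N. \<forall>n. N \<le> n \<longrightarrow> \<bar>X n - L\<bar> < inverse (real (Suc k))"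
      show "X \<longlonglongrightarrow> L" unfolding LIMSEQ_iff
      proof (intro allI impI)
        fix e :: real assume "0 < e"
        then obtain k where "inverse (real (Suc k)) < e" using reals_Archimedean by blast
        with * show "\<exists>N. \<forall>n\<ge>N. norm (X n - L) < e" by (metis less_trans real_norm_def)
      qed
    qed
    then show ?thesis unfolding irregular_def by simp
  qed
  also have "\<dots> \<in> sets (boundary_borel I)" by measurable
  finally show ?thesis .
qed

lemma lcats_irregular:
  assumes p: "\<forall>c\<in>set p. clique I c" and \<omega>: "\<omega> \<in> irregular \<theta>"
  shows "lcats I p \<omega> \<in> irregular \<theta>"
proof -
  have b: "\<omega> \<in> boundary I" "normal_seq I \<omega>" using \<omega> by (auto simp: irregular_def boundary_iff)
  obtain a where a: "\<not> frequency \<omega> a \<longlonglongrightarrow> \<theta> a"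
    using \<omega> by (auto simp: irregular_def)
  have "\<not> frequency (lcats I p \<omega>) a \<longlonglongrightarrow> \<theta> a"
  proof
    assume lim: "frequency (lcats I p \<omega>) a \<longlonglongrightarrow> \<theta> a"
    have "(\<lambda>n. real (count_list (word_upto \<omega> n) a) / real n - real (count_list (word_upto (lcats I p \<omega>) n) a) / real n) \<longlonglongrightarrow> 0"
    proof (rule Lim_null_comparison)
      show "(\<lambda>n. real (length p) / real n) \<longlonglongrightarrow> 0" by (rule lim_const_over_n)
      show "eventually (\<lambda>n. norm (real (count_list (word_upto \<omega> n) a) / real n - real (count_list (word_upto (lcats I p \<omega>) n) a) / real n)
          \<le> real (length p) / real n) sequentially"
        using lcats_count[OF p b(2), of _ a]
        by (intro always_eventually allI)
          (simp add: divide_right_mono abs_minus_commute flip: diff_divide_distrib)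
    qed
    from tendsto_add[OF this lim] a show False by simp
  qed
  then show ?thesis using lcats_boundary[OF p b(1)] by (auto simp: irregular_def)
qed

text \<open>A cylinder that forces the first clique to be \<open>c\<close> carries no mass of irregular
  traces. Removing its prefix gives the claim for one state, and prefixes leading to the other states spread
  it.\<close>

theorem AE_letter_frequency:
  assumes J: "recurrent J" and \<pi>: "irreducible_chain.stationary Q J \<pi>"
  shows "AE \<omega> in \<nu> \<gamma>. \<forall>a. frequency \<omega> a
    \<longlonglongrightarrow> (\<Sum>p\<in>J. \<pi> p * of_bool (a \<in> snd p))"
proof -
  define \<theta> where "\<theta> a = (\<Sum>p\<in>J. \<pi> p * of_bool (a \<in> snd p))" for a
  let ?B = "irregular \<theta>"
  have transfer: "F \<alpha> u * measure (\<nu> \<beta>) ?B \<le> measure (\<nu> \<alpha>) (?B \<inter> cylinder I (trace_of I u))"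
    if "run (Some \<alpha>) u = Some \<beta>" for \<alpha> u \<beta>
  proof -
    have cl: "\<forall>c\<in>set (letters u). clique I c" using clique_letters by blast
    have "F \<alpha> u * measure (\<nu> \<beta>) ?B = measure (\<nu> \<alpha>) (lcats I (letters u) ` ?B)"
      using measure_lcats[OF cl, of \<alpha> \<beta> ?B] that sets_irregular by simp
    also have "\<dots> \<le> measure (\<nu> \<alpha>) (?B \<inter> cylinder I (trace_of I u))"
    proof (rule finite_measure.finite_measure_mono[OF finite_measure_nu])
      show "lcats I (letters u) ` ?B \<subseteq> ?B \<inter> cylinder I (trace_of I u)"
        using lcats_irregular[OF cl] lcats_boundary_image[OF cl] by (auto simp: irregular_def)
    qed (auto intro!: sets.Int sets_irregular)
    finally show ?thesis .
  qed
  obtain \<alpha> c where start: "(\<alpha>, c) \<in> J" using J by (auto simp: recurrent_def)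
  then have "stable I act (\<alpha>, c)" using J by (auto simp: recurrent_def)
  from stable_witness[OF this] obtain u \<beta> where u: "run (Some \<alpha>) u = Some \<beta>"
    "cylinder I (trace_of I u) \<inter> boundary_from I act \<alpha> \<subseteq> first_is I c" by auto
  have "AE \<omega> in \<nu> \<alpha>. \<forall>a. \<omega> 0 = c \<longrightarrow> frequency \<omega> a \<longlonglongrightarrow> \<theta> a"
    unfolding AE_all_countable \<theta>_def using AE_letter_frequency_start[OF J start \<pi>] by blast
  then have "AE \<omega> in \<nu> \<alpha>. \<omega> \<notin> ?B \<inter> cylinder I (trace_of I u)"
    using AE_boundary_from[of \<alpha>]
  proof eventually_elim
    case (elim \<omega>)
    then show ?case using u(2) by (auto simp: irregular_def)
  qed
  moreover have "?B \<inter> cylinder I (trace_of I u) \<in> sets (\<nu> \<alpha>)"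
    by (simp add: sets.Int sets_irregular)
  ultimately have "measure (\<nu> \<alpha>) (?B \<inter> cylinder I (trace_of I u)) = 0"
    using prob_space.prob_eq_0[OF prob_space_nu] by blast
  then have "F \<alpha> u * measure (\<nu> \<beta>) ?B \<le> 0" using transfer[OF u(1)] by simp
  moreover have "F \<alpha> u > 0" using u(1) F_pos_iff by simp
  ultimately have B\<beta>: "measure (\<nu> \<beta>) ?B = 0"
    using measure_nonneg[of "\<nu> \<beta>" ?B] by (simp add: mult_le_0_iff order_antisym)
  obtain r where r: "run (Some \<beta>) r = Some \<gamma>" using reach_state by blast
  have "measure (\<nu> \<beta>) (?B \<inter> cylinder I (trace_of I r)) \<le> measure (\<nu> \<beta>) ?B"
    by (rule finite_measure.finite_measure_mono[OF finite_measure_nu]) (use sets_irregular in auto)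
  then have "F \<beta> r * measure (\<nu> \<gamma>) ?B \<le> 0" using transfer[OF r] B\<beta> by linarith
  moreover have "F \<beta> r > 0" using r F_pos_iff by simp
  ultimately have "measure (\<nu> \<gamma>) ?B = 0"
    using measure_nonneg[of "\<nu> \<gamma>" ?B] by (simp add: mult_le_0_iff order_antisym)
  then have "AE \<omega> in \<nu> \<gamma>. \<omega> \<notin> ?B"
    using prob_space.prob_eq_0[OF prob_space_nu, of ?B \<gamma>] sets_irregular by simp
  moreover have "AE \<omega> in \<nu> \<gamma>. \<omega> \<in> boundary I" using AE_space[of "\<nu> \<gamma>"] by simp
  ultimately show ?thesis unfolding \<theta>_def[symmetric] by eventually_elim (auto simp: irregular_def)
qed

end

section \<open>The speedup as a sum of letter frequencies\<close>

lemma length_eq_sum_count: "length w = (\<Sum>a\<in>UNIV. count_list w (a :: 'a::finite))"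
  by (rule sum_count_set[symmetric]) auto

lemma tle_length: "independence I \<Longrightarrow> tle I u v \<Longrightarrow> length u \<le> length (v :: 'a::finite list)" for I
  unfolding length_eq_sum_count by (intro sum_mono independence.tle_count)

lemma frequency_rescaled:
  fixes x :: "nat \<Rightarrow> real" and r :: real
  assumes x: "(\<lambda>n. x n / real n) \<longlonglongrightarrow> \<theta>" and r: "0 < r"
  shows "(\<lambda>m. x (nat \<lfloor>r * real m\<rfloor>) / real m) \<longlonglongrightarrow> r * \<theta>"
proof -
  define k where "k m = nat \<lfloor>r * real m\<rfloor>" for m
  have rm: "filterlim (\<lambda>m. r * real m) at_top sequentially"
    by (rule filterlim_tendsto_pos_mult_at_top[OF tendsto_const r filterlim_real_sequentially])
  have k_top: "filterlim k at_top sequentially"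
    unfolding k_def
    by (intro filterlim_compose[OF filterlim_nat_sequentially] filterlim_compose[OF filterlim_floor_sequentially rm])
  have kr: "r * real m - 1 \<le> real (k m)" "real (k m) \<le> r * real m" for m
  proof -
    have "real (k m) = real_of_int \<lfloor>r * real m\<rfloor>" using r by (simp add: k_def)
    then show "r * real m - 1 \<le> real (k m)" "real (k m) \<le> r * real m" by linarith+
  qed
  have "(\<lambda>m. real (k m) / real m) \<longlonglongrightarrow> r"
  proof (rule tendsto_sandwich)
    have "(\<lambda>m. r - 1 / real m) \<longlonglongrightarrow> r - 0" by (intro tendsto_diff tendsto_const lim_const_over_n)
    then show "(\<lambda>m. r - 1 / real m) \<longlonglongrightarrow> r" by simp
    show "eventually (\<lambda>m. r - 1 / real m \<le> real (k m) / real m) sequentially"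
      using eventually_gt_at_top[of 0]
    proof eventually_elim
      case (elim m)
      then have "(r - 1 / real m) * real m = r * real m - 1" by (simp add: left_diff_distrib)
      with kr(1)[of m] elim show ?case by (simp add: pos_le_divide_eq)
    qed
    show "eventually (\<lambda>m. real (k m) / real m \<le> r) sequentially"
      using eventually_gt_at_top[of 0] by eventually_elim (use kr(2) in \<open>simp add: pos_divide_le_eq\<close>)
  qed simp
  from tendsto_mult[OF this filterlim_compose[OF x k_top]]
  have "(\<lambda>m. real (k m) / real m * (x (k m) / real (k m))) \<longlonglongrightarrow> r * \<theta>" .
  moreover have "eventually (\<lambda>m. real (k m) / real m * (x (k m) / real (k m)) = x (k m) / real m) sequentially"
    using filterlim_at_top[THEN iffD1, OF k_top, rule_format, of 1]
    by eventually_elim simp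
  ultimately show ?thesis unfolding k_def by (rule Lim_transform_eventually)
qed

context irreducible_markov_system
begin

text \<open>An occurrence of \<open>b\<close> at level \<open>m\<close> or later lies above all earlier
  occurrences of the letters that depend on \<open>b\<close>.\<close>

lemma dependent_letter_absorbed:
  assumes y: "tle I y (word_upto \<omega> n)" and bc: "(b, c) \<notin> I"
    and b: "count_list (word_upto \<omega> m) b < count_list y b"
  shows "count_list (word_upto \<omega> m) c \<le> count_list y c"
proof -
  let ?w = "word_upto \<omega> m" and ?z = "word_upto \<omega> (max m n)"
  have count_proj: "count_list (proj b c v) b = count_list v b" "count_list (proj b c v) c = count_list v c" for v
    by (induction v) (auto simp: proj_Cons)
  have "tle I y ?z" using y word_upto_mono[of n "max m n"] tle_trans by fastforce
  moreover have "tle I ?w ?z" by (rule word_upto_mono) simp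
  ultimately have "prefix (proj b c y) (proj b c ?z)" "prefix (proj b c ?w) (proj b c ?z)"
    using bc unfolding tle_def by auto
  then consider "prefix (proj b c y) (proj b c ?w)" | "prefix (proj b c ?w) (proj b c y)"
    using prefix_same_cases by blast
  then show ?thesis
  proof cases
    case 1
    then have "count_list (proj b c y) b \<le> count_list (proj b c ?w) b" by (auto simp: prefix_def)
    with b show ?thesis by (simp add: count_proj)
  next
    case 2
    then have "count_list (proj b c ?w) c \<le> count_list (proj b c y) c" by (auto simp: prefix_def)
    then show ?thesis by (simp add: count_proj)
  qed
qed

text \<open>If every letter occurs in each of \<open>CARD('a)\<close> consecutive blocks of cliques, then a
  prefix that reaches beyond the last block contains everything before the first one: from block to block,
  downwards, the set of letters that the prefix contains up to there grows along the dependence graph.\<close>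

lemma prefix_beyond_blocks:
  assumes \<omega>: "\<omega> \<in> boundary I" and y: "tle I y (word_upto \<omega> n)"
    and blocks: "\<And>j a. j < CARD('a) \<Longrightarrow>
      count_list (word_upto \<omega> (l j)) a < count_list (word_upto \<omega> (l (Suc j))) a"
    and beyond: "l CARD('a) < ht y"
  shows "tle I (word_upto \<omega> (l 0)) y"
proof -
  let ?K = "CARD('a)"
  define S where "S i = {a. count_list (word_upto \<omega> (l i)) a < count_list y a}" for i
  have common: "tle I (word_upto \<omega> m) (word_upto \<omega> (max m n))" "tle I y (word_upto \<omega> (max m n))" for m
    using word_upto_mono[of m "max m n" I \<omega>] word_upto_mono[of n "max m n" I \<omega>] y tle_trans by auto
  have top: "S ?K \<noteq> {}"
  proof
    assume "S ?K = {}"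
    then have "count_list y a \<le> count_list (word_upto \<omega> (l ?K)) a" for a
      by (auto simp: S_def not_less)
    then have "tle I y (word_upto \<omega> (l ?K))" using tle_if_count_le[OF common(2,1)] by blast
    from height_mono[OF this] have "ht y \<le> l ?K" using height_word_upto[OF \<omega>] by simp
    with beyond show False by simp
  qed
  have down: "c \<in> S i" if "b \<in> S (Suc i)" "(b, c) \<notin> I" "i < ?K" for b c i
    using dependent_letter_absorbed[OF y that(2), of "l (Suc i)"] that(1) blocks[OF that(3), of c]
    by (simp add: S_def)
  have "S (?K - j) = UNIV \<or> j < card (S (?K - j))" if "j \<le> ?K" for j
    using that
  proof (induction j)
    case 0
    show ?case using top by (simp add: card_gt_0_iff)
  next
    case (Suc j)
    let ?i = "?K - Suc j"
    have i: "?K - j = Suc ?i" "?i < ?K" using Suc.prems by auto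
    have sub: "S (Suc ?i) \<subseteq> S ?i" using down[OF _ not_I_refl i(2)] by blast
    show ?case
    proof (cases "S (Suc ?i) = UNIV")
      case False
      then have card: "j < card (S (Suc ?i))" using Suc i by auto
      then have "S (Suc ?i) \<noteq> {}" by auto
      then obtain b c where "b \<in> S (Suc ?i)" "c \<notin> S (Suc ?i)" "(b, c) \<notin> I"
        using dependence_connected[OF _ False] by auto
      then have "S (Suc ?i) \<subset> S ?i" using down[OF _ _ i(2)] sub by blast
      then have "card (S (Suc ?i)) < card (S ?i)" by (rule psubset_card_mono[rotated]) simp
      with card show ?thesis by simp
    qed (use sub in auto)
  qed
  from this[of ?K] have "S 0 = UNIV \<or> ?K < card (S 0)" by simp
  moreover have "card (S 0) \<le> ?K" by (rule card_mono) auto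
  ultimately have "S 0 = UNIV" by auto
  then have "a \<in> S 0" for a by simp
  then have "count_list (word_upto \<omega> (l 0)) a \<le> count_list y a" for a
    by (simp add: S_def less_imp_le)
  then show ?thesis using tle_if_count_le[OF common] by blast
qed

lemma word_upto_in_traces_from:
  "\<omega> \<in> boundary_from I act \<alpha> \<Longrightarrow> trace_of I (word_upto \<omega> n) \<in> traces_from I act \<alpha>"
  unfolding boundary_from_def using trace_carrier
  by (metis (mono_tags, lifting) mem_Collect_eq prefix_of_iff tle_refl)

text \<open>Since all frequencies are positive, each letter occurs in every stretch of levels that is long in
  proportion to \<open>m\<close>, for large \<open>m\<close>. So a prefix of height \<open>m\<close> contains
  the first \<open>r m\<close> cliques and is contained in the first \<open>m\<close> cliques.\<close>

lemma speed_limit_sum_frequencies: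
  assumes \<omega>_from: "\<omega> \<in> boundary_from I act \<alpha>"
    and freq: "\<And>a. frequency \<omega> a \<longlonglongrightarrow> \<theta> a"
    and pos: "\<And>a. 0 < \<theta> a"
  shows "speed_limit I act \<alpha> \<omega> (\<Sum>a\<in>UNIV. \<theta> a)"
  unfolding speed_limit_def
proof (intro allI impI)
  fix \<epsilon> :: real assume \<epsilon>: "0 < \<epsilon>"
  let ?K = "CARD('a)"
  define s where "s = (\<Sum>a\<in>UNIV. \<theta> a)"
  have s: "0 < s" unfolding s_def by (rule sum_pos) (use pos in auto)
  have \<omega>: "\<omega> \<in> boundary I" using \<omega>_from by (simp add: boundary_from_def)
  then have nw: "normal_seq I \<omega>" by (simp add: boundary_iff)
  \<comment> \<open>\<open>r\<close> is the fraction of the levels that a prefix is shown to exhaust; the remaining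
    fraction \<open>1 - r\<close> is divided into \<open>CARD('a) + 1\<close> blocks.\<close>
  define r where "r = 1 - min (1 / 2) (\<epsilon> / (4 * s))"
  have r: "0 < r" "r < 1" using \<epsilon> s by (auto simp: r_def min_def)
  have rs: "s - \<epsilon> / 2 < r * s"
  proof -
    have "min (1 / 2) (\<epsilon> / (4 * s)) * s \<le> \<epsilon> / (4 * s) * s" using s by (intro mult_right_mono) auto
    also have "\<dots> = \<epsilon> / 4" using s by simp
    finally show ?thesis using \<epsilon> by (simp add: r_def algebra_simps)
  qed
  define \<rho> where "\<rho> j = r + (1 - r) * real j / real (Suc ?K)" for j
  have \<rho>_pos: "0 < \<rho> j" for j using r by (auto simp: \<rho>_def intro!: add_pos_nonneg divide_nonneg_nonneg mult_nonneg_nonneg)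
  have \<rho>_less: "\<rho> j < \<rho> (Suc j)" for j
    unfolding \<rho>_def using r by (intro add_strict_left_mono divide_strict_right_mono mult_strict_left_mono) auto
  have \<rho>_K: "\<rho> ?K < 1"
  proof -
    have "(1 - r) * real ?K / real (Suc ?K) < (1 - r) * 1"
      unfolding times_divide_eq_right[symmetric] using r by (intro mult_strict_left_mono) auto
    then show ?thesis by (simp add: \<rho>_def)
  qed
  define l where "l m j = nat \<lfloor>\<rho> j * real m\<rfloor>" for m j
  have lim: "(\<lambda>m. real (count_list (word_upto \<omega> (l m j)) a) / real m) \<longlonglongrightarrow> \<rho> j * \<theta> a" for j a
    unfolding l_def by (rule frequency_rescaled[OF freq \<rho>_pos])
  have len_lim: "(\<lambda>n. real (length (word_upto \<omega> n)) / real n) \<longlonglongrightarrow> s"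
    unfolding length_eq_sum_count s_def of_nat_sum sum_divide_distrib by (intro tendsto_sum freq)
  have low_lim: "(\<lambda>m. real (length (word_upto \<omega> (l m 0))) / real m) \<longlonglongrightarrow> r * s"
    using frequency_rescaled[OF len_lim \<rho>_pos[of 0]] by (simp add: l_def \<rho>_def)
  have "eventually (\<lambda>m. \<forall>j<?K. \<forall>a\<in>UNIV. count_list (word_upto \<omega> (l m j)) a < count_list (word_upto \<omega> (l m (Suc j))) a) sequentially"
  proof -
    have ev: "eventually (\<lambda>m. count_list (word_upto \<omega> (l m j)) a < count_list (word_upto \<omega> (l m (Suc j))) a) sequentially" for j a
    proof -
      have "0 < \<rho> (Suc j) * \<theta> a - \<rho> j * \<theta> a" using mult_strict_right_mono[OF \<rho>_less pos] by simp
      from order_tendstoD(1)[OF tendsto_diff[OF lim lim] this]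
      show ?thesis using eventually_gt_at_top[of 0]
      proof eventually_elim
        case (elim m)
        then have "real (count_list (word_upto \<omega> (l m j)) a) / real m < real (count_list (word_upto \<omega> (l m (Suc j))) a) / real m"
          by simp
        then show ?case using elim(2) by (simp add: divide_less_cancel)
      qed
    qed
    have "eventually (\<lambda>m. \<forall>j\<in>{..<?K}. \<forall>a\<in>UNIV. count_list (word_upto \<omega> (l m j)) a < count_list (word_upto \<omega> (l m (Suc j))) a) sequentially"
      by (intro eventually_ball_finite finite_lessThan finite ballI ev)
    then show ?thesis by (simp add: Ball_def)
  qed
  moreover have "eventually (\<lambda>m. real (length (word_upto \<omega> m)) / real m < s + \<epsilon>) sequentially"
    by (rule order_tendstoD(2)[OF len_lim]) (use \<epsilon> in simp)
  moreover have "eventually (\<lambda>m. s - \<epsilon> < real (length (word_upto \<omega> (l m 0))) / real m) sequentially"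
    by (rule order_tendstoD(1)[OF low_lim]) (use \<epsilon> rs in simp)
  moreover have "eventually (\<lambda>m. l m ?K < m) sequentially"
    using eventually_gt_at_top[of 0]
  proof eventually_elim
    case (elim m)
    have "\<rho> ?K * real m < 1 * real m" using \<rho>_K elim by (intro mult_strict_right_mono) auto
    then have "\<lfloor>\<rho> ?K * real m\<rfloor> < int m" by linarith
    then show ?case using elim by (simp add: l_def nat_less_iff)
  qed
  ultimately have "eventually (\<lambda>m. (\<forall>j<?K. \<forall>a\<in>UNIV. count_list (word_upto \<omega> (l m j)) a < count_list (word_upto \<omega> (l m (Suc j))) a)
      \<and> real (length (word_upto \<omega> m)) / real m < s + \<epsilon>
      \<and> s - \<epsilon> < real (length (word_upto \<omega> (l m 0))) / real m \<and> l m ?K < m) sequentially"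
    by eventually_elim blast
  then obtain M where M: "\<And>m j a. M \<le> m \<Longrightarrow> j < ?K \<Longrightarrow>
        count_list (word_upto \<omega> (l m j)) a < count_list (word_upto \<omega> (l m (Suc j))) a"
      "\<And>m. M \<le> m \<Longrightarrow> real (length (word_upto \<omega> m)) / real m < s + \<epsilon>"
      "\<And>m. M \<le> m \<Longrightarrow> s - \<epsilon> < real (length (word_upto \<omega> (l m 0))) / real m"
      "\<And>m. M \<le> m \<Longrightarrow> l m ?K < m"
    unfolding eventually_sequentially by blast
  let ?x = "trace_of I (word_upto \<omega> M)"
  have "\<bar>real (trace_length y) / real (height I y) - s\<bar> < \<epsilon>"
    if y: "y \<in> traces_from I act \<alpha>" "trace_le I ?x y" "prefix_of I y \<omega>" for y
  proof -
    obtain v where v: "y = trace_of I v" using y(1) unfolding traces_from_def carrier_trace_monoid by auto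
    let ?m = "ht v"
    have "tle I (word_upto \<omega> M) v" using y(2) by (simp add: v trace_le_iff_tle)
    then have m: "M \<le> ?m" using height_mono height_word_upto[OF \<omega>] by metis
    obtain n where n: "tle I v (word_upto \<omega> n)" using y(3) by (auto simp: v prefix_of_iff)
    have "length v \<le> length (word_upto \<omega> ?m)"
      by (rule tle_length[OF independence_axioms tle_word_upto_height[OF nw n]])
    then have "real (length v) / real ?m \<le> real (length (word_upto \<omega> ?m)) / real ?m"
      by (intro divide_right_mono) auto
    with M(2)[OF m] have upper: "real (length v) / real ?m < s + \<epsilon>" by linarith
    have "tle I (word_upto \<omega> (l ?m 0)) v"
      by (rule prefix_beyond_blocks[OF \<omega> n M(1)[OF m] M(4)[OF m]])
    from tle_length[OF independence_axioms this]
    have "real (length (word_upto \<omega> (l ?m 0))) / real ?m \<le> real (length v) / real ?m"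
      by (intro divide_right_mono) auto
    with M(3)[OF m] have "s - \<epsilon> < real (length v) / real ?m" by linarith
    with upper show ?thesis by (simp add: v trace_length_trace_of abs_less_iff)
  qed
  moreover have "prefix_of I ?x \<omega>" unfolding prefix_of_iff by (rule exI[of _ M]) simp
  ultimately show "\<exists>x\<in>traces_from I act \<alpha>. prefix_of I x \<omega> \<and>
        (\<forall>y\<in>traces_from I act \<alpha>. y \<noteq> \<one>\<^bsub>trace_monoid I\<^esub> \<and> trace_le I x y \<and> prefix_of I y \<omega> \<longrightarrow>
           \<bar>real (trace_length y) / real (height I y) - sum \<theta> UNIV\<bar> < \<epsilon>)"
    using word_upto_in_traces_from[OF \<omega>_from, of M] unfolding s_def by blast
qed

lemma speed_limit_unique:
  assumes \<omega>_from: "\<omega> \<in> boundary_from I act \<alpha>"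
    and "speed_limit I act \<alpha> \<omega> s" "speed_limit I act \<alpha> \<omega> t"
  shows "s = t"
proof (rule ccontr)
  assume "s \<noteq> t"
  define \<epsilon> where "\<epsilon> = \<bar>s - t\<bar> / 2"
  have \<epsilon>: "0 < \<epsilon>" using \<open>s \<noteq> t\<close> by (simp add: \<epsilon>_def)
  have \<omega>: "\<omega> \<in> boundary I" using \<omega>_from by (simp add: boundary_from_def)
  have *: "\<exists>n. \<forall>m\<ge>n. \<bar>real (trace_length (trace_of I (word_upto \<omega> m))) / real (ht (word_upto \<omega> m)) - s\<bar> < \<epsilon>"
    if "speed_limit I act \<alpha> \<omega> s" for s
  proof -
    from that \<epsilon> have "\<exists>x\<in>traces_from I act \<alpha>. prefix_of I x \<omega> \<and>
        (\<forall>y\<in>traces_from I act \<alpha>. y \<noteq> \<one>\<^bsub>trace_monoid I\<^esub> \<and> trace_le I x y \<and> prefix_of I y \<omega> \<longrightarrow>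
           \<bar>real (trace_length y) / real (height I y) - s\<bar> < \<epsilon>)"
      unfolding speed_limit_def by (elim allE impE)
    then obtain x where x: "x \<in> traces_from I act \<alpha>" "prefix_of I x \<omega>"
      "\<forall>y\<in>traces_from I act \<alpha>. y \<noteq> \<one>\<^bsub>trace_monoid I\<^esub> \<and> trace_le I x y \<and> prefix_of I y \<omega> \<longrightarrow>
           \<bar>real (trace_length y) / real (height I y) - s\<bar> < \<epsilon>"
      by (elim bexE conjE)
    obtain u where u: "x = trace_of I u" using x(1) unfolding traces_from_def carrier_trace_monoid by auto
    obtain n where n: "tle I u (word_upto \<omega> n)" using x(2) by (auto simp: u prefix_of_iff)
    show ?thesis
    proof (intro exI[of _ "Suc n"] allI impI)
      fix m assume m: "Suc n \<le> m"
      let ?y = "trace_of I (word_upto \<omega> m)"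
      have "tle I u (word_upto \<omega> m)" using n word_upto_mono[of n m] m tle_trans by fastforce
      then have "trace_le I x ?y" by (simp add: u trace_le_iff_tle)
      moreover have "?y \<noteq> \<one>\<^bsub>trace_monoid I\<^esub>"
      proof
        assume "?y = \<one>\<^bsub>trace_monoid I\<^esub>"
        then have "trace_of I (word_upto \<omega> m) = trace_of I (word_upto \<omega> 0)" by (simp add: one_trace)
        then have "m = 0" using height_word_upto[OF \<omega>, of m] height_word_upto[OF \<omega>, of 0] by simp
        with m show False by simp
      qed
      moreover have "prefix_of I ?y \<omega>" unfolding prefix_of_iff by (rule exI[of _ m]) simp
      ultimately show "\<bar>real (trace_length ?y) / real (height I ?y) - s\<bar> < \<epsilon>"
        using bspec[OF x(3) word_upto_in_traces_from[OF \<omega>_from, of m]] by simp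
    qed
  qed
  obtain m n where mn: "\<forall>k\<ge>m. \<bar>real (trace_length (trace_of I (word_upto \<omega> k))) / real (ht (word_upto \<omega> k)) - s\<bar> < \<epsilon>"
    "\<forall>k\<ge>n. \<bar>real (trace_length (trace_of I (word_upto \<omega> k))) / real (ht (word_upto \<omega> k)) - t\<bar> < \<epsilon>"
    using *[OF assms(2)] *[OF assms(3)] by blast
  have "\<bar>q - t\<bar> < \<epsilon> \<Longrightarrow> False" if "\<bar>q - s\<bar> < \<epsilon>" for q
  proof -
    assume "\<bar>q - t\<bar> < \<epsilon>"
    with that have "\<bar>q - s\<bar> + \<bar>q - t\<bar> < \<bar>s - t\<bar>" by (simp add: \<epsilon>_def)
    moreover have "\<bar>s - t\<bar> \<le> \<bar>q - s\<bar> + \<bar>q - t\<bar>" by linarith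
    ultimately show False by simp
  qed
  then show False using mn(1)[rule_format, OF max.cobounded1[of m n]] mn(2)[rule_format, OF max.cobounded2[of n m]]
    by blast
qed

lemma is_speedup_recurrent:
  assumes J: "recurrent J" and \<pi>: "invariant_distribution Q J \<pi>"
  shows "is_speedup I act \<nu> (\<Sum>(\<alpha>, d)\<in>J. real (card d) * pmf \<pi> (\<alpha>, d))"
proof -
  interpret chain: irreducible_chain Q J by (rule irreducible_chain_recurrent[OF J])
  have st: "chain.stationary (pmf \<pi>)" using \<pi> chain.invariant_distribution_iff by simp
  define \<theta> where "\<theta> a = (\<Sum>p\<in>J. pmf \<pi> p * of_bool (a \<in> snd p))" for a
  have \<theta>_pos: "0 < \<theta> a" for a
  proof -
    obtain p where p: "p \<in> J" "a \<in> snd p" using letter_in_recurrent[OF J] by blast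
    have "0 < pmf \<pi> p * of_bool (a \<in> snd p)" using chain.stationary_positive[OF st p(1)] p(2) by simp
    also have "\<dots> \<le> \<theta> a" unfolding \<theta>_def by (rule member_le_sum) (use p in auto)
    finally show ?thesis .
  qed
  have "(\<Sum>a\<in>UNIV. \<theta> a) = (\<Sum>p\<in>J. \<Sum>a\<in>UNIV. pmf \<pi> p * of_bool (a \<in> snd p))"
    unfolding \<theta>_def by (rule sum.swap)
  also have "\<dots> = (\<Sum>(\<alpha>, d)\<in>J. real (card d) * pmf \<pi> (\<alpha>, d))"
    by (rule sum.cong) (auto simp flip: sum_distrib_left)
  finally have e: "(\<Sum>(\<alpha>, d)\<in>J. real (card d) * pmf \<pi> (\<alpha>, d)) = (\<Sum>a\<in>UNIV. \<theta> a)" ..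
  show ?thesis unfolding is_speedup_def e
  proof
    fix \<alpha>
    show "AE \<omega> in \<nu> \<alpha>. \<omega> \<in> boundary_from I act \<alpha> \<and> speed_limit I act \<alpha> \<omega> (\<Sum>a\<in>UNIV. \<theta> a)"
      using AE_boundary_from[of \<alpha>] AE_letter_frequency[OF J st, of \<alpha>]
    proof eventually_elim
      case (elim \<omega>)
      then show ?case using speed_limit_sum_frequencies[of \<omega> \<alpha> \<theta>] \<theta>_pos unfolding \<theta>_def by blast
    qed
  qed
qed

lemma is_speedup_unique:
  assumes "is_speedup I act \<nu> s" "is_speedup I act \<nu> t" shows "s = t"
proof -
  fix \<alpha> :: 's
  have "AE \<omega> in \<nu> \<alpha>. s = t"
    using assms[unfolded is_speedup_def, rule_format, of \<alpha>]
    by eventually_elim (use speed_limit_unique in blast)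
  then show ?thesis
    using prob_space.ae_filter_bot[OF prob_space_nu] eventually_happens' by blast
qed

lemma speedup_formula:
  "(\<exists>!s. is_speedup I act \<nu> s) \<and>
    (\<forall>J. final_component (DSC_plus I act) J \<longrightarrow>
      (\<exists>!\<pi>. invariant_distribution Q J \<pi>) \<and>
      (\<forall>\<pi>. invariant_distribution Q J \<pi> \<longrightarrow>
        speedup I act \<nu> = (\<Sum>(\<alpha>, d)\<in>J. real (card d) * pmf \<pi> (\<alpha>, d))))"
proof (intro conjI allI impI)
  have ex1: "\<exists>!\<pi>. invariant_distribution Q J \<pi>" if "recurrent J" for J
    using irreducible_chain.invariant_distribution_ex1[OF irreducible_chain_recurrent[OF that]] .
  obtain J where J: "recurrent J" using recurrent_exists by blast
  then show "\<exists>!s. is_speedup I act \<nu> s"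
    using ex1[OF J] is_speedup_recurrent[OF J] is_speedup_unique by blast
  fix J assume "final_component (DSC_plus I act) J"
  then have J: "recurrent J" by (rule recurrent_if_final_component)
  show "\<exists>!\<pi>. invariant_distribution Q J \<pi>" by (rule ex1[OF J])
  fix \<pi> assume "invariant_distribution Q J \<pi>"
  then have s: "is_speedup I act \<nu> (\<Sum>(\<alpha>, d)\<in>J. real (card d) * pmf \<pi> (\<alpha>, d))"
    by (rule is_speedup_recurrent[OF J])
  show "speedup I act \<nu> = (\<Sum>(\<alpha>, d)\<in>J. real (card d) * pmf \<pi> (\<alpha>, d))"
    unfolding speedup_def using s is_speedup_unique by (intro the_equality) auto
qed

end

theorem proposition5p11:
  fixes I :: "('a::finite \<times> 'a) set"
    and act :: "'s::finite option \<Rightarrow> 'a list set \<Rightarrow> 's option"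
    and \<nu> :: "'s \<Rightarrow> (nat \<Rightarrow> 'a set) measure"
  assumes "concurrent_system I act"
    and "irreducible_system I act"
    and "markov_measure I act \<nu>"
  shows "(\<exists>!s. is_speedup I act \<nu> s) \<and>
    (\<forall>J. final_component (DSC_plus I act) J \<longrightarrow>
      (\<exists>!\<pi>. invariant_distribution (transition I act \<nu>) J \<pi>) \<and>
      (\<forall>\<pi>. invariant_distribution (transition I act \<nu>) J \<pi> \<longrightarrow>
        speedup I act \<nu> = (\<Sum>(\<alpha>, d)\<in>J. real (card d) * pmf \<pi> (\<alpha>, d))))"
proof -
  interpret concurrent_system I act by (rule assms(1))
  interpret irreducible_markov_system I act \<nu>
    by unfold_locales (rule assms(3), rule assms(2))
  show ?thesis by (rule speedup_formula)
qed

end
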